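(* Let $F$ be an infinite field of characteristic different from $2$. The ideal $I_w\subset F\langle X\rangle$ of the weak polynomial identities of the superalgebra $M_{1,1}(E)$ (i.e. of the pair $(R,W)$) is $\Omega$-generated by the two polynomials $$c_3=[x_1,x_2,x_3]\quad\text{and}\quad p=[x_2,x_1][x_3,x_1][x_4,x_1],$$ that is, $I_w$ is the smallest $\Omega$-stable two-sided ideal of $F\langle X\rangle$ containing $c_3$ and $p$. Moreover, for every integer $k>0$, the Hilbert series of the algebra $B_k(I_w)$ is $$H(B_k(I_w),t_1,\ldots,t_k)=\frac12\sum_{i=0}^{k}\left[e_i(t_1,\ldots,t_k)^2+(-1)^i e_i(t_1^2,\ldots,t_k^2)\right],$$ where $e_i(t_1,\ldots,t_k)$ is the $i$-th elementary symmetric function.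
   Context: $F\langle X\rangle$ is the free unital associative $F$-algebra on $X=\{x_1,x_2,\ldots\}$. Commutators are $[u,v]=uv-vu$, left-normed: $[x_1,x_2,x_3]=[[x_1,x_2],x_3]$, etc. $E=E_0\oplus E_1$ is the (unital) Grassmann algebra generated by a vector space of countably infinite dimension over $F$, with its $\mathbb{Z}_2$-homogeneous components $E_0$ (even) and $E_1$ (odd). Put $$R=M_{1,1}(E)=\left\{\begin{pmatrix}a&b\\c&d\end{pmatrix}\;\middle|\;a,d\in E_0,\ b,c\in E_1\right\},\qquad \mathrm{str}\begin{pmatrix}a&b\\c&d\end{pmatrix}=a-d,$$ and $W=\{A\in R\mid \mathrm{str}(A)=0\}$. A polynomial $f(x_1,\ldots,x_n)\in F\langle X\rangle$ is a weak polynomial identity for the pair $(R,W)$ if $f(w_1,\ldots,w_n)=0$ for all $w_1,\ldots,w_n\in W$; $I_w=I(R,W)$ is the two-sided ideal of all such polynomials. $\Omega$ is the $F$-linear span of $X\cup\{1\}$ in $F\langle X\rangle$. An ideal of $F\langle X\rangle$ is $\Omega$-stable if it is mapped into itself by every algebra endomorphism of $F\langle X\rangle$ sending each $x_i$ to an element of $\Omega$. The ideal $\Omega$-generated by a set $G$ is the smallest $\Omega$-stable ideal containing $G$. $B$ is the (unital) subalgebra of $F\langle X\rangle$ generated by all commutators $[x_{i_1},\ldots,x_{i_l}]$ of length $l\ge 2$; $B_k=B\cap F\langle x_1,\ldots,x_k\rangle$ and $B_k(I_w)=B_k/(B_k\cap I_w)$. The algebra $B_k(I_w)$ is multigraded: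 its component $B_k^{(n_1,\ldots,n_k)}(I_w)$ is the image of the polynomials in $B_k$ that are homogeneous of degree $n_i$ in $x_i$ for each $i$. Its Hilbert series is the formal power series $H(B_k(I_w),t_1,\ldots,t_k)=\sum_{(n_1,\ldots,n_k)\in\mathbb{Z}_{\ge0}^k}\dim_F B_k^{(n_1,\ldots,n_k)}(I_w)\,t_1^{n_1}\cdots t_k^{n_k}$. *)

theory Defs
  imports "HOL-Analysis.Cartesian_Space" "HOL-Library.Poly_Mapping"
begin

section \<open>The free associative algebra\<close>

text \<open>Noncommutative monomials are words. The letter \<open>i\<close> stands for the variable
  \<open>x\<^bsub>i+1\<^esub>\<close>, so the variables \<open>x\<^sub>1, ..., x\<^sub>k\<close> are the letters below \<open>k\<close>. The wrapper type
  carries the (additively written) concatenation monoid, so that convolution on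
  \<^typ>\<open>'b \<Rightarrow>\<^sub>0 'a\<close> is the product of the free algebra.\<close>

datatype word = Word (letters: "nat list")

instantiation word :: monoid_add
begin

definition zero_word :: word where "0 = Word []"
definition plus_word :: "word \<Rightarrow> word \<Rightarrow> word" where "u + v = Word (letters u @ letters v)"

instance by standard (auto simp: zero_word_def plus_word_def)

end

type_synonym 'a free_alg = "word \<Rightarrow>\<^sub>0 'a"

definition var :: "nat \<Rightarrow> 'a::field free_alg"
  where "var i = Poly_Mapping.single (Word [i]) 1"

definition scale_free :: "'a::field \<Rightarrow> 'a free_alg \<Rightarrow> 'a free_alg"
  where "scale_free c f = Poly_Mapping.single 0 c * f"

global_interpretation free: vector_space "scale_free :: 'a::field \<Rightarrow> _"
  defines free_span = free.span and free_subspace = free.subspace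
  by standard (simp_all add: scale_free_def algebra_simps single_add mult_single
      flip: mult.assoc)

definition commutator :: "'b::ring \<Rightarrow> 'b \<Rightarrow> 'b"
  where "commutator u v = u * v - v * u"

text \<open>\<open>long_commutator i [j, k, \<dots>]\<close> is the left-normed commutator of the variables
  with indices \<open>i, j, k, \<dots>\<close>.\<close>

definition long_commutator :: "nat \<Rightarrow> nat list \<Rightarrow> 'a::field free_alg"
  where "long_commutator i js = foldl commutator (var i) (map var js)"

definition two_sided_ideal :: "'b::ring_1 set \<Rightarrow> bool"
  where "two_sided_ideal I \<longleftrightarrow> 0 \<in> I \<and> (\<forall>f\<in>I. \<forall>g\<in>I. f + g \<in> I)
    \<and> (\<forall>f\<in>I. \<forall>g. g * f \<in> I \<and> f * g \<in> I)"

definition algebra_endomorphism :: "('a::field free_alg \<Rightarrow> 'a free_alg) \<Rightarrow> bool"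
  where "algebra_endomorphism \<phi> \<longleftrightarrow> Vector_Spaces.linear scale_free scale_free \<phi>
    \<and> \<phi> 1 = 1 \<and> (\<forall>f g. \<phi> (f * g) = \<phi> f * \<phi> g)"

definition Omega :: "'a::field free_alg set"
  where "Omega = free_span (insert 1 (range var))"

definition Omega_stable :: "'a::field free_alg set \<Rightarrow> bool"
  where "Omega_stable I \<longleftrightarrow>
    (\<forall>\<phi>. algebra_endomorphism \<phi> \<and> (\<forall>i. \<phi> (var i) \<in> Omega) \<longrightarrow> \<phi> ` I \<subseteq> I)"

definition Omega_ideal :: "'a::field free_alg set \<Rightarrow> bool"
  where "Omega_ideal I \<longleftrightarrow> two_sided_ideal I \<and> Omega_stable I"

definition Omega_generated :: "'a::field free_alg set \<Rightarrow> 'a free_alg set"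
  where "Omega_generated G = Omega_ideal hull G"

lemma Omega_ideal_Omega_generated: "Omega_ideal (Omega_generated G)"
  unfolding Omega_generated_def
  by (rule hull_in) (fastforce simp: Omega_ideal_def two_sided_ideal_def Omega_stable_def)

definition subalgebra :: "'a::field free_alg set \<Rightarrow> bool"
  where "subalgebra S \<longleftrightarrow> free_subspace S \<and> 1 \<in> S \<and> (\<forall>f\<in>S. \<forall>g\<in>S. f * g \<in> S)"

definition proper_polys :: "'a::field free_alg set"
  where "proper_polys = subalgebra hull {long_commutator i js | i js. js \<noteq> []}"

lemma subalgebra_proper_polys: "subalgebra proper_polys"
  unfolding proper_polys_def
  by (rule hull_in) (auto simp: subalgebra_def intro: free.subspace_Inter)

definition polys_in :: "nat \<Rightarrow> 'a::field free_alg set"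
  where "polys_in k = {f. \<forall>m\<in>Poly_Mapping.keys f. set (letters m) \<subseteq> {..<k}}"

definition B_polys :: "nat \<Rightarrow> 'a::field free_alg set"
  where "B_polys k = proper_polys \<inter> polys_in k"

definition multihomogeneous :: "(nat \<Rightarrow>\<^sub>0 nat) \<Rightarrow> 'a::field free_alg \<Rightarrow> bool"
  where "multihomogeneous n f \<longleftrightarrow>
    (\<forall>m\<in>Poly_Mapping.keys f. \<forall>i. count_list (letters m) i = Poly_Mapping.lookup n i)"


section \<open>The Grassmann algebra\<close>

text \<open>An element is its coefficient function with respect to the basis of monomials
  \<open>e\<^sub>S = e\<^bsub>s\<^sub>1\<^esub> \<cdots> e\<^bsub>s\<^sub>r\<^esub>\<close>, where \<open>S = {s\<^sub>1 < \<cdots> < s\<^sub>r}\<close> runs through the finite sets of natural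
  numbers and \<open>e\<^sub>0, e\<^sub>1, \<dots>\<close> is a basis of the generating vector space.\<close>

typedef (overloaded) 'a grassmann =
  "{f :: nat set \<Rightarrow> 'a::zero. finite {S. f S \<noteq> 0} \<and> (\<forall>S. f S \<noteq> 0 \<longrightarrow> finite S)}"
  morphisms coeff_grassmann Abs_grassmann
  by (rule exI[of _ "\<lambda>_. 0"]) simp

setup_lifting type_definition_grassmann

definition inversions :: "nat set \<Rightarrow> nat set \<Rightarrow> nat"
  where "inversions S T = card {(s, t) \<in> S \<times> T. t < s}"

lemma inversions_Un_left:
  assumes "finite S" "finite S'" "finite T" "S \<inter> S' = {}"
  shows "inversions (S \<union> S') T = inversions S T + inversions S' T"
proof -
  have "{(s, t) \<in> (S \<union> S') \<times> T. t < s} = {(s, t) \<in> S \<times> T. t < s} \<union> {(s, t) \<in> S' \<times> T. t < s}"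
    by auto
  moreover have "finite {(s, t) \<in> A \<times> T. t < s}" if "finite A" for A
    by (rule finite_subset[of _ "A \<times> T"]) (use that assms in auto)
  ultimately show ?thesis
    unfolding inversions_def using assms by (auto intro!: card_Un_disjoint)
qed

lemma inversions_Un_right:
  assumes "finite S" "finite T" "finite T'" "T \<inter> T' = {}"
  shows "inversions S (T \<union> T') = inversions S T + inversions S T'"
proof -
  have "{(s, t) \<in> S \<times> (T \<union> T'). t < s} = {(s, t) \<in> S \<times> T. t < s} \<union> {(s, t) \<in> S \<times> T'. t < s}"
    by auto
  moreover have "finite {(s, t) \<in> S \<times> A. t < s}" if "finite A" for A
    by (rule finite_subset[of _ "S \<times> A"]) (use that assms in auto)
  ultimately show ?thesis
    unfolding inversions_def using assms by (auto intro!: card_Un_disjoint)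
qed

lemma inversions_empty [simp]: "inversions {} T = 0" "inversions S {} = 0"
  by (simp_all add: inversions_def)

instantiation grassmann :: (comm_ring_1) ring_1
begin

lift_definition zero_grassmann :: "'a grassmann" is "\<lambda>_. 0" by simp

lift_definition one_grassmann :: "'a grassmann" is "\<lambda>S. if S = {} then 1 else 0" by auto

lift_definition plus_grassmann :: "'a grassmann \<Rightarrow> 'a grassmann \<Rightarrow> 'a grassmann"
  is "\<lambda>f g S. f S + g S"
proof -
  fix f g :: "nat set \<Rightarrow> 'a"
  assume a: "finite {S. f S \<noteq> 0} \<and> (\<forall>S. f S \<noteq> 0 \<longrightarrow> finite S)"
    "finite {S. g S \<noteq> 0} \<and> (\<forall>S. g S \<noteq> 0 \<longrightarrow> finite S)"
  have "{S. f S + g S \<noteq> 0} \<subseteq> {S. f S \<noteq> 0} \<union> {S. g S \<noteq> 0}" by auto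
  with a show "finite {S. f S + g S \<noteq> 0} \<and> (\<forall>S. f S + g S \<noteq> 0 \<longrightarrow> finite S)"
    by (metis (mono_tags, lifting) add.right_neutral finite_Un finite_subset)
qed

lift_definition uminus_grassmann :: "'a grassmann \<Rightarrow> 'a grassmann" is "\<lambda>f S. - f S" by simp

lift_definition minus_grassmann :: "'a grassmann \<Rightarrow> 'a grassmann \<Rightarrow> 'a grassmann"
  is "\<lambda>f g S. f S - g S"
proof -
  fix f g :: "nat set \<Rightarrow> 'a"
  assume a: "finite {S. f S \<noteq> 0} \<and> (\<forall>S. f S \<noteq> 0 \<longrightarrow> finite S)"
    "finite {S. g S \<noteq> 0} \<and> (\<forall>S. g S \<noteq> 0 \<longrightarrow> finite S)"
  have "{S. f S - g S \<noteq> 0} \<subseteq> {S. f S \<noteq> 0} \<union> {S. g S \<noteq> 0}" by auto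
  with a show "finite {S. f S - g S \<noteq> 0} \<and> (\<forall>S. f S - g S \<noteq> 0 \<longrightarrow> finite S)"
    by (metis (mono_tags, lifting) diff_zero finite_Un finite_subset)
qed

text \<open>\<open>e\<^sub>S e\<^sub>T\<close> is \<open>\<plusminus> e\<^bsub>S \<union> T\<^esub>\<close> for disjoint \<open>S, T\<close>, with the sign of the sorting permutation,
  and \<open>0\<close> otherwise. If \<open>U\<close> is infinite, so is \<open>Pow U\<close>, and the sum is \<open>0\<close>.\<close>

lift_definition times_grassmann :: "'a grassmann \<Rightarrow> 'a grassmann \<Rightarrow> 'a grassmann"
  is "\<lambda>f g U. \<Sum>S\<in>Pow U. (- 1) ^ inversions S (U - S) * f S * g (U - S)"
proof -
  fix f g :: "nat set \<Rightarrow> 'a"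
  assume a: "finite {S. f S \<noteq> 0} \<and> (\<forall>S. f S \<noteq> 0 \<longrightarrow> finite S)"
    "finite {S. g S \<noteq> 0} \<and> (\<forall>S. g S \<noteq> 0 \<longrightarrow> finite S)"
  let ?h = "\<lambda>U. \<Sum>S\<in>Pow U. (- 1) ^ inversions S (U - S) * f S * g (U - S)"
  have sub: "{U. ?h U \<noteq> 0} \<subseteq> (\<lambda>(S, T). S \<union> T) ` ({S. f S \<noteq> 0} \<times> {S. g S \<noteq> 0})"
  proof
    fix U assume "U \<in> {U. ?h U \<noteq> 0}"
    then obtain S where "S \<in> Pow U" "(- 1) ^ inversions S (U - S) * f S * g (U - S) \<noteq> 0"
      by (metis (mono_tags, lifting) mem_Collect_eq sum.neutral)
    then have "f S \<noteq> 0" "g (U - S) \<noteq> 0" "U = S \<union> (U - S)" by auto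
    then show "U \<in> (\<lambda>(S, T). S \<union> T) ` ({S. f S \<noteq> 0} \<times> {S. g S \<noteq> 0})"
      by (intro image_eqI[of _ _ "(S, U - S)"]) auto
  qed
  have "finite {U. ?h U \<noteq> 0}"
    by (rule finite_subset[OF sub]) (use a in auto)
  moreover have "finite U" if "?h U \<noteq> 0" for U
    using that by (metis finite_Pow_iff sum.infinite)
  ultimately show "finite {U. ?h U \<noteq> 0} \<and> (\<forall>U. ?h U \<noteq> 0 \<longrightarrow> finite U)" by blast
qed

instance
proof
  fix a b c :: "'a grassmann"
  show "a + b + c = a + (b + c)" "a + b = b + a" "0 + a = a" "- a + a = 0" "a - b = a + - b"
    by (transfer, simp add: fun_eq_iff add_ac)+
  show "(0 :: 'a grassmann) \<noteq> 1"
    by transfer (metis zero_neq_one)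
  show "(a + b) * c = a * c + b * c" "a * (b + c) = a * b + a * c"
    by (transfer, simp add: algebra_simps sum.distrib fun_eq_iff)+
  show "1 * a = a"
  proof (transfer, rule ext)
    fix f :: "nat set \<Rightarrow> 'a" and U
    assume f: "finite {S. f S \<noteq> 0} \<and> (\<forall>S. f S \<noteq> 0 \<longrightarrow> finite S)"
    show "(\<Sum>S\<in>Pow U. (- 1) ^ inversions S (U - S) * (if S = {} then 1 else 0) * f (U - S)) = f U"
    proof (cases "finite U")
      case True
      have "(\<Sum>S\<in>Pow U. (- 1) ^ inversions S (U - S) * (if S = {} then 1 else 0) * f (U - S))
        = (\<Sum>S\<in>Pow U. if S = {} then f U else 0)"
        by (rule sum.cong) auto
      with True show ?thesis by simp
    qed (use f in auto)
  qed
  show "a * 1 = a"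
  proof (transfer, rule ext)
    fix f :: "nat set \<Rightarrow> 'a" and U
    assume f: "finite {S. f S \<noteq> 0} \<and> (\<forall>S. f S \<noteq> 0 \<longrightarrow> finite S)"
    show "(\<Sum>S\<in>Pow U. (- 1) ^ inversions S (U - S) * f S * (if U - S = {} then 1 else 0)) = f U"
    proof (cases "finite U")
      case True
      have "(\<Sum>S\<in>Pow U. (- 1) ^ inversions S (U - S) * f S * (if U - S = {} then 1 else 0))
        = (\<Sum>S\<in>Pow U. if S = U then f U else 0)"
        by (rule sum.cong) auto
      with True show ?thesis by simp
    qed (use f in auto)
  qed
  show "a * b * c = a * (b * c)"
  proof (transfer, rule ext)
    fix f g h :: "nat set \<Rightarrow> 'a" and U
    let ?e = "\<lambda>S T. (- 1 :: 'a) ^ inversions S T"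
    show "(\<Sum>S\<in>Pow U. ?e S (U - S) * (\<Sum>T\<in>Pow S. ?e T (S - T) * f T * g (S - T)) * h (U - S))
      = (\<Sum>T\<in>Pow U. ?e T (U - T) * f T * (\<Sum>V\<in>Pow (U - T). ?e V (U - T - V) * g V * h (U - T - V)))"
    proof (cases "finite U")
      case fin: True
      have "(\<Sum>S\<in>Pow U. ?e S (U - S) * (\<Sum>T\<in>Pow S. ?e T (S - T) * f T * g (S - T)) * h (U - S))
        = (\<Sum>S\<in>Pow U. \<Sum>T\<in>Pow S. ?e S (U - S) * ?e T (S - T) * f T * g (S - T) * h (U - S))"
        by (simp add: sum_distrib_left sum_distrib_right mult.assoc)
      also have "\<dots> = (\<Sum>(S, T)\<in>(SIGMA S:Pow U. Pow S).
          ?e S (U - S) * ?e T (S - T) * f T * g (S - T) * h (U - S))"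
        using fin by (subst sum.Sigma) (auto intro: finite_subset)
      also have "\<dots> = (\<Sum>(T, V)\<in>(SIGMA T:Pow U. Pow (U - T)).
          ?e T (U - T) * ?e V (U - T - V) * f T * g V * h (U - T - V))"
      proof (rule sum.reindex_bij_witness[where j = "\<lambda>(S, T). (T, S - T)" and i = "\<lambda>(T, V). (T \<union> V, T)"], goal_cases)
        case (5 z)
        then obtain S T where z: "z = (S, T)" "T \<subseteq> S" "S \<subseteq> U" by auto
        have f: "finite T" "finite (S - T)" "finite (U - S)"
          using z fin by (auto intro: finite_subset)
        have s: "inversions S (U - S) = inversions T (U - S) + inversions (S - T) (U - S)"
          using inversions_Un_left[OF f(1,2,3)] z by (simp add: Un_absorb1)
        have "U - T = (S - T) \<union> (U - S)" using z by auto
        then have t: "inversions T (U - T) = inversions T (S - T) + inversions T (U - S)"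
          using inversions_Un_right[OF f(1,2,3)] by auto
        have "U - T - (S - T) = U - S" using z by auto
        then show ?case
          by (simp add: z s t power_add mult_ac)
      qed auto
      also have "\<dots> = (\<Sum>T\<in>Pow U. \<Sum>V\<in>Pow (U - T).
          ?e T (U - T) * ?e V (U - T - V) * f T * g V * h (U - T - V))"
        using fin by (subst sum.Sigma) (auto intro: finite_subset)
      also have "\<dots> = (\<Sum>T\<in>Pow U. ?e T (U - T) * f T *
          (\<Sum>V\<in>Pow (U - T). ?e V (U - T - V) * g V * h (U - T - V)))"
        by (simp add: sum_distrib_left mult_ac)
      finally show ?thesis .
    qed auto
  qed
qed

end

lift_definition scale_grassmann :: "'a::comm_ring_1 \<Rightarrow> 'a grassmann \<Rightarrow> 'a grassmann"
  is "\<lambda>c f S. c * f S"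
proof -
  fix c :: 'a and f :: "nat set \<Rightarrow> 'a"
  assume a: "finite {S. f S \<noteq> 0} \<and> (\<forall>S. f S \<noteq> 0 \<longrightarrow> finite S)"
  have "{S. c * f S \<noteq> 0} \<subseteq> {S. f S \<noteq> 0}" by auto
  with a show "finite {S. c * f S \<noteq> 0} \<and> (\<forall>S. c * f S \<noteq> 0 \<longrightarrow> finite S)"
    by (metis finite_subset mult_zero_right)
qed

lemma scale_grassmann_simps:
  "scale_grassmann c (a + b) = scale_grassmann c a + scale_grassmann c b"
  "scale_grassmann (c + d) a = scale_grassmann c a + scale_grassmann d a"
  "scale_grassmann c a * scale_grassmann d b = scale_grassmann (c * d) (a * b)"
  "scale_grassmann c 0 = 0"
  "scale_grassmann 0 a = 0"
  "scale_grassmann 1 a = a"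
  by (transfer, simp add: algebra_simps fun_eq_iff sum_distrib_left)+

definition grassmann_even :: "'a::comm_ring_1 grassmann set"
  where "grassmann_even = {a. \<forall>S. coeff_grassmann a S \<noteq> 0 \<longrightarrow> even (card S)}"

definition grassmann_odd :: "'a::comm_ring_1 grassmann set"
  where "grassmann_odd = {a. \<forall>S. coeff_grassmann a S \<noteq> 0 \<longrightarrow> odd (card S)}"


section \<open>Weak polynomial identities of \<open>M\<^bsub>1,1\<^esub>(E)\<close>\<close>

definition M11 :: "('a::comm_ring_1 grassmann^2^2) set"
  where "M11 = {A. A $ 1 $ 1 \<in> grassmann_even \<and> A $ 2 $ 2 \<in> grassmann_even
    \<and> A $ 1 $ 2 \<in> grassmann_odd \<and> A $ 2 $ 1 \<in> grassmann_odd}"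

definition str :: "'b::ring_1^2^2 \<Rightarrow> 'b"
  where "str A = A $ 1 $ 1 - A $ 2 $ 2"

definition M11_str0 :: "('a::comm_ring_1 grassmann^2^2) set"
  where "M11_str0 = {A \<in> M11. str A = 0}"

definition scale_mat :: "'a::comm_ring_1 \<Rightarrow> 'a grassmann^2^2 \<Rightarrow> 'a grassmann^2^2"
  where "scale_mat c A = (\<chi> i j. scale_grassmann c (A $ i $ j))"

text \<open>The matrix product is \<open>**\<close>; the product \<open>*\<close> on \<^typ>\<open>'b^2^2\<close> would be entrywise.\<close>

definition eval_word :: "(nat \<Rightarrow> 'a::comm_ring_1 grassmann^2^2) \<Rightarrow> word \<Rightarrow> 'a grassmann^2^2"
  where "eval_word w m = foldr (\<lambda>i A. w i ** A) (letters m) (mat 1)"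

definition eval_poly :: "(nat \<Rightarrow> 'a::field grassmann^2^2) \<Rightarrow> 'a free_alg \<Rightarrow> 'a grassmann^2^2"
  where "eval_poly w f = (\<Sum>m\<in>Poly_Mapping.keys f. scale_mat (Poly_Mapping.lookup f m) (eval_word w m))"

text \<open>Assigning elements to all variables, rather than to those occurring in \<open>f\<close>, makes no
  difference, as the superfluous ones can be sent to \<open>0\<close>.\<close>

definition I_w :: "'a::field free_alg set"
  where "I_w = {f. \<forall>w. (\<forall>i. w i \<in> M11_str0) \<longrightarrow> eval_poly w f = 0}"

lemma scale_mat_simps:
  "scale_mat (c + d) A = scale_mat c A + scale_mat d A"
  "scale_mat c (A + A') = scale_mat c A + scale_mat c A'"
  "scale_mat c A ** scale_mat d A' = scale_mat (c * d) (A ** A')"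
  "scale_mat 0 A = 0" "scale_mat 1 A = A"
  by (simp_all add: scale_mat_def vec_eq_iff matrix_matrix_mult_def scale_grassmann_simps sum_2)

lemma eval_word_plus: "eval_word w (u + v) = eval_word w u ** eval_word w v"
proof -
  have "foldr (\<lambda>i A. w i ** A) xs A = foldr (\<lambda>i A. w i ** A) xs (mat 1) ** A" for xs A
    by (induction xs) (simp_all flip: matrix_mul_assoc)
  then show ?thesis by (simp add: eval_word_def plus_word_def)
qed

lemma eval_supset:
  assumes "finite K" "Poly_Mapping.keys f \<subseteq> K"
  shows "eval_poly w f = (\<Sum>m\<in>K. scale_mat (Poly_Mapping.lookup f m) (eval_word w m))"
  unfolding eval_poly_def using assms
  by (intro sum.mono_neutral_left) (auto simp: in_keys_iff scale_mat_simps)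

lemma eval_0 [simp]: "eval_poly w 0 = 0"
  by (simp add: eval_poly_def)

lemma eval_add: "eval_poly w (f + g) = eval_poly w f + eval_poly w g"
proof -
  let ?K = "Poly_Mapping.keys f \<union> Poly_Mapping.keys g"
  have "finite ?K" by simp
  then show ?thesis
    using eval_supset[of ?K f w] eval_supset[of ?K g w] eval_supset[of ?K "f + g" w] keys_add[of f g]
    by (simp add: lookup_add scale_mat_simps sum.distrib)
qed

lemma eval_uminus: "eval_poly w (- f) = - eval_poly w f"
  using eval_add[of w f "- f"] by (simp add: eq_neg_iff_add_eq_0 add.commute)

lemma eval_diff: "eval_poly w (f - g) = eval_poly w f - eval_poly w g"
  using eval_add[of w f "- g"] eval_uminus[of w g] by simp

lemma eval_sum: "eval_poly w (sum f A) = (\<Sum>a\<in>A. eval_poly w (f a))"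
  by (induction A rule: infinite_finite_induct) (simp_all add: eval_add)

lemma eval_single: "eval_poly w (Poly_Mapping.single m c) = scale_mat c (eval_word w m)"
  by (cases "c = 0") (simp_all add: eval_poly_def scale_mat_simps)

lemma eval_1: "eval_poly w 1 = mat 1"
  using eval_single[of w 0 1] by (simp add: eval_word_def zero_word_def[symmetric] scale_mat_simps)
     (simp add: zero_word_def)

lemma free_alg_sum_single:
  "(f :: 'a::field free_alg) = (\<Sum>m\<in>Poly_Mapping.keys f. Poly_Mapping.single m (Poly_Mapping.lookup f m))"
  by (rule poly_mapping_eqI) (auto simp: lookup_sum lookup_single when_def sum.delta' in_keys_iff)

lemma mat_sum_left: "(\<Sum>a\<in>A. X a) ** Y = (\<Sum>a\<in>A. X a ** Y)"
  for Y :: "'b::ring_1^2^2"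
  by (induction A rule: infinite_finite_induct)
    (simp_all add: matrix_matrix_mult_def vec_eq_iff sum_2 distrib_right)

lemma mat_sum_right: "Y ** (\<Sum>a\<in>A. X a) = (\<Sum>a\<in>A. Y ** X a)"
  for Y :: "'b::ring_1^2^2"
  by (induction A rule: infinite_finite_induct)
    (simp_all add: matrix_matrix_mult_def vec_eq_iff sum_2 distrib_left)

lemma eval_mult: "eval_poly w (f * g) = eval_poly w f ** eval_poly w g"
proof -
  have "f * g = (\<Sum>u\<in>Poly_Mapping.keys f. \<Sum>v\<in>Poly_Mapping.keys g.
      Poly_Mapping.single (u + v) (Poly_Mapping.lookup f u * Poly_Mapping.lookup g v))"
    by (subst (1) free_alg_sum_single[of f], subst (1) free_alg_sum_single[of g])
      (simp add: sum_distrib_left sum_distrib_right mult_single, rule sum.swap)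
  then have "eval_poly w (f * g) = (\<Sum>u\<in>Poly_Mapping.keys f. \<Sum>v\<in>Poly_Mapping.keys g.
      scale_mat (Poly_Mapping.lookup f u) (eval_word w u)
      ** scale_mat (Poly_Mapping.lookup g v) (eval_word w v))"
    by (simp only: eval_sum eval_single eval_word_plus scale_mat_simps)
  also have "\<dots> = eval_poly w f ** eval_poly w g"
    by (simp only: eval_poly_def mat_sum_left mat_sum_right) (rule sum.swap)
  finally show ?thesis .
qed

lemma zero_in_M11_str0: "0 \<in> M11_str0"
  by (simp add: M11_str0_def M11_def str_def grassmann_even_def grassmann_odd_def
      zero_grassmann.rep_eq)

lemma two_sided_ideal_I_w: "two_sided_ideal I_w"
  by (simp add: two_sided_ideal_def I_w_def eval_add eval_mult matrix_matrix_mult_def vec_eq_iff)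

lemma zero_in_I_w: "0 \<in> I_w"
  by (simp add: I_w_def)

lemma one_notin_I_w: "1 \<notin> I_w"
proof
  assume "1 \<in> (I_w :: 'a free_alg set)"
  then have "mat 1 = (0 :: 'a grassmann^2^2)"
    using zero_in_M11_str0 by (auto simp: I_w_def eval_1 dest: spec[of _ "\<lambda>_. 0"])
  then have "(mat 1 :: 'a grassmann^2^2) $ 1 $ 1 = (0 :: 'a grassmann^2^2) $ 1 $ 1"
    by (simp only:)
  then show False by (simp add: mat_def)
qed


section \<open>The quotient by \<open>I\<^sub>w\<close> and the Hilbert series\<close>

quotient_type (overloaded) 'a rel_free = "'a::field free_alg" / "\<lambda>f g. f - g \<in> I_w"
  morphisms rep_rel_free to_rel
proof (rule equivpI)
  show "reflp (\<lambda>f g :: 'a free_alg. f - g \<in> I_w)"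
    by (auto simp: reflp_def I_w_def)
  show "symp (\<lambda>f g :: 'a free_alg. f - g \<in> I_w)"
    by (auto simp: symp_def I_w_def eval_diff)
  show "transp (\<lambda>f g :: 'a free_alg. f - g \<in> I_w)"
    by (auto simp: transp_def I_w_def eval_diff)
qed

instantiation rel_free :: (field) ring_1
begin

lift_definition zero_rel_free :: "'a rel_free" is 0 .
lift_definition one_rel_free :: "'a rel_free" is 1 .
lift_definition plus_rel_free :: "'a rel_free \<Rightarrow> 'a rel_free \<Rightarrow> 'a rel_free" is "(+)"
  by (auto simp: I_w_def eval_diff eval_add)
lift_definition minus_rel_free :: "'a rel_free \<Rightarrow> 'a rel_free \<Rightarrow> 'a rel_free" is "(-)"
  by (auto simp: I_w_def eval_diff)
lift_definition uminus_rel_free :: "'a rel_free \<Rightarrow> 'a rel_free" is uminus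
  by (auto simp: I_w_def eval_diff eval_uminus)
lift_definition times_rel_free :: "'a rel_free \<Rightarrow> 'a rel_free \<Rightarrow> 'a rel_free" is "(*)"
  by (auto simp: I_w_def eval_diff eval_mult)

instance
proof
  fix a b c :: "'a rel_free"
  show "a + b + c = a + (b + c)"
    by transfer (simp only: add.assoc diff_self zero_in_I_w)
  show "a + b = b + a"
    by transfer (simp only: add.commute diff_self zero_in_I_w)
  show "0 + a = a"
    by transfer (simp only: add_0_left diff_self zero_in_I_w)
  show "- a + a = 0"
    by transfer (simp only: left_minus diff_self zero_in_I_w)
  show "a - b = a + - b"
    by transfer (simp add: zero_in_I_w)
  show "a * b * c = a * (b * c)"
    by transfer (simp only: mult.assoc diff_self zero_in_I_w)
  show "(a + b) * c = a * c + b * c"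
    by transfer (simp only: distrib_right diff_self zero_in_I_w)
  show "a * (b + c) = a * b + a * c"
    by transfer (simp only: distrib_left diff_self zero_in_I_w)
  show "1 * a = a"
    by transfer (simp only: mult_1_left diff_self zero_in_I_w)
  show "a * 1 = a"
    by transfer (simp only: mult_1_right diff_self zero_in_I_w)
  show "(0 :: 'a rel_free) \<noteq> 1"
  proof (transfer, rule notI)
    assume "(0 :: 'a free_alg) - 1 \<in> I_w"
    then have "(1 :: 'a free_alg) \<in> I_w" by (auto simp: I_w_def eval_uminus)
    with one_notin_I_w show False by blast
  qed
qed

end

lift_definition scale_rel :: "'a::field \<Rightarrow> 'a rel_free \<Rightarrow> 'a rel_free" is scale_free
  by (auto simp: I_w_def eval_diff eval_mult scale_free_def)

global_interpretation rel: vector_space "scale_rel :: 'a::field \<Rightarrow> _"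
  defines rel_dim = rel.dim
proof
  fix a b :: 'a and x y :: "'a rel_free"
  show "scale_rel a (x + y) = scale_rel a x + scale_rel a y"
    by transfer (simp only: free.scale_right_distrib diff_self zero_in_I_w)
  show "scale_rel (a + b) x = scale_rel a x + scale_rel b x"
    by transfer (simp only: free.scale_left_distrib diff_self zero_in_I_w)
  show "scale_rel a (scale_rel b x) = scale_rel (a * b) x"
    by transfer (simp only: free.scale_scale diff_self zero_in_I_w)
  show "scale_rel 1 x = x"
    by transfer (simp only: free.scale_one diff_self zero_in_I_w)
qed

text \<open>\<open>B\<^sub>k / (B\<^sub>k \<inter> I\<^sub>w)\<close> is realised as the image of \<open>B\<^sub>k\<close> in the quotient of the free algebra
  by \<open>I\<^sub>w\<close>; the lemma below states that exactly \<open>B\<^sub>k \<inter> I\<^sub>w\<close> is factored out.\<close>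

definition B_rel :: "nat \<Rightarrow> 'a::field rel_free set"
  where "B_rel k = to_rel ` B_polys k"

lemma to_rel_eq_iff_B:
  assumes "f \<in> B_polys k" "g \<in> B_polys k"
  shows "to_rel f = to_rel g \<longleftrightarrow> f - g \<in> B_polys k \<inter> I_w"
proof -
  have "f - g \<in> proper_polys"
    using assms subalgebra_proper_polys
    by (auto simp: B_polys_def subalgebra_def intro: free.subspace_diff)
  moreover have "f - g \<in> polys_in k"
    using assms keys_diff[of f g] by (auto simp: B_polys_def polys_in_def)
  ultimately have "f - g \<in> B_polys k"
    by (simp add: B_polys_def)
  then show ?thesis
    by (simp add: rel_free.abs_eq_iff)
qed

definition B_component :: "nat \<Rightarrow> (nat \<Rightarrow>\<^sub>0 nat) \<Rightarrow> 'a::field rel_free set"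
  where "B_component k n = to_rel ` {f \<in> B_polys k. multihomogeneous n f}"

text \<open>A formal power series in \<open>t\<^sub>1, \<dots>, t\<^sub>k\<close> is the family of its coefficients, indexed by
  the exponents of monomials; here \<open>t\<^bsub>j+1\<^esub>\<close> has index \<open>j\<close>. All coefficients at
  monomials involving other variables are zero. The spaces \<open>V n\<close> of interest are spanned by
  the images of finitely many words, so the library convention \<open>dim = 0\<close> for
  infinite-dimensional spaces plays no role.\<close>

definition hilbert_series :: "nat \<Rightarrow> ((nat \<Rightarrow>\<^sub>0 nat) \<Rightarrow> 'a::field rel_free set) \<Rightarrow> (nat \<Rightarrow>\<^sub>0 nat) \<Rightarrow> rat"
  where "hilbert_series k V n =
    (if Poly_Mapping.keys n \<subseteq> {..<k} then of_nat (rel_dim (V n)) else 0)"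

definition tvar :: "nat \<Rightarrow> (nat \<Rightarrow>\<^sub>0 nat) \<Rightarrow>\<^sub>0 rat"
  where "tvar j = Poly_Mapping.single (Poly_Mapping.single j 1) 1"

definition mpoly_const :: "rat \<Rightarrow> (nat \<Rightarrow>\<^sub>0 nat) \<Rightarrow>\<^sub>0 rat"
  where "mpoly_const c = Poly_Mapping.single 0 c"

definition elem_sym :: "nat \<Rightarrow> nat \<Rightarrow> (nat \<Rightarrow> 'b::comm_ring_1) \<Rightarrow> 'b"
  where "elem_sym k i t = (\<Sum>S | S \<subseteq> {..<k} \<and> card S = i. \<Prod>j\<in>S. t j)"

end

theory Submission
  imports Defs "HOL-Library.Multiset" "HOL-Library.Nat_Bijection"
    "HOL-Computational_Algebra.Polynomial"
begin

text \<open>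
  An element of \<open>W\<close> is \<open>w\<^sub>i = a\<^sub>i I\<close> plus an off-diagonal matrix with odd entries \<open>b\<^sub>i\<close> and \<open>c\<^sub>i\<close>, and
  \<open>[w\<^sub>i, w\<^sub>j] = u\<^sub>i\<^sub>j I\<close> with the even element \<open>u\<^sub>i\<^sub>j = b\<^sub>i c\<^sub>j + c\<^sub>i b\<^sub>j\<close>. So commutators of elements of \<open>W\<close> are
  central, and \<open>p\<close> vanishes because each of its terms contains \<open>b\<^sub>1\<close> or \<open>c\<^sub>1\<close> twice. This is one
  inclusion; let \<open>J\<close> be the \<open>\<Omega>\<close>-ideal generated by \<open>c\<^sub>3\<close> and \<open>p\<close>.

  For the other inclusion, modulo \<open>J\<close> the commutators \<open>[x\<^sub>i, x\<^sub>j]\<close> are central, so every polynomial is a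
  combination of sorted words times products of such commutators. A product is a multigraph on the
  indices. The polarization of \<open>p\<close> says that the six products \<open>[a\<^sub>1, x\<^bsub>\<sigma>(1)\<^esub>][a\<^sub>2, x\<^bsub>\<sigma>(2)\<^esub>][a\<^sub>3, x\<^bsub>\<sigma>(3)\<^esub>]\<close> add up
  to an element of \<open>J\<close>. Its term with the largest sum \<open>\<Sum> i j\<close> over all edges joins the sorted \<open>a\<close> to the
  sorted \<open>x\<close>. Hence the multigraphs without three edges \<open>i < j\<close> that form a chain in the product order
  suffice (\<open>comm_prod_reduce\<close>, \<open>span_sorted\<close>). Such a multigraph is a union of two rainbows, that is,
  of two families of nested edges (\<open>normal_pairs_nested\<close>). Put \<open>b\<^sub>i = y\<^sub>i + z\<^sub>i\<close> and \<open>c\<^sub>i = y\<^sub>i - z\<^sub>i\<close> for independent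
  generators \<open>y\<^sub>i, z\<^sub>i\<close>. Then \<open>u\<^sub>i\<^sub>j = 2 y\<^sub>i y\<^sub>j - 2 z\<^sub>i z\<^sub>j\<close>, and the monomial \<open>y\<^sub>L z\<^sub>U\<close> occurs in a product of these
  only if the edges split into perfect matchings of \<open>L\<close> and of \<open>U\<close>. A rainbow is the matching of
  smallest weight (\<open>nested_minimal\<close>), so the values of the normal forms are triangular with respect to
  the weight, and their diagonal entries are powers of two up to sign (\<open>coeff_prod_edge_weight\<close>,
  \<open>coeff_prod_edge_self\<close>). The words are told apart by adding scalars \<open>\<lambda>\<^bsup>s i\<^esup>\<close> with rapidly growing
  exponents to the variables and comparing the highest powers of \<open>\<lambda>\<close>; this uses that the field is
  infinite. Thus the normal forms are independent modulo the weak identities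
  (\<open>normal_basis_independent\<close>), which gives \<open>I\<^sub>w \<subseteq> J\<close>.

  For the Hilbert series, the values of \<open>B\<^sub>k\<close> are identified with the span of the elements
  \<open>b\<^sub>S c\<^sub>T + c\<^sub>S b\<^sub>T\<close> with \<open>|S| = |T|\<close>. Multiplication by \<open>u\<^sub>i\<^sub>j\<close> preserves this span
  (\<open>pairing_times_sym_prod\<close>), and conversely each of these elements is the value of a polynomial in \<open>B\<^sub>k\<close>
  of the same degree: an identity between three exchanges of \<open>b\<close> and \<open>c\<close> allows an induction on \<open>|S|\<close>
  with division by two (\<open>sym_prod_step\<close>, \<open>sym_prod_realized\<close>). The exchange of \<open>b\<close> and \<open>c\<close> maps \<open>b\<^sub>S c\<^sub>T\<close> to
  \<open>(-1)\<^bsup>|S|\<^esup> b\<^sub>T c\<^sub>S\<close>. So the dimension of a component is the number of unordered pairs \<open>{S, T}\<close> of the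
  given degree, where \<open>S = T\<close> is admitted only for even \<open>|S|\<close> (\<open>dim_B_component\<close>). This is half of
  the number of ordered pairs plus half of the trace of the exchange, and the two summands are
  counted by \<open>e\<^sub>i(t)\<^sup>2\<close> and \<open>(-1)\<^sup>i e\<^sub>i(t\<^sup>2)\<close>.
\<close>

section \<open>Words and substitutions in the free algebra\<close>

lemma letters_zero [simp]: "letters 0 = []"
  by (simp add: zero_word_def)

lemma prod_list_var: "prod_list (map var l) = Poly_Mapping.single (Word l) 1"
  by (induction l) (simp_all add: var_def mult_single plus_word_def flip: zero_word_def single_one)

lemma single_eq_scale_prod_var:
  "Poly_Mapping.single m c = scale_free c (prod_list (map var (letters m)))"
  by (simp add: prod_list_var scale_free_def mult_single)

lemma free_span_words: "f \<in> free_span (range (\<lambda>l. prod_list (map var l)))"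
proof -
  have "f = (\<Sum>m\<in>Poly_Mapping.keys f.
      scale_free (Poly_Mapping.lookup f m) (prod_list (map var (letters m))))"
    by (subst free_alg_sum_single) (simp only: single_eq_scale_prod_var)
  also have "\<dots> \<in> free_span (range (\<lambda>l. prod_list (map var l)))"
    by (intro free.span_sum free.span_scale free.span_base) auto
  finally show ?thesis .
qed

lemma scale_free_mult:
  "scale_free c f * g = scale_free c (f * g)" "f * scale_free c g = scale_free c (f * g)"
proof -
  show "scale_free c f * g = scale_free c (f * g)"
    by (simp add: scale_free_def mult.assoc)
  have *: "f * Poly_Mapping.single 0 c = Poly_Mapping.single 0 c * f"
    by (subst (1 2) free_alg_sum_single[of f])
      (simp add: sum_distrib_left sum_distrib_right mult_single mult.commute)
  show "f * scale_free c g = scale_free c (f * g)"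
    by (simp add: scale_free_def * flip: mult.assoc)
qed

definition subst_free :: "(nat \<Rightarrow> 'a::field free_alg) \<Rightarrow> 'a free_alg \<Rightarrow> 'a free_alg"
  where "subst_free h f = (\<Sum>m\<in>Poly_Mapping.keys f.
    scale_free (Poly_Mapping.lookup f m) (prod_list (map h (letters m))))"

lemma subst_free_supset:
  assumes "finite K" "Poly_Mapping.keys f \<subseteq> K"
  shows "subst_free h f
    = (\<Sum>m\<in>K. scale_free (Poly_Mapping.lookup f m) (prod_list (map h (letters m))))"
  unfolding subst_free_def using assms
  by (intro sum.mono_neutral_left) (auto simp: in_keys_iff)

lemma subst_free_add: "subst_free h (f + g) = subst_free h f + subst_free h g"
proof -
  let ?K = "Poly_Mapping.keys f \<union> Poly_Mapping.keys g"
  have "finite ?K" by simp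
  then show ?thesis
    using subst_free_supset[of ?K f h] subst_free_supset[of ?K g h]
      subst_free_supset[of ?K "f + g" h] keys_add[of f g]
    by (simp add: lookup_add free.scale_left_distrib sum.distrib)
qed

lemma subst_free_sum: "subst_free h (sum f A) = (\<Sum>a\<in>A. subst_free h (f a))"
  by (induction A rule: infinite_finite_induct) (simp_all add: subst_free_add, simp_all add: subst_free_def)

lemma subst_free_single:
  "subst_free h (Poly_Mapping.single m c) = scale_free c (prod_list (map h (letters m)))"
  by (cases "c = 0") (simp_all add: subst_free_def)

lemma subst_free_mult: "subst_free h (f * g) = subst_free h f * subst_free h g"
proof -
  have "f * g = (\<Sum>u\<in>Poly_Mapping.keys f. \<Sum>v\<in>Poly_Mapping.keys g.
      Poly_Mapping.single (u + v) (Poly_Mapping.lookup f u * Poly_Mapping.lookup g v))"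
    by (subst (1) free_alg_sum_single[of f], subst (1) free_alg_sum_single[of g])
      (simp add: sum_distrib_left sum_distrib_right mult_single, rule sum.swap)
  then have "subst_free h (f * g) = (\<Sum>u\<in>Poly_Mapping.keys f. \<Sum>v\<in>Poly_Mapping.keys g.
      scale_free (Poly_Mapping.lookup f u) (prod_list (map h (letters u)))
      * scale_free (Poly_Mapping.lookup g v) (prod_list (map h (letters v))))"
    by (simp add: subst_free_sum subst_free_single plus_word_def scale_free_mult mult_ac)
  also have "\<dots> = subst_free h f * subst_free h g"
    by (simp add: subst_free_def sum_distrib_left sum_distrib_right) (rule sum.swap)
  finally show ?thesis .
qed

lemma subst_free_scale: "subst_free h (scale_free c f) = scale_free c (subst_free h f)"
  by (simp add: scale_free_def[of c f] subst_free_mult subst_free_single)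
    (simp add: scale_free_def zero_word_def)

lemma algebra_endomorphism_subst_free: "algebra_endomorphism (subst_free h)"
  unfolding algebra_endomorphism_def
proof (intro conjI allI)
  show "Vector_Spaces.linear scale_free scale_free (subst_free h)"
    by unfold_locales (simp_all add: subst_free_add subst_free_scale)
  show "subst_free h 1 = 1"
    using subst_free_single[of h 0 1] by (simp add: letters_zero)
qed (simp add: subst_free_mult)

lemma subst_free_var [simp]: "subst_free h (var i) = h i"
  by (simp add: var_def subst_free_single)

lemma var_in_Omega: "var i \<in> Omega"
  by (auto simp: Omega_def intro: free.span_base)

lemma Omega_add: "f \<in> Omega \<Longrightarrow> g \<in> Omega \<Longrightarrow> f + g \<in> Omega"
  by (simp add: Omega_def free.span_add)

lemma commutator_self [simp]: "commutator u u = 0"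
  by (simp add: commutator_def)

lemma commutator_swap: "commutator u v = - commutator v u"
  by (simp add: commutator_def)

lemma commutator_add_right: "commutator u (v + w) = commutator u v + commutator u w"
  by (simp add: commutator_def algebra_simps)

section \<open>Normal forms for products of commutators\<close>

definition comm_pair :: "nat \<times> nat \<Rightarrow> 'a::field free_alg"
  where "comm_pair e = commutator (var (fst e)) (var (snd e))"

definition comm_prod :: "(nat \<times> nat) list \<Rightarrow> 'a::field free_alg"
  where "comm_prod c = prod_list (map comm_pair c)"

lemma comm_prod_simps [simp]: "comm_prod [] = 1" "comm_prod (e # c) = comm_pair e * comm_prod c"
  "comm_prod (c @ d) = comm_prod c * comm_prod d"
  by (simp_all add: comm_prod_def)

definition pair_le :: "nat \<times> nat \<Rightarrow> nat \<times> nat \<Rightarrow> bool"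
  where "pair_le e f \<longleftrightarrow> fst e \<le> fst f \<and> snd e \<le> snd f"

text \<open>A pair \<open>(i, j)\<close> with \<open>i < j\<close> stands for the commutator \<open>[x\<^sub>i, x\<^sub>j]\<close>, and also for an edge of
  a graph on the indices. The excluded chains are, up to reordering, the sorted ways to join three
  indices to three others: the leading terms of the relation that comes from \<open>p\<close>. Chains are taken
  in the multiset, so that a repeated pair counts twice.\<close>

definition normal_pairs :: "(nat \<times> nat) multiset \<Rightarrow> bool"
  where "normal_pairs M \<longleftrightarrow> (\<forall>e\<in>#M. fst e < snd e)
    \<and> \<not> (\<exists>e f g. {#e, f, g#} \<subseteq># M \<and> pair_le e f \<and> pair_le f g)"

text \<open>By the rearrangement inequality, joining \<open>a\<^sub>1 \<le> a\<^sub>2 \<le> a\<^sub>3\<close> to \<open>x\<^sub>1 \<le> x\<^sub>2 \<le> x\<^sub>3\<close> in this order gives the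
  largest weight among the six ways to join them, and joining in the opposite order the smallest.
  The first fact makes the reduction terminate, the second makes normal forms independent.\<close>

definition pair_weight :: "(nat \<times> nat) multiset \<Rightarrow> nat"
  where "pair_weight M = (\<Sum>e\<in>#M. fst e * snd e)"

lemma pair_weight_simps [simp]: "pair_weight {#} = 0"
  "pair_weight (add_mset e M) = fst e * snd e + pair_weight M"
  "pair_weight (M + N) = pair_weight M + pair_weight N"
  by (simp_all add: pair_weight_def)

text \<open>The reduction uses the two generators only through their substitution instances. An arbitrary
  \<open>h \<in> \<Omega>\<close> in the cubic relation is what allows its polarization.\<close>

locale cubic_ideal =
  fixes J :: "'a::field free_alg set"
  assumes ideal: "two_sided_ideal J"
    and triple: "commutator (commutator (var i) (var j)) (var l) \<in> J"
    and cube: "h \<in> Omega \<Longrightarrow>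
      commutator (var i) h * commutator (var j) h * commutator (var l) h \<in> J"
begin

lemma zero_in: "0 \<in> J" and add_in: "f \<in> J \<Longrightarrow> g \<in> J \<Longrightarrow> f + g \<in> J"
  and mult_in: "f \<in> J \<Longrightarrow> g * f \<in> J" "f \<in> J \<Longrightarrow> f * g \<in> J"
  using ideal by (auto simp: two_sided_ideal_def)

lemma scale_in: "f \<in> J \<Longrightarrow> scale_free c f \<in> J"
  by (simp add: scale_free_def mult_in)

lemma uminus_in: "f \<in> J \<Longrightarrow> - f \<in> J"
  using mult_in(1)[of f "-1"] by simp

lemma diff_in: "f \<in> J \<Longrightarrow> g \<in> J \<Longrightarrow> f - g \<in> J"
  using add_in[of f "- g"] uminus_in by simp

definition span_mod :: "'a free_alg set \<Rightarrow> 'a free_alg set"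
  where "span_mod A = free_span (J \<union> A)"

lemma span_mod_ideal: "f \<in> J \<Longrightarrow> f \<in> span_mod A"
  by (simp add: span_mod_def free.span_base)

lemma span_mod_base: "f \<in> A \<Longrightarrow> f \<in> span_mod A"
  by (simp add: span_mod_def free.span_base)

lemma span_mod_closed:
  "f \<in> span_mod A \<Longrightarrow> g \<in> span_mod A \<Longrightarrow> f + g \<in> span_mod A"
  "f \<in> span_mod A \<Longrightarrow> g \<in> span_mod A \<Longrightarrow> f - g \<in> span_mod A"
  "f \<in> span_mod A \<Longrightarrow> - f \<in> span_mod A"
  "f \<in> span_mod A \<Longrightarrow> scale_free c f \<in> span_mod A"
  by (simp_all add: span_mod_def free.span_add free.span_diff free.span_neg free.span_scale)

lemma span_mod_cong: "f - g \<in> J \<Longrightarrow> g \<in> span_mod A \<Longrightarrow> f \<in> span_mod A"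
  using span_mod_closed(1)[of "f - g" A g] span_mod_ideal[of "f - g" A] by simp

lemma span_mod_image:
  assumes "f \<in> span_mod A" "\<And>a. a \<in> J \<Longrightarrow> T a \<in> span_mod A'"
    "\<And>a. a \<in> A \<Longrightarrow> T a \<in> span_mod A'"
    and T: "\<And>f g. T (f + g) = T f + T g" "\<And>c f. T (scale_free c f) = scale_free c (T f)"
  shows "T f \<in> span_mod A'"
  using assms(1) unfolding span_mod_def[of A]
proof (induction rule: free.span_induct_alt)
  case base
  show ?case using T(2)[of 0 0] span_mod_ideal[OF zero_in] by simp
next
  case (step c a y)
  then show ?case using assms(2,3) by (auto simp: T intro!: span_mod_closed)
qed

lemma span_mod_mono:
  assumes "f \<in> span_mod A" "\<And>a. a \<in> A \<Longrightarrow> a \<in> span_mod A'"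
  shows "f \<in> span_mod A'"
  using span_mod_image[of f A "\<lambda>x. x" A'] assms span_mod_ideal by simp

lemma span_mod_mult:
  assumes "f \<in> span_mod A" "\<And>a. a \<in> A \<Longrightarrow> g * a * h \<in> span_mod A'"
  shows "g * f * h \<in> span_mod A'"
  by (rule span_mod_image[where T="\<lambda>f. g * f * h", OF assms(1)])
    (auto simp: distrib_left distrib_right scale_free_mult intro: assms(2) span_mod_ideal mult_in)

text \<open>The triple commutators are in the ideal, so a commutator of two variables commutes with every
  variable, and hence with every word.\<close>

lemma comm_pair_central: "comm_pair e * f - f * comm_pair e \<in> J"
proof -
  have word: "comm_pair e * prod_list (map var l) - prod_list (map var l) * comm_pair e \<in> J" for l
  proof (induction l)
    case (Cons i l)
    let ?u = "comm_pair e :: 'a free_alg" and ?w = "prod_list (map var l)"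
    have "?u * (var i * ?w) - var i * ?w * ?u
      = (?u * var i - var i * ?u) * ?w + var i * (?u * ?w - ?w * ?u)"
      by (simp add: algebra_simps)
    moreover have "?u * var i - var i * ?u \<in> J"
      using triple[of "fst e" "snd e" i] by (simp add: comm_pair_def commutator_def[of _ "var i"])
    ultimately have "?u * (var i * ?w) - var i * ?w * ?u \<in> J"
      using add_in[OF mult_in(2) mult_in(1)[OF Cons.IH]] by (simp only:)
    then show ?case by simp
  qed (simp add: zero_in)
  show ?thesis
    using free_span_words[of f]
  proof (induction rule: free.span_induct_alt)
    case (step c a y)
    have "comm_pair e * (scale_free c a + y) - (scale_free c a + y) * comm_pair e
      = scale_free c (comm_pair e * a - a * comm_pair e) + (comm_pair e * y - y * comm_pair e)"
      by (simp add: algebra_simps scale_free_mult free.scale_right_diff_distrib)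
    then show ?case using step word by (auto intro!: add_in scale_in)
  qed (simp add: zero_in)
qed

lemma comm_prod_cong_mset: "mset c = mset d \<Longrightarrow> comm_prod c - comm_prod d \<in> J"
proof (induction c arbitrary: d)
  case (Cons e c)
  then have "e \<in> set d" by (metis list.set_intros(1) set_mset_mset)
  then obtain d1 d2 where d: "d = d1 @ e # d2" by (meson split_list)
  have "mset c = mset (d1 @ d2)" using Cons.prems by (simp add: d)
  then have IH: "comm_prod c - comm_prod (d1 @ d2) \<in> J" by (rule Cons.IH)
  have "comm_prod (e # c) - (comm_prod d :: 'a free_alg)
    = comm_pair e * (comm_prod c - comm_prod (d1 @ d2))
      + (comm_pair e * comm_prod d1 - comm_prod d1 * comm_pair e) * comm_prod d2"
    by (simp add: d algebra_simps)
  then show ?case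
    using add_in[OF mult_in(1)[OF IH] mult_in(2)[OF comm_pair_central]] by (simp only:)
qed (simp add: zero_in)

text \<open>With \<open>D h = [x\<^sub>i, h][x\<^sub>j, h][x\<^sub>l, h]\<close>, the sum is the full polarization of the cubic map \<open>D\<close>,
  which inclusion and exclusion over the subsets of \<open>{x, y, z}\<close> expresses by values of \<open>D\<close>. No
  division occurs.\<close>

lemma polarized_cube:
  "(\<Sum>(p, q, r) \<leftarrow> [(x,y,z), (x,z,y), (y,x,z), (y,z,x), (z,x,y), (z,y,x)].
    comm_prod [(i, p), (j, q), (l, r)]) \<in> J"
proof -
  define D where "D h = commutator (var i) h * commutator (var j) h * commutator (var l) h"
    for h :: "'a free_alg"
  have mem: "D (var x + var y + var z) \<in> J" "D (var x + var y) \<in> J" "D (var x + var z) \<in> J"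
    "D (var y + var z) \<in> J" "D (var x) \<in> J" "D (var y) \<in> J" "D (var z) \<in> J"
    unfolding D_def by (intro cube Omega_add var_in_Omega)+
  have "(\<Sum>(p, q, r) \<leftarrow> [(x,y,z), (x,z,y), (y,x,z), (y,z,x), (z,x,y), (z,y,x)].
    comm_prod [(i, p), (j, q), (l, r)])
    = D (var x + var y + var z) - D (var x + var y) - D (var x + var z) - D (var y + var z)
      + D (var x) + D (var y) + D (var z)"
    by (simp add: D_def comm_pair_def commutator_add_right algebra_simps)
  also have "\<dots> \<in> J"
    using mem by (intro add_in diff_in)
  finally show ?thesis .
qed

lemma comm_prod_orient:
  "comm_prod c = (0 :: 'a free_alg) \<or> (\<exists>d. (\<forall>e\<in>set d. fst e < snd e) \<and> pair_weight (mset d) = pair_weight (mset c)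
    \<and> (comm_prod c = (comm_prod d :: 'a free_alg) \<or> comm_prod c = - (comm_prod d :: 'a free_alg)))"
proof (induction c)
  case (Cons e c)
  obtain i j where e: "e = (i, j)" by force
  show ?case
  proof (cases "comm_prod c = (0 :: 'a free_alg)")
    case False
    with Cons obtain d where d: "\<forall>e\<in>set d. fst e < snd e" "pair_weight (mset d) = pair_weight (mset c)"
      and s: "comm_prod c = (comm_prod d :: 'a free_alg) \<or> comm_prod c = - (comm_prod d :: 'a free_alg)"
      by blast
    consider "i = j" | "i < j" | "j < i" by linarith
    then show ?thesis
    proof cases
      case 1
      then show ?thesis by (simp add: e comm_pair_def)
    next
      case 2
      then show ?thesis using d s by (intro disjI2 exI[of _ "(i, j) # d"]) (auto simp: e)
    next
      case 3
      have "comm_pair e = - (comm_pair (j, i) :: 'a free_alg)"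
        using commutator_swap by (force simp: comm_pair_def e)
      then show ?thesis using 3 d s by (intro disjI2 exI[of _ "(j, i) # d"]) (auto simp: e)
    qed
  qed simp
qed (auto intro: exI[of _ "[]"])

text \<open>The polarized relation for \<open>a\<^sub>1, a\<^sub>2, a\<^sub>3\<close> and \<open>x\<^sub>1, x\<^sub>2, x\<^sub>3\<close> has the sorted product as a term. The other
  five terms have smaller weight, unless ties among the indices make them equal to the sorted one.
  Then the sorted product occurs with coefficient \<open>1\<close>, \<open>2\<close> or \<open>4\<close>, which is invertible. Only if all \<open>a\<^sub>i\<close>
  or all \<open>x\<^sub>i\<close> coincide is the coefficient \<open>6\<close>; in this case the unpolarized relation applies.\<close>

lemma comm_prod_chain:
  assumes lt: "a1 \<le> a2" "a2 \<le> a3" "x1 \<le> x2" "x2 \<le> x3"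
    and IH: "\<And>d. pair_weight (mset d) < pair_weight (mset ((a1,x1) # (a2,x2) # (a3,x3) # c))
      \<Longrightarrow> comm_prod d \<in> span_mod A"
    and two: "(2 :: 'a) \<noteq> 0"
  shows "comm_prod ((a1,x1) # (a2,x2) # (a3,x3) # c) \<in> span_mod A"
proof (cases "a1 = a3 \<or> x1 = x3")
  case True
  then consider "a1 = a2" "a2 = a3" | "x1 = x2" "x2 = x3" using lt by fastforce
  then have "comm_pair (a1,x1) * comm_pair (a2,x2) * comm_pair (a3,x3) \<in> J"
  proof cases
    case 1
    have "- (commutator (var x1) (var a1) * commutator (var x2) (var a1) * commutator (var x3) (var a1)) \<in> J"
      by (intro uminus_in cube var_in_Omega)
    also have "- (commutator (var x1) (var a1) * commutator (var x2) (var a1) * commutator (var x3) (var a1))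
      = comm_pair (a1,x1) * comm_pair (a2,x2) * (comm_pair (a3,x3) :: 'a free_alg)"
      by (simp add: comm_pair_def commutator_swap[of _ "var a3"] 1)
    finally show ?thesis .
  next
    case 2
    then show ?thesis using cube[OF var_in_Omega[of x1]] by (simp add: comm_pair_def)
  qed
  then show ?thesis
    using mult_in(2) by (auto simp: mult.assoc[symmetric] intro!: span_mod_ideal)
next
  case False
  define t where "t p q r = (a1,p) # (a2,q) # (a3,r) # c" for p q r
  have sum: "comm_prod (t x1 x2 x3) + comm_prod (t x1 x3 x2) + comm_prod (t x2 x1 x3)
    + comm_prod (t x2 x3 x1) + comm_prod (t x3 x1 x2) + comm_prod (t x3 x2 x1) \<in> J"
    using mult_in(2)[OF polarized_cube[of a1 a2 a3 x1 x2 x3], of "comm_prod c"]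
    by (simp add: t_def algebra_simps)
  obtain p q r s where d: "a2 = a1 + p" "a3 = a1 + p + q" "x2 = x1 + r" "x3 = x1 + r + s"
    using lt by (metis le_iff_add)
  have pqrs: "0 < p \<or> 0 < q" "0 < r \<or> 0 < s" using False d by auto
  let ?w = "\<lambda>p q r. pair_weight (mset (t p q r))"
  have small: "comm_prod (t u v w) \<in> span_mod A" if "?w u v w < ?w x1 x2 x3" for u v w
    using that by (rule IH[folded t_def])
  have same: "comm_prod (t u v w) - comm_prod (t x1 x2 x3) \<in> J"
    if "mset (t u v w) = mset (t x1 x2 x3)" for u v w
    using that by (rule comm_prod_cong_mset)
  let ?u = "comm_prod (t x1 x2 x3) :: 'a free_alg"
  \<comment> \<open>\<open>P\<close> says when the term is equal to the sorted one.\<close>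
  have tie: "comm_prod (t u v w) - scale_free (of_bool P) ?u \<in> span_mod A"
    if "P \<Longrightarrow> mset (t u v w) = mset (t x1 x2 x3)" "\<not> P \<Longrightarrow> ?w u v w < ?w x1 x2 x3" for u v w P
    using that small same by (cases P) (auto intro: span_mod_ideal)
  have w1: "comm_prod (t x1 x3 x2) - scale_free (of_bool (q = 0 \<or> s = 0)) ?u \<in> span_mod A"
    by (rule tie) (auto simp: t_def d algebra_simps)
  have w2: "comm_prod (t x2 x1 x3) - scale_free (of_bool (p = 0 \<or> r = 0)) ?u \<in> span_mod A"
    by (rule tie) (auto simp: t_def d algebra_simps)
  have w3: "comm_prod (t x3 x2 x1) \<in> span_mod A"
    using pqrs by (intro small) (auto simp: t_def d algebra_simps)
  have w4: "comm_prod (t x2 x3 x1) - scale_free (of_bool (q = 0 \<and> r = 0)) ?u \<in> span_mod A"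
    by (rule tie) (use pqrs in \<open>auto simp: t_def d algebra_simps\<close>)
  have w5: "comm_prod (t x3 x1 x2) - scale_free (of_bool (p = 0 \<and> s = 0)) ?u \<in> span_mod A"
    by (rule tie) (use pqrs in \<open>auto simp: t_def d algebra_simps\<close>)
  \<comment> \<open>the multiplicity of the sorted term\<close>
  define k :: 'a where "k = 1 + of_bool (q = 0 \<or> s = 0) + of_bool (p = 0 \<or> r = 0)
    + of_bool (q = 0 \<and> r = 0) + of_bool (p = 0 \<and> s = 0)"
  have "k = 1 \<or> k = 2 \<or> k = 2 * 2"
    using pqrs by (cases "p = 0"; cases "q = 0"; cases "r = 0"; cases "s = 0") (auto simp: k_def)
  then have "k \<noteq> 0" using two by (metis mult_eq_0_iff zero_neq_one)
  have "scale_free k ?u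
    = (?u + comm_prod (t x1 x3 x2) + comm_prod (t x2 x1 x3)
        + comm_prod (t x2 x3 x1) + comm_prod (t x3 x1 x2) + comm_prod (t x3 x2 x1))
      - (comm_prod (t x1 x3 x2) - scale_free (of_bool (q = 0 \<or> s = 0)) ?u)
      - (comm_prod (t x2 x1 x3) - scale_free (of_bool (p = 0 \<or> r = 0)) ?u)
      - (comm_prod (t x2 x3 x1) - scale_free (of_bool (q = 0 \<and> r = 0)) ?u)
      - (comm_prod (t x3 x1 x2) - scale_free (of_bool (p = 0 \<and> s = 0)) ?u)
      - comm_prod (t x3 x2 x1)"
    by (simp add: k_def free.scale_left_distrib)
  also have "\<dots> \<in> span_mod A"
    by (intro span_mod_closed(2) w1 w2 w3 w4 w5 span_mod_ideal sum)
  finally have "scale_free (inverse k) (scale_free k ?u) \<in> span_mod A"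
    by (rule span_mod_closed(4))
  then show ?thesis using \<open>k \<noteq> 0\<close> by (simp add: t_def)
qed

lemma comm_prod_reduce:
  assumes two: "(2 :: 'a) \<noteq> 0"
  shows "comm_prod c \<in> span_mod (comm_prod ` {d. normal_pairs (mset d)})"
proof (induction "pair_weight (mset c)" arbitrary: c rule: less_induct)
  case less
  let ?A = "comm_prod ` {d. normal_pairs (mset d)} :: 'a free_alg set"
  show ?case
  proof (cases "comm_prod c = (0 :: 'a free_alg)")
    case False
    then obtain d where d: "\<forall>e\<in>set d. fst e < snd e" "pair_weight (mset d) = pair_weight (mset c)"
      and s: "comm_prod c = (comm_prod d :: 'a free_alg) \<or> comm_prod c = - (comm_prod d :: 'a free_alg)"
      using comm_prod_orient[of c] by blast
    have "comm_prod d \<in> span_mod ?A"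
    proof (cases "normal_pairs (mset d)")
      case True
      then show ?thesis by (intro span_mod_base) auto
    next
      case False
      with d obtain e f g where efg: "{#e, f, g#} \<subseteq># mset d" "pair_le e f" "pair_le f g"
        by (auto simp: normal_pairs_def)
      then obtain N where "mset d = {#e, f, g#} + N" by (meson mset_subset_eq_exists_conv)
      moreover obtain r where "mset r = N" by (meson ex_mset)
      ultimately have m: "mset d = mset (e # f # g # r)" by simp
      have "comm_prod ((fst e, snd e) # (fst f, snd f) # (fst g, snd g) # r) \<in> span_mod ?A"
      proof (rule comm_prod_chain)
        fix q assume "pair_weight (mset q)
          < pair_weight (mset ((fst e, snd e) # (fst f, snd f) # (fst g, snd g) # r))"
        then show "comm_prod q \<in> span_mod ?A"
          using less m d(2) by simp
      qed (use efg two in \<open>auto simp: pair_le_def\<close>)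
      then show ?thesis
        using comm_prod_cong_mset[OF m] by (auto intro: span_mod_cong)
    qed
    with s show ?thesis by (auto intro: span_mod_closed)
  qed (simp add: span_mod_ideal zero_in)
qed

text \<open>Exchanging two adjacent letters of a word costs their commutator, which is central modulo the
  ideal and leaves a word shorter by two. This is the spanning half of the
  Poincare-Birkhoff-Witt theorem for the free two-step nilpotent Lie algebra.\<close>

lemma span_words_sorted:
  assumes two: "(2 :: 'a) \<noteq> 0"
  defines "W \<equiv> {prod_list (map var l) * comm_prod c | l c. sorted l \<and> normal_pairs (mset c)}"
  shows "prod_list (map var l) * comm_prod c \<in> span_mod W"
proof (induction "length l" arbitrary: l c rule: less_induct)
  case less
  let ?w = "\<lambda>l. prod_list (map var l) :: 'a free_alg"
  \<comment> \<open>\<open>lower n\<close> collects the words shorter than \<open>n\<close>, with commutators as coefficients.\<close>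
  define lower where "lower n = span_mod {?w l * comm_prod c | l c. length l < n}" for n
  have lower_mult: "var i * f \<in> lower (Suc n)" if "f \<in> lower n" for i f n
  proof -
    have "var i * f * 1 \<in> lower (Suc n)"
      using that unfolding lower_def
    proof (rule span_mod_mult)
      fix a assume "a \<in> {?w l * comm_prod c | l c. length l < n}"
      then obtain l c where "a = ?w l * comm_prod c" "length l < n" by blast
      then show "var i * a * 1 \<in> span_mod {?w l * comm_prod c | l c. length l < Suc n}"
        by (intro span_mod_base CollectI exI[of _ "i # l"] exI[of _ c]) (simp add: mult.assoc)
    qed
    then show ?thesis by simp
  qed
  have lower_add: "f + g \<in> lower n" if "f \<in> lower n" "g \<in> lower n" for f g n
    using that by (simp add: lower_def span_mod_closed)
  have insort: "var i * ?w r - ?w (insort i r) \<in> lower (Suc (length r))" for i r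
  proof (induction r)
    case (Cons j r)
    show ?case
    proof (cases "i \<le> j")
      case False
      have "var i * ?w (j # r) - ?w (insort i (j # r))
        = var j * (var i * ?w r - ?w (insort i r)) + (comm_pair (i, j) * ?w r - ?w r * comm_pair (i, j))
          + ?w r * comm_prod [(i, j)]"
        using False by (simp add: comm_pair_def commutator_def algebra_simps)
      moreover have "comm_pair (i, j) * ?w r - ?w r * comm_pair (i, j) \<in> lower (Suc (length (j # r)))"
        using comm_pair_central by (simp add: lower_def span_mod_ideal)
      moreover have "?w r * comm_prod [(i, j)] \<in> lower (Suc (length (j # r)))"
        unfolding lower_def by (intro span_mod_base CollectI exI[of _ r] exI[of _ "[(i, j)]"]) simp
      moreover have "var j * (var i * ?w r - ?w (insort i r)) \<in> lower (Suc (length (j # r)))"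
        using lower_mult[OF Cons.IH] by simp
      ultimately show ?thesis
        by (simp only: lower_add)
    qed (simp add: lower_def span_mod_ideal zero_in)
  qed (simp add: lower_def span_mod_ideal zero_in)
  have sort: "?w l - ?w (sort l) \<in> lower (length l)" for l
  proof (induction l)
    case (Cons i l)
    have "?w (i # l) - ?w (sort (i # l))
      = var i * (?w l - ?w (sort l)) + (var i * ?w (sort l) - ?w (insort i (sort l)))"
      by (simp add: algebra_simps)
    moreover have "var i * (?w l - ?w (sort l)) \<in> lower (length (i # l))"
      using lower_mult[OF Cons.IH] by simp
    moreover have "var i * ?w (sort l) - ?w (insort i (sort l)) \<in> lower (length (i # l))"
      using insort[of i "sort l"] by simp
    ultimately show ?case by (simp only: lower_add)
  qed (simp add: lower_def span_mod_ideal zero_in)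
  have "1 * (?w l - ?w (sort l)) * comm_prod c \<in> span_mod W"
    using sort[of l] unfolding lower_def
  proof (rule span_mod_mult)
    fix a assume "a \<in> {?w l' * comm_prod c | l' c. length l' < length l}"
    then obtain l' c' where "a = ?w l' * comm_prod c'" "length l' < length l" by blast
    then show "1 * a * comm_prod c \<in> span_mod W"
      using less[of l' "c' @ c"] by (simp add: mult.assoc)
  qed
  moreover have "?w (sort l) * comm_prod c * 1 \<in> span_mod W"
    using comm_prod_reduce[OF two]
  proof (rule span_mod_mult)
    fix a :: "'a free_alg" assume "a \<in> comm_prod ` {d. normal_pairs (mset d)}"
    then obtain d where "a = comm_prod d" "normal_pairs (mset d)" by blast
    then show "?w (sort l) * a * 1 \<in> span_mod W"
      unfolding W_def by (intro span_mod_base CollectI exI[of _ "sort l"] exI[of _ d]) simp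
  qed
  ultimately show ?case
    using span_mod_closed(1) by (fastforce simp: algebra_simps)
qed

lemma span_sorted:
  assumes two: "(2 :: 'a) \<noteq> 0"
  shows "f \<in> span_mod {prod_list (map var l) * comm_prod c | l c. sorted l \<and> normal_pairs (mset c)}"
proof -
  have "f \<in> span_mod (range (\<lambda>l. prod_list (map var l)))"
    unfolding span_mod_def using free_span_words[of f] by (rule free.span_mono[THEN subsetD, rotated]) auto
  then show ?thesis
  proof (rule span_mod_mono)
    fix a :: "'a free_alg" assume "a \<in> range (\<lambda>l. prod_list (map var l))"
    then obtain l where "a = prod_list (map var l) * comm_prod []" by auto
    then show "a \<in> span_mod {prod_list (map var l) * comm_prod c | l c. sorted l \<and> normal_pairs (mset c)}"
      using span_words_sorted[OF two, of l "[]"] by simp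
  qed
qed

end

lemma cubic_ideal_Omega_generated:
  "cubic_ideal (Omega_generated {commutator (commutator (var 0) (var 1)) (var 2),
    commutator (var 1) (var 0) * commutator (var 2) (var 0) * commutator (var 3) (var 0)} :: 'a::field free_alg set)"
    (is "cubic_ideal ?J")
proof
  have J: "two_sided_ideal ?J" "Omega_stable ?J"
    using Omega_ideal_Omega_generated by (auto simp: Omega_ideal_def)
  then show "two_sided_ideal ?J" by simp
  have sub: "subst_free h f \<in> ?J" if "f \<in> ?J" "\<And>i. h i \<in> Omega" for h and f :: "'a free_alg"
    using J(2) that algebra_endomorphism_subst_free[of h] by (fastforce simp: Omega_stable_def)
  have gen: "commutator (commutator (var 0) (var 1)) (var 2) \<in> ?J"
    "commutator (var 1) (var 0) * commutator (var 2) (var 0) * commutator (var 3) (var 0) \<in> ?J"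
    by (auto simp: Omega_generated_def intro: hull_inc)
  have com: "subst_free h (commutator f g) = commutator (subst_free h f) (subst_free h g)" for h and f g :: "'a free_alg"
    using subst_free_add[of h "f * g - g * f" "g * f"] by (simp add: commutator_def subst_free_mult)
  show "commutator (commutator (var i) (var j)) (var l) \<in> ?J" for i j l
    using sub[OF gen(1), of "\<lambda>n. var (if n = 0 then i else if n = 1 then j else l)"]
    by (simp add: com var_in_Omega)
  show "commutator (var i) h * commutator (var j) h * commutator (var l) h \<in> ?J"
    if "h \<in> Omega" for h i j l
    using sub[OF gen(2), of "\<lambda>n. if n = 0 then h else var (if n = 1 then i else if n = 2 then j else l)"] that
    by (simp add: com var_in_Omega subst_free_mult)
qed

section \<open>Parity in the Grassmann algebra\<close>

lemma grassmann_eqI: "(\<And>S. coeff_grassmann f S = coeff_grassmann g S) \<Longrightarrow> f = g"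
  by (metis coeff_grassmann_inject ext)

lemmas coeff_simps = zero_grassmann.rep_eq one_grassmann.rep_eq plus_grassmann.rep_eq
  minus_grassmann.rep_eq uminus_grassmann.rep_eq scale_grassmann.rep_eq

lemma coeff_grassmann_sum: "coeff_grassmann (sum f A) S = (\<Sum>a\<in>A. coeff_grassmann (f a) S)"
  by (induction A rule: infinite_finite_induct) (simp_all add: coeff_simps)

lemma coeff_grassmann_infinite: "infinite U \<Longrightarrow> coeff_grassmann f U = 0"
  using coeff_grassmann[of f] by auto

lemma coeff_times_nonzero:
  assumes "coeff_grassmann (f * g) U \<noteq> 0"
  obtains S where "finite U" "S \<subseteq> U" "coeff_grassmann f S \<noteq> 0" "coeff_grassmann g (U - S) \<noteq> 0"
proof -
  from assms have "finite U" using coeff_grassmann_infinite by blast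
  moreover from assms obtain S where "S \<in> Pow U"
    "(- 1) ^ inversions S (U - S) * coeff_grassmann f S * coeff_grassmann g (U - S) \<noteq> 0"
    unfolding times_grassmann.rep_eq by (metis (no_types, lifting) sum.neutral)
  then have "S \<subseteq> U" "coeff_grassmann f S \<noteq> 0" "coeff_grassmann g (U - S) \<noteq> 0" by auto
  ultimately show thesis using that by blast
qed

lemma inversions_swap:
  assumes "finite S" "finite T" "S \<inter> T = {}"
  shows "inversions S T + inversions T S = card S * card T"
proof -
  let ?A = "{(s, t) \<in> S \<times> T. t < s}" and ?B = "{(s, t) \<in> S \<times> T. s < t}"
  have "{(s, t) \<in> T \<times> S. t < s} = prod.swap ` ?B" by (auto simp: image_iff)
  then have swap: "inversions T S = card ?B"
    by (simp add: inversions_def card_image)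
  have un: "S \<times> T = ?A \<union> ?B"
    using assms(3) by (safe; force simp: neq_iff)
  have "finite ?A" "finite ?B"
    by (rule finite_subset[of _ "S \<times> T"]; use assms in force)+
  moreover have "?A \<inter> ?B = {}" by auto
  ultimately have "card (?A \<union> ?B) = inversions S T + inversions T S"
    unfolding swap unfolding inversions_def by (rule card_Un_disjoint)
  then show ?thesis
    unfolding un[symmetric] by (simp add: card_cartesian_product)
qed

text \<open>Exchanging \<open>S\<close> with its complement in the defining sum turns \<open>f * g\<close> into \<open>g * f\<close> up to the signs
  \<open>(-1)\<^bsup>|S| |U - S|\<^esup>\<close>.\<close>

lemma coeff_times_swap:
  assumes "finite U"
  shows "coeff_grassmann (f * g) U = (\<Sum>S\<in>Pow U. (- 1) ^ (card S * card (U - S))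
    * ((- 1) ^ inversions S (U - S) * coeff_grassmann g S * coeff_grassmann f (U - S)))"
proof -
  have sign: "(- 1 :: 'a) ^ inversions (U - S) S = (- 1) ^ (card S * card (U - S)) * (- 1) ^ inversions S (U - S)"
    if "S \<subseteq> U" for S
  proof -
    have "inversions S (U - S) + inversions (U - S) S = card S * card (U - S)"
      using that assms by (intro inversions_swap) (auto intro: finite_subset)
    then have "even (card S * card (U - S)) \<longleftrightarrow> (even (inversions S (U - S)) \<longleftrightarrow> even (inversions (U - S) S))"
      by (metis even_add)
    then show ?thesis
      by (simp only: minus_one_power_iff) auto
  qed
  have "coeff_grassmann (f * g) U
    = (\<Sum>S\<in>Pow U. (- 1) ^ inversions (U - S) S * coeff_grassmann f (U - S) * coeff_grassmann g S)"
    unfolding times_grassmann.rep_eq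
    by (rule sum.reindex_bij_witness[of _ "\<lambda>S. U - S" "\<lambda>S. U - S"]) (auto simp: double_diff)
  also have "\<dots> = (\<Sum>S\<in>Pow U. (- 1) ^ (card S * card (U - S))
    * ((- 1) ^ inversions S (U - S) * coeff_grassmann g S * coeff_grassmann f (U - S)))"
    by (rule sum.cong) (auto simp: sign mult_ac)
  finally show ?thesis .
qed

lemma even_central:
  assumes "f \<in> grassmann_even" shows "f * g = g * f"
proof (rule grassmann_eqI)
  fix U
  show "coeff_grassmann (f * g) U = coeff_grassmann (g * f) U"
  proof (cases "finite U")
    case True
    show ?thesis
      unfolding coeff_times_swap[OF True] times_grassmann.rep_eq[of g f]
    proof (rule sum.cong)
      fix S
      show "(- 1) ^ (card S * card (U - S)) * ((- 1) ^ inversions S (U - S) * coeff_grassmann g S * coeff_grassmann f (U - S))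
        = (- 1) ^ inversions S (U - S) * coeff_grassmann g S * coeff_grassmann f (U - S)"
        using assms by (cases "coeff_grassmann f (U - S) = 0") (auto simp: grassmann_even_def)
    qed simp
  qed (simp add: coeff_grassmann_infinite)
qed

lemma odd_anticommute:
  assumes "f \<in> grassmann_odd" "g \<in> grassmann_odd" shows "f * g = - (g * f)"
proof (rule grassmann_eqI)
  fix U
  show "coeff_grassmann (f * g) U = coeff_grassmann (- (g * f)) U"
  proof (cases "finite U")
    case True
    show ?thesis
      unfolding coeff_times_swap[OF True] times_grassmann.rep_eq[of g f] uminus_grassmann.rep_eq
        sum_negf[symmetric]
    proof (rule sum.cong)
      fix S
      show "(- 1) ^ (card S * card (U - S)) * ((- 1) ^ inversions S (U - S) * coeff_grassmann g S * coeff_grassmann f (U - S))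
        = - ((- 1) ^ inversions S (U - S) * coeff_grassmann g S * coeff_grassmann f (U - S))"
        using assms
        by (cases "coeff_grassmann f (U - S) = 0"; cases "coeff_grassmann g S = 0")
          (auto simp: grassmann_odd_def)
    qed simp
  qed (simp add: coeff_grassmann_infinite)
qed

lemma grassmann_even_closed:
  shows "0 \<in> grassmann_even"
    and "1 \<in> grassmann_even"
    and "f \<in> grassmann_even \<Longrightarrow> g \<in> grassmann_even \<Longrightarrow> f + g \<in> grassmann_even"
    and "f \<in> grassmann_even \<Longrightarrow> - f \<in> grassmann_even"
    and "f \<in> grassmann_even \<Longrightarrow> g \<in> grassmann_even \<Longrightarrow> f - g \<in> grassmann_even"
    and "f \<in> grassmann_even \<Longrightarrow> scale_grassmann c f \<in> grassmann_even"
  unfolding grassmann_even_def mem_Collect_eq coeff_simps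
  by (simp_all split: if_splits) (metis add_0, metis diff_self diff_0_right, metis mult_zero_right)

lemma grassmann_odd_closed:
  shows "0 \<in> grassmann_odd"
    and "f \<in> grassmann_odd \<Longrightarrow> g \<in> grassmann_odd \<Longrightarrow> f + g \<in> grassmann_odd"
    and "f \<in> grassmann_odd \<Longrightarrow> - f \<in> grassmann_odd"
    and "f \<in> grassmann_odd \<Longrightarrow> g \<in> grassmann_odd \<Longrightarrow> f - g \<in> grassmann_odd"
    and "f \<in> grassmann_odd \<Longrightarrow> scale_grassmann c f \<in> grassmann_odd"
  unfolding grassmann_odd_def mem_Collect_eq coeff_simps
  by (simp_all split: if_splits) (metis add_0, metis diff_self diff_0_right, metis mult_zero_right)

lemma odd_times_odd:
  assumes "f \<in> grassmann_odd" "g \<in> grassmann_odd" shows "f * g \<in> grassmann_even"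
  unfolding grassmann_even_def
proof (intro CollectI allI impI)
  fix U assume "coeff_grassmann (f * g) U \<noteq> 0"
  then obtain S where S: "finite U" "S \<subseteq> U" "coeff_grassmann f S \<noteq> 0" "coeff_grassmann g (U - S) \<noteq> 0"
    by (rule coeff_times_nonzero)
  then have "card U = card S + card (U - S)"
    by (metis card_Diff_subset card_mono finite_subset le_add_diff_inverse)
  with S assms show "even (card U)" by (simp add: grassmann_odd_def)
qed

lemma odd_square:
  assumes "f \<in> grassmann_odd" and two: "(2 :: 'a::field) \<noteq> 0"
  shows "f * f = (0 :: 'a grassmann)"
proof (rule grassmann_eqI)
  fix U
  have "coeff_grassmann (f * f) U = - coeff_grassmann (f * f) U"
    using odd_anticommute[OF assms(1,1)] by (metis uminus_grassmann.rep_eq)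
  then have "2 * coeff_grassmann (f * f) U = 0" by (simp add: eq_neg_iff_add_eq_0)
  with two show "coeff_grassmann (f * f) U = coeff_grassmann 0 U" by (simp add: coeff_simps)
qed

section \<open>Values of commutators\<close>

lemma matrix_2_eqI:
  fixes A B :: "'b^2^2"
  shows "A $ 1 $ 1 = B $ 1 $ 1 \<Longrightarrow> A $ 1 $ 2 = B $ 1 $ 2 \<Longrightarrow> A $ 2 $ 1 = B $ 2 $ 1
    \<Longrightarrow> A $ 2 $ 2 = B $ 2 $ 2 \<Longrightarrow> A = B"
  by (simp add: vec_eq_iff forall_2)

lemma mat_2 [simp]:
  fixes g :: "'b::zero"
  shows "(mat g :: 'b^2^2) $ 1 $ 1 = g" "(mat g :: 'b^2^2) $ 1 $ 2 = 0"
    "(mat g :: 'b^2^2) $ 2 $ 1 = 0" "(mat g :: 'b^2^2) $ 2 $ 2 = g"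
  by (simp_all add: mat_def)

lemma matrix_mult_2:
  "((A :: 'b::ring_1^2^2) ** B) $ i $ j = A $ i $ 1 * B $ 1 $ j + A $ i $ 2 * B $ 2 $ j"
  by (simp add: matrix_matrix_mult_def sum_2)

lemma mat_mult_mat: "(mat g :: 'b::ring_1^2^2) ** mat h = mat (g * h)"
  by (rule matrix_2_eqI) (simp_all add: matrix_mult_2)

text \<open>An element of \<open>W\<close> is \<open>a I\<close>, with \<open>a\<close> even and hence central, plus an off-diagonal matrix with odd
  entries \<open>b\<close> and \<open>c\<close>. So a commutator of two such elements is the scalar matrix with the even entry
  \<open>b\<^sub>i c\<^sub>j + c\<^sub>i b\<^sub>j\<close>.\<close>

definition pairing :: "(nat \<Rightarrow> 'a::comm_ring_1 grassmann^2^2) \<Rightarrow> nat \<times> nat \<Rightarrow> 'a grassmann"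
  where "pairing w e = w (fst e) $ 1 $ 2 * w (snd e) $ 2 $ 1 + w (fst e) $ 2 $ 1 * w (snd e) $ 1 $ 2"

definition admissible :: "(nat \<Rightarrow> 'a::comm_ring_1 grassmann^2^2) \<Rightarrow> bool"
  where "admissible w \<longleftrightarrow> (\<forall>i. w i \<in> M11_str0)"

lemma I_w_iff: "f \<in> I_w \<longleftrightarrow> (\<forall>w. admissible w \<longrightarrow> eval_poly w f = 0)"
  by (simp add: I_w_def admissible_def)

lemma admissibleD:
  assumes "admissible w"
  shows "w i $ 1 $ 1 \<in> grassmann_even" "w i $ 2 $ 2 = w i $ 1 $ 1"
    "w i $ 1 $ 2 \<in> grassmann_odd" "w i $ 2 $ 1 \<in> grassmann_odd"
  using assms by (auto simp: admissible_def M11_str0_def M11_def str_def)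

lemma pairing_even: "admissible w \<Longrightarrow> pairing w e \<in> grassmann_even"
  by (simp add: pairing_def grassmann_even_closed odd_times_odd admissibleD)

lemma eval_var: "eval_poly w (var i) = w i"
  by (simp add: var_def eval_single eval_word_def scale_mat_simps)

lemma eval_commutator:
  "eval_poly w (commutator f g) = eval_poly w f ** eval_poly w g - eval_poly w g ** eval_poly w f"
  by (simp add: commutator_def eval_diff eval_mult)

lemma eval_comm_pair:
  assumes "admissible w" shows "eval_poly w (comm_pair e) = mat (pairing w e)"
proof (rule matrix_2_eqI)
  obtain i j where e: "e = (i, j)" by force
  note d = admissibleD[OF assms]
  note c = even_central[OF d(1)[of i], of "w j $ 1 $ 1"] even_central[OF d(1)[of i], of "w j $ 1 $ 2"]
    even_central[OF d(1)[of i], of "w j $ 2 $ 1"] even_central[OF d(1)[of j], of "w i $ 1 $ 2"]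
    even_central[OF d(1)[of j], of "w i $ 2 $ 1"]
    odd_anticommute[OF d(3)[of j] d(4)[of i]] odd_anticommute[OF d(4)[of j] d(3)[of i]]
  let ?M = "mat (pairing w e) :: 'a grassmann^2^2"
  note expand = comm_pair_def eval_commutator eval_var e pairing_def matrix_mult_2 d(2)
    vector_minus_component fst_conv snd_conv mat_2
  show "eval_poly w (comm_pair e) $ 1 $ 1 = ?M $ 1 $ 1"
    unfolding expand c by simp
  show "eval_poly w (comm_pair e) $ 1 $ 2 = ?M $ 1 $ 2"
    unfolding expand c by simp
  show "eval_poly w (comm_pair e) $ 2 $ 1 = ?M $ 2 $ 1"
    unfolding expand c by simp
  show "eval_poly w (comm_pair e) $ 2 $ 2 = ?M $ 2 $ 2"
    unfolding expand c by simp
qed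

lemma eval_comm_prod:
  assumes "admissible w" shows "eval_poly w (comm_prod c) = mat (prod_list (map (pairing w) c))"
  by (induction c) (simp_all add: eval_1 eval_mult eval_comm_pair[OF assms] mat_mult_mat)

lemma mat_even_central:
  fixes A :: "'a::comm_ring_1 grassmann^2^2"
  assumes "g \<in> grassmann_even" shows "mat g ** A = A ** mat g"
  by (intro matrix_2_eqI) (simp_all add: matrix_mult_2 even_central[OF assms])

lemma eval_triple_commutator:
  assumes "admissible w"
  shows "eval_poly w (commutator (comm_pair e) f) = 0"
  using assms by (simp add: eval_commutator eval_comm_pair mat_even_central pairing_even)

text \<open>Each factor is a multiple of \<open>c\<^sub>l\<close> plus a multiple of \<open>b\<^sub>l\<close>, and both have square zero. Among three
  factors, two contribute a multiple of the same element.\<close>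

lemma pairing_cube:
  assumes w: "admissible w" and two: "(2 :: 'a::field) \<noteq> 0"
  shows "pairing w (i, l) * pairing w (j, l) * pairing w (m, l) = (0 :: 'a grassmann)"
proof -
  note d = admissibleD[OF w]
  define X where "X i = w i $ 1 $ 2 * w l $ 2 $ 1" for i
  define Y where "Y i = w i $ 2 $ 1 * w l $ 1 $ 2" for i
  have even: "X i \<in> grassmann_even" "Y i \<in> grassmann_even" for i
    by (simp_all add: X_def Y_def odd_times_odd d)
  have *: "a * c * (b * c) = 0" if "b \<in> grassmann_odd" "c \<in> grassmann_odd" for a b c :: "'a grassmann"
  proof -
    have "a * c * (b * c) = a * (c * b) * c" by (simp add: mult.assoc)
    also have "\<dots> = - (a * b * (c * c))" by (simp add: odd_anticommute[OF that(2,1)] mult.assoc)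
    finally show ?thesis using odd_square[OF that(2) two] by simp
  qed
  have XX: "X i * X j = 0" and YY: "Y i * Y j = 0" for i j
    by (simp_all add: X_def Y_def * d)
  have "X i * Y j * X m = 0"
    using even_central[OF even(2), of j "X m"] by (simp add: mult.assoc) (simp add: XX flip: mult.assoc)
  moreover have "Y i * X j * Y m = 0"
    using even_central[OF even(1), of j "Y m"] by (simp add: mult.assoc) (simp add: YY flip: mult.assoc)
  moreover have "X i * Y j * Y m = 0" "Y i * X j * X m = 0"
    by (simp_all add: mult.assoc XX YY)
  ultimately have "(X i + Y i) * (X j + Y j) * (X m + Y m) = 0"
    by (simp add: distrib_left distrib_right XX YY)
  then show ?thesis by (simp add: pairing_def X_def Y_def)
qed

lemma eval_scale: "eval_poly w (scale_free c f) = scale_mat c (eval_poly w f)"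
proof -
  have "scale_mat c (mat 1) ** A = scale_mat c A" for A :: "'a grassmann^2^2"
    using scale_mat_simps(3)[of c "mat 1" 1 A] by (simp add: scale_mat_simps)
  then show ?thesis
    by (simp add: scale_free_def eval_mult eval_single eval_word_def)
qed

lemma eval_Omega:
  assumes w: "admissible w" and h: "h \<in> Omega"
  shows "eval_poly w h \<in> M11_str0"
  using h unfolding Omega_def
proof (induction rule: free.span_induct_alt)
  case base
  then show ?case by (simp add: zero_in_M11_str0)
next
  case (step c a y)
  have "eval_poly w a \<in> M11_str0"
    using step(1) w by (auto simp: eval_1 eval_var admissible_def M11_str0_def M11_def str_def
        grassmann_even_closed grassmann_odd_closed)
  with step(2) show ?case
    by (simp add: eval_add eval_scale M11_str0_def M11_def str_def scale_mat_def
        grassmann_even_closed grassmann_odd_closed)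
qed

lemma eval_endomorphism:
  assumes "algebra_endomorphism \<phi>"
  shows "eval_poly w (\<phi> f) = eval_poly (\<lambda>i. eval_poly w (\<phi> (var i))) f"
    (is "_ = eval_poly ?v f")
proof -
  from assms interpret Vector_Spaces.linear scale_free scale_free \<phi>
    by (simp add: algebra_endomorphism_def)
  have mult: "\<phi> (f * g) = \<phi> f * \<phi> g" and one: "\<phi> 1 = 1" for f g
    using assms by (auto simp: algebra_endomorphism_def)
  have word: "eval_poly w (\<phi> (prod_list (map var l))) = eval_poly ?v (prod_list (map var l))" for l
    by (induction l) (simp_all add: mult one eval_mult eval_1 eval_var)
  show ?thesis
    using free_span_words[of f]
    by (induction rule: free.span_induct_alt) (auto simp: add scale eval_add eval_scale word)
qed

text \<open>\<open>W\<close> is a subspace that contains the scalar matrices, so evaluation at elements of \<open>W\<close> sends \<open>\<Omega>\<close> into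
  \<open>W\<close>.\<close>

lemma Omega_ideal_I_w: "Omega_ideal I_w"
  unfolding Omega_ideal_def Omega_stable_def
proof (intro conjI allI impI two_sided_ideal_I_w subsetI)
  fix \<phi> :: "'a free_alg \<Rightarrow> 'a free_alg" and g
  assume \<phi>: "algebra_endomorphism \<phi> \<and> (\<forall>i. \<phi> (var i) \<in> Omega)" and "g \<in> \<phi> ` I_w"
  then obtain f where f: "f \<in> I_w" "g = \<phi> f" by blast
  show "g \<in> I_w"
    unfolding I_w_iff
  proof (intro allI impI)
    fix w :: "nat \<Rightarrow> 'a grassmann^2^2" assume "admissible w"
    then have "admissible (\<lambda>i. eval_poly w (\<phi> (var i)))"
      using \<phi> eval_Omega by (auto simp: admissible_def)
    with f(1) have "eval_poly (\<lambda>i. eval_poly w (\<phi> (var i))) f = 0"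
      by (simp add: I_w_iff)
    then show "eval_poly w g = 0"
      using f(2) \<phi> eval_endomorphism[of \<phi> w f] by (simp only:)
  qed
qed

lemma Omega_generated_subset_I_w:
  assumes two: "(2 :: 'a::field) \<noteq> 0"
  shows "Omega_generated {commutator (commutator (var 0) (var 1)) (var 2),
    commutator (var 1) (var 0) * commutator (var 2) (var 0) * commutator (var 3) (var 0)}
    \<subseteq> (I_w :: 'a free_alg set)"
  unfolding Omega_generated_def
proof (rule hull_minimal)
  have "commutator (comm_pair (0, 1)) (var 2) \<in> (I_w :: 'a free_alg set)"
    by (simp add: I_w_iff eval_triple_commutator)
  moreover have "comm_prod [(1, 0), (2, 0), (3, 0)] \<in> (I_w :: 'a free_alg set)"
    unfolding I_w_iff
  proof (intro allI impI)
    fix w :: "nat \<Rightarrow> 'a grassmann^2^2" assume w: "admissible w"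
    have "prod_list (map (pairing w) [(1, 0), (2, 0), (3, 0)]) = 0"
      using pairing_cube[OF w two, of 1 0 2 3] by (simp add: mult.assoc)
    then show "eval_poly w (comm_prod [(1, 0), (2, 0), (3, 0)]) = 0"
      unfolding eval_comm_prod[OF w] by (simp add: vec_eq_iff mat_def)
  qed
  ultimately show "{commutator (commutator (var 0) (var 1)) (var 2),
    commutator (var 1) (var 0) * commutator (var 2) (var 0) * commutator (var 3) (var 0)}
    \<subseteq> (I_w :: 'a free_alg set)"
    by (simp add: comm_pair_def mult.assoc)
qed (rule Omega_ideal_I_w)

lemma two_neq_zero:
  assumes "CHAR('a::field) \<noteq> 2" shows "(2 :: 'a) \<noteq> 0"
proof
  assume "(2 :: 'a) = 0"
  then have "of_nat 2 = (0 :: 'a)" by simp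
  then have "CHAR('a) dvd 2" by (simp only: of_nat_eq_0_iff_char_dvd)
  moreover have "CHAR('a) \<noteq> 0" using calculation by (metis dvd_0_left_iff zero_neq_numeral)
  ultimately have "CHAR('a) = 1 \<or> CHAR('a) = 2" using dvd_imp_le[of "CHAR('a)" 2] by linarith
  with assms have "of_nat 1 = (0 :: 'a)" using of_nat_eq_0_iff_char_dvd[of 1, where 'a='a] by simp
  then show False by simp
qed

section \<open>Monomials of the Grassmann algebra\<close>

lift_definition emon :: "nat set \<Rightarrow> 'a::comm_ring_1 grassmann"
  is "\<lambda>A S. if S = A \<and> finite A then 1 else 0"
  by auto

lemma coeff_emon: "coeff_grassmann (emon A) S = (if S = A \<and> finite A then 1 else 0)"
  by (simp add: emon.rep_eq)

lemma emon_empty: "emon {} = 1"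
  by (rule grassmann_eqI) (simp add: coeff_simps coeff_emon)

definition gen :: "nat \<Rightarrow> 'a::comm_ring_1 grassmann"
  where "gen i = emon {i}"

lemma gen_odd: "gen i \<in> grassmann_odd"
  by (auto simp: gen_def grassmann_odd_def coeff_emon)

lemma gen_times_emon:
  assumes "finite A"
  shows "gen i * emon A = (if i \<in> A then 0
    else scale_grassmann ((- 1) ^ inversions {i} A) (emon (insert i A)))"
proof (rule grassmann_eqI)
  fix U
  show "coeff_grassmann (gen i * emon A) U = coeff_grassmann (if i \<in> A then 0
    else scale_grassmann ((- 1) ^ inversions {i} A) (emon (insert i A))) U"
  proof (cases "finite U")
    case True
    have "coeff_grassmann (gen i * emon A) U
      = (\<Sum>S\<in>Pow U. if S = {i} then (if U - {i} = A then (- 1) ^ inversions {i} A else 0) else 0)"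
      unfolding times_grassmann.rep_eq using assms by (intro sum.cong) (auto simp: gen_def coeff_emon)
    also have "\<dots> = (if i \<in> U \<and> U - {i} = A then (- 1) ^ inversions {i} A else 0)"
      using True by (simp add: sum.delta)
    also have "i \<in> U \<and> U - {i} = A \<longleftrightarrow> i \<notin> A \<and> U = insert i A" by auto
    finally show ?thesis using assms
      by (cases "i \<in> A"; cases "U = insert i A") (simp_all add: coeff_simps coeff_emon)
  qed (simp add: coeff_grassmann_infinite)
qed

text \<open>Up to sign, a product of distinct generators is a basis element of the Grassmann algebra, and a
  product with a repeated generator vanishes.\<close>

definition gens :: "nat list \<Rightarrow> 'a::comm_ring_1 grassmann"
  where "gens l = prod_list (map gen l)"

lemma gens_simps [simp]: "gens [] = 1" "gens (i # l) = gen i * gens l"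
  by (simp_all add: gens_def)

lemma gens_append: "gens (l @ l') = gens l * gens l'"
  by (simp add: gens_def)

lemma scale_grassmann_mult:
  "scale_grassmann c f * g = scale_grassmann c (f * g)" "f * scale_grassmann c g = scale_grassmann c (f * g)"
  using scale_grassmann_simps(3)[of c f 1 g] scale_grassmann_simps(3)[of 1 f c g]
  by (simp_all add: scale_grassmann_simps)

lemma scale_grassmann_scale: "scale_grassmann c (scale_grassmann d f) = scale_grassmann (c * d) f"
  by (rule grassmann_eqI) (simp add: coeff_simps mult.assoc)

lemma gens_distinct:
  assumes "distinct l"
  obtains \<epsilon> :: "'a::comm_ring_1" where "\<epsilon> = 1 \<or> \<epsilon> = - 1" "gens l = scale_grassmann \<epsilon> (emon (set l))"
proof -
  have "\<exists>\<epsilon>::'a. (\<epsilon> = 1 \<or> \<epsilon> = - 1) \<and> gens l = scale_grassmann \<epsilon> (emon (set l))"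
    using assms
  proof (induction l)
    case (Cons i l)
    then obtain \<epsilon> :: 'a where *: "\<epsilon> = 1 \<or> \<epsilon> = - 1" "gens l = scale_grassmann \<epsilon> (emon (set l))" by auto
    have "gens (i # l) = scale_grassmann (\<epsilon> * (- 1) ^ inversions {i} (set l)) (emon (set (i # l)))"
      using Cons.prems by (simp add: * scale_grassmann_mult gen_times_emon scale_grassmann_scale)
    moreover have "\<epsilon> * (- 1) ^ inversions {i} (set l) = 1 \<or> \<epsilon> * (- 1) ^ inversions {i} (set l) = - 1"
      using *(1) by (auto simp: minus_one_power_iff)
    ultimately show ?case by blast
  qed (auto simp: emon_empty scale_grassmann_simps)
  with that show thesis by blast
qed

lemma gens_not_distinct: "\<not> distinct l \<Longrightarrow> gens l = 0"
proof (induction l)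
  case (Cons i l)
  show ?case
  proof (cases "distinct l")
    case True
    then obtain \<epsilon> where "gens l = (scale_grassmann \<epsilon> (emon (set l)) :: 'a grassmann)"
      by (rule gens_distinct)
    with Cons.prems True show ?thesis
      by (simp add: scale_grassmann_mult gen_times_emon scale_grassmann_simps)
  qed (use Cons in simp)
qed simp

lemma gens_sorted: "sorted l \<Longrightarrow> distinct l \<Longrightarrow> gens l = emon (set l)"
proof (induction l)
  case (Cons i l)
  have "{(s, t) \<in> {i} \<times> set l. t < s} = {}" using Cons.prems by auto
  then have "inversions {i} (set l) = 0" by (simp only: inversions_def card.empty)
  with Cons show ?case by (simp add: gen_times_emon scale_grassmann_simps)
qed (simp add: emon_empty)

lemma coeff_gens_nonzero:
  assumes "coeff_grassmann (gens l) A \<noteq> 0" shows "mset l = mset_set A"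
proof -
  have d: "distinct l" using assms by (metis gens_not_distinct zero_grassmann.rep_eq)
  then obtain \<epsilon> where "gens l = (scale_grassmann \<epsilon> (emon (set l)) :: 'a grassmann)"
    by (rule gens_distinct)
  with assms have "A = set l" by (auto simp: coeff_simps coeff_emon split: if_splits)
  with d show ?thesis by (simp add: mset_set_set)
qed

lemma coeff_gens_set:
  assumes "distinct l" shows "coeff_grassmann (gens l :: 'a::field grassmann) (set l) \<noteq> 0"
proof -
  from assms obtain \<epsilon> where "\<epsilon> = 1 \<or> \<epsilon> = - 1" "gens l = (scale_grassmann \<epsilon> (emon (set l)) :: 'a grassmann)"
    by (rule gens_distinct)
  then show ?thesis by (auto simp: coeff_simps coeff_emon)
qed

section \<open>Nested pairs\<close>

text \<open>Read as edges, the pairs form a rainbow: each one lies strictly inside the previous ones.\<close>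

fun nested :: "(nat \<times> nat) list \<Rightarrow> bool" where
  "nested [] \<longleftrightarrow> True"
| "nested (e # r) \<longleftrightarrow> fst e < snd e \<and> (\<forall>f\<in>set r. fst e < fst f \<and> snd f < snd e) \<and> nested r"

definition verts :: "(nat \<times> nat) multiset \<Rightarrow> nat multiset"
  where "verts M = (\<Sum>e\<in>#M. {#fst e, snd e#})"

lemma verts_simps [simp]: "verts {#} = {#}"
  "verts (add_mset e M) = add_mset (fst e) (add_mset (snd e) (verts M))"
  "verts (M + N) = verts M + verts N"
  by (simp_all add: verts_def)

lemma in_verts: "i \<in># verts M \<longleftrightarrow> (\<exists>e\<in>#M. i = fst e \<or> i = snd e)"
  by (induction M) auto

lemma nested_less: "nested r \<Longrightarrow> e \<in> set r \<Longrightarrow> fst e < snd e"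
  by (induction r) auto

lemma nested_distinct: "nested r \<Longrightarrow> distinct r"
  by (induction r) auto

lemma nested_verts_distinct: "nested r \<Longrightarrow> count (verts (mset r)) i \<le> 1"
proof (induction r)
  case (Cons e r)
  have "fst e \<notin># verts (mset r)" "snd e \<notin># verts (mset r)"
    using Cons.prems nested_less[of r] by (fastforce simp: in_verts)+
  with Cons show ?case by (auto simp: not_in_iff)
qed simp

text \<open>Among the perfect matchings of a set of indices, the rainbow is the unique one of smallest weight.
  If the outermost indices \<open>a < z\<close> are not matched with each other, but \<open>a\<close> with \<open>x\<close> and \<open>z\<close> with \<open>y\<close>, then
  matching \<open>a\<close> with \<open>z\<close> and \<open>x\<close> with \<open>y\<close> instead lowers the weight by \<open>(y - a)(z - x) > 0\<close>.\<close>

lemma nested_minimal: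
  assumes "nested r" "\<forall>e\<in>#c. fst e < snd e" "verts c = verts (mset r)"
  shows "pair_weight (mset r) \<le> pair_weight c \<and> (pair_weight (mset r) = pair_weight c \<longrightarrow> c = mset r)"
  using assms
proof (induction r arbitrary: c)
  case Nil
  then have "c = {#}" by (cases c) auto
  then show ?case by simp
next
  case (Cons e r)
  obtain a z where e: "e = (a, z)" by force
  have az: "a < z" and r: "nested r" and inner: "\<And>f. f \<in> set r \<Longrightarrow> a < fst f \<and> snd f < z"
    using Cons.prems(1) by (auto simp: e)
  have V: "verts c = add_mset a (add_mset z (verts (mset r)))"
    using Cons.prems(3) by (simp add: e)
  have between: "a < i \<and> i < z" if "i \<in># verts (mset r)" for i
    using that inner nested_less[OF r] by (fastforce simp: in_verts)
  have range: "a \<le> i \<and> i \<le> z" if "i \<in># verts c" for i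
    using that between az by (auto simp: V less_imp_le)
  have once: "count (verts c) a = 1" "count (verts c) z = 1"
    using between az by (auto simp: V not_in_iff[symmetric])
  obtain f where f: "f \<in># c" "a = fst f \<or> a = snd f"
    using V in_verts[of a c] by auto
  have "fst f \<in># verts c" using f(1) in_verts by blast
  then have fa: "fst f = a" using f range[of "fst f"] Cons.prems(2) by force
  then obtain x where fx: "f = (a, x)" by (cases f) auto
  obtain g where g: "g \<in># c" "z = fst g \<or> z = snd g"
    using V in_verts[of z c] by auto
  have "snd g \<in># verts c" using g(1) in_verts by blast
  then have "snd g = z" using g range[of "snd g"] Cons.prems(2) by force
  then obtain y where gy: "g = (y, z)" by (cases g) auto
  show ?case
  proof (cases "f = g")
    case True
    then have fe: "f = (a, z)" using fx gy by simp
    obtain d where c: "c = add_mset f d" using f(1) by (meson mset_add)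
    have "verts d = verts (mset r)" using V by (simp add: c fe)
    then show ?thesis
      using Cons.IH[OF r, of d] Cons.prems(2) by (auto simp: c fe e)
  next
    case False
    obtain d' where c': "c = add_mset f d'" using f(1) by (meson mset_add)
    with False g(1) have "g \<in># d'" by simp
    then obtain d where d': "d' = add_mset g d" by (meson mset_add)
    have c: "c = add_mset (a, x) (add_mset (y, z) d)" by (simp add: c' d' fx gy)
    have ax: "a < x" and yz: "y < z" using Cons.prems(2) by (auto simp: c)
    have ya: "y \<noteq> a" using once(1) by (auto simp: c split: if_splits)
    have xz: "x \<noteq> z" using once(2) by (auto simp: c split: if_splits)
    have xy: "add_mset x (add_mset y (verts d)) = verts (mset r)"
      using V by (simp add: c add_mset_commute)
    have "y \<noteq> x"
      using nested_verts_distinct[OF r, of x] by (auto simp flip: xy)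
    have bounds: "a < y" "x < z"
      using range[of y] range[of x] ya xz by (auto simp: c)
    \<comment> \<open>replace the edges \<open>a - x\<close> and \<open>y - z\<close> by \<open>a - z\<close> and the edge between \<open>x\<close> and \<open>y\<close>\<close>
    define d1 where "d1 = add_mset (min x y, max x y) d"
    have "verts d1 = verts (mset r)"
      unfolding xy[symmetric] by (cases "x \<le> y") (auto simp: d1_def add_mset_commute)
    moreover have "\<forall>e\<in>#d1. fst e < snd e"
      using Cons.prems(2) \<open>y \<noteq> x\<close> by (auto simp: d1_def c min_def max_def)
    ultimately have "pair_weight (mset r) \<le> pair_weight d1"
      using Cons.IH[OF r, of d1] by blast
    moreover have "pair_weight d1 = x * y + pair_weight d"
      by (simp add: d1_def min_def max_def)
    moreover have "a * z + x * y < a * x + y * z"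
    proof -
      obtain s where s: "z = x + s" "s > 0" using bounds by (metis less_imp_add_positive)
      obtain t where t: "y = a + t" "t > 0" using bounds by (metis less_imp_add_positive)
      show ?thesis using s t by (simp add: algebra_simps)
    qed
    ultimately have "pair_weight (mset (e # r)) < pair_weight c"
      by (simp add: c e)
    then show ?thesis by simp
  qed
qed

lemma antichain_nested:
  assumes "finite S" "\<forall>e\<in>S. fst e < snd e" "\<forall>e\<in>S. \<forall>f\<in>S. pair_le e f \<longrightarrow> e = f"
  shows "\<exists>r. nested r \<and> mset r = mset_set S"
  using assms
proof (induction "card S" arbitrary: S)
  case 0
  then show ?case by (intro exI[of _ "[]"]) simp
next
  case (Suc n)
  then have "S \<noteq> {}" by auto
  then obtain e where e: "e \<in> S" "\<And>f. f \<in> S \<Longrightarrow> fst e \<le> fst f"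
    using Suc.prems(1) ex_min_if_finite[of "fst ` S"] by (metis (no_types, lifting) arg_min_if_finite(1) arg_min_least)
  have "\<exists>r. nested r \<and> mset r = mset_set (S - {e})"
    using Suc e by (intro Suc.hyps(1)) auto
  then obtain r where r: "nested r" "mset r = mset_set (S - {e})" by blast
  then have "set r = S - {e}" using Suc.prems(1) by (metis finite_Diff finite_set_mset_mset_set set_mset_mset)
  moreover have "fst e < fst f \<and> snd f < snd e" if "f \<in> S - {e}" for f
  proof -
    have "\<not> pair_le e f" "\<not> pair_le f e" using that e(1) Suc.prems(3) by auto
    with e(2)[of f] that show ?thesis by (auto simp: pair_le_def)
  qed
  ultimately have "nested (e # r)" using r e Suc.prems(2) by auto
  moreover have "mset (e # r) = mset_set S"
    using e(1) Suc.prems(1) r(2) by (simp add: mset_set.remove)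
  ultimately show ?case by blast
qed

text \<open>The minimal pairs of the product order form an antichain. So do the remaining ones, because two
  comparable pairs among them and a minimal one below would be a chain of three. An antichain of
  pairs is a rainbow.\<close>

lemma normal_pairs_nested:
  assumes "normal_pairs M"
  obtains r s where "nested r" "nested s" "M = mset r + mset s"
proof -
  define S where "S = {e \<in> set_mset M. \<forall>f\<in>#M. pair_le f e \<longrightarrow> f = e}"
  have fin: "finite S" by (simp add: S_def)
  have SM: "mset_set S \<subseteq># M"
    by (rule mset_subset_eqI) (auto simp: S_def count_mset_set' Suc_le_eq)
  define N where "N = M - mset_set S"
  have M: "M = mset_set S + N" using SM by (simp add: N_def)
  have less: "fst e < snd e" if "e \<in># M" for e
    using assms that by (simp add: normal_pairs_def)
  have below: "\<exists>f\<in>S. pair_le f e" if "e \<in># M" for e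
    using that
  proof (induction "fst e + snd e" arbitrary: e rule: less_induct)
    case less
    show ?case
    proof (cases "e \<in> S")
      case False
      with less.prems obtain f where f: "f \<in># M" "pair_le f e" "f \<noteq> e" by (auto simp: S_def)
      then have "fst f + snd f < fst e + snd e"
        by (cases f; cases e) (auto simp: pair_le_def)
      with less(1) f(1) obtain g where "g \<in> S" "pair_le g f" by blast
      with f(2) show ?thesis by (auto simp: pair_le_def intro!: bexI[of _ g])
    qed (auto simp: pair_le_def)
  qed
  have chain: False if "{#e, f#} \<subseteq># N" "pair_le e f" for e f
  proof -
    have "e \<in># M" using that(1) M by (metis insert_subset_eq_iff mset_subset_eqD union_iff)
    then obtain g where g: "g \<in> S" "pair_le g e" using below by blast
    have "{#g#} + {#e, f#} \<subseteq># M"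
      unfolding M using that(1) g(1) fin by (intro subset_mset.add_mono) auto
    then have "{#g, e, f#} \<subseteq># M"
      by (simp only: add_mset_add_single[symmetric] union_mset_add_mset_left add_0)
    with assms g(2) that(2) show False unfolding normal_pairs_def by blast
  qed
  have N: "N = mset_set (set_mset N)"
  proof (rule multiset_eqI)
    fix e
    have "count N e \<le> 1"
    proof (rule ccontr)
      assume "\<not> count N e \<le> 1"
      then have "{#e, e#} \<subseteq># N" by (intro mset_subset_eqI) auto
      then show False using chain[of e e] by (simp add: pair_le_def)
    qed
    then show "count N e = count (mset_set (set_mset N)) e"
      by (cases "e \<in># N") (auto simp: count_mset_set' le_Suc_eq count_eq_zero_iff)
  qed
  have "\<exists>r. nested r \<and> mset r = mset_set S"
    using less by (intro antichain_nested fin) (auto simp: S_def)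
  moreover have "\<exists>s. nested s \<and> mset s = mset_set (set_mset N)"
  proof (intro antichain_nested ballI impI)
    fix e f assume ef: "e \<in># N" "f \<in># N" "pair_le e f"
    show "e = f"
    proof (rule ccontr)
      assume "e \<noteq> f"
      with ef have "{#e, f#} \<subseteq># N"
        by (intro mset_subset_eqI) (auto simp: Suc_le_eq)
      with chain ef(3) show False by blast
    qed
  qed (use less M in auto)
  ultimately show thesis using that M N by metis
qed

section \<open>Triangularity of the normal forms\<close>

fun splits :: "'b list \<Rightarrow> ('b list \<times> 'b list) list" where
  "splits [] = [([], [])]"
| "splits (e # c) = map (\<lambda>(p, q). (e # p, q)) (splits c) @ map (\<lambda>(p, q). (p, e # q)) (splits c)"

lemma splits_mset: "(p, q) \<in> set (splits c) \<Longrightarrow> mset c = mset p + mset q"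
  by (induction c arbitrary: p q) auto

lemma prod_list_add_expand:
  fixes Y Z :: "'e \<Rightarrow> 'b::ring_1"
  assumes central: "\<And>e x. Z e * x = x * Z e"
  shows "prod_list (map (\<lambda>e. Y e + Z e) c)
    = (\<Sum>(p, q)\<leftarrow>splits c. prod_list (map Y p) * prod_list (map Z q))"
proof (induction c)
  case (Cons e c)
  have Z: "Z e * (\<Sum>(p, q)\<leftarrow>ps. prod_list (map Y p) * prod_list (map Z q))
    = (\<Sum>(p, q)\<leftarrow>ps. prod_list (map Y p) * prod_list (map Z (e # q)))" for ps
  proof (induction ps)
    case (Cons pq ps)
    obtain p q where "pq = (p, q)" by force
    then show ?case using Cons central[of e "prod_list (map Y p)"]
      by (simp add: distrib_left mult.assoc[symmetric])
  qed simp
  have Y: "Y e * (\<Sum>(p, q)\<leftarrow>ps. prod_list (map Y p) * prod_list (map Z q))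
    = (\<Sum>(p, q)\<leftarrow>ps. prod_list (map Y (e # p)) * prod_list (map Z q))" for ps
    by (induction ps) (auto simp: distrib_left mult.assoc)
  have "prod_list (map (\<lambda>e. Y e + Z e) (e # c))
    = Y e * (\<Sum>(p, q)\<leftarrow>splits c. prod_list (map Y p) * prod_list (map Z q))
      + Z e * (\<Sum>(p, q)\<leftarrow>splits c. prod_list (map Y p) * prod_list (map Z q))"
    by (simp add: Cons distrib_right)
  then show ?case
    unfolding Y Z by (simp add: comp_def case_prod_unfold)
qed simp

text \<open>An element of \<open>S \<inter> T\<close> occurs twice in \<open>c\<close>, and either copy can go to \<open>S\<close>. That the number is a
  power of two matters because it becomes a factor in a field of characteristic different
  from two.\<close>

lemma count_splits:
  assumes "finite S" "finite T" "mset c = mset_set S + mset_set T"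
  shows "length (filter (\<lambda>(p, q). mset p = mset_set S \<and> mset q = mset_set T) (splits c))
    = 2 ^ card (S \<inter> T)"
  using assms
proof (induction c arbitrary: S T)
  case Nil
  then show ?case by (simp add: mset_set_empty_iff)
next
  case (Cons e c)
  let ?N = "\<lambda>S T. length (filter (\<lambda>(p, q). mset p = mset_set S \<and> mset q = mset_set T) (splits c))"
  have add: "add_mset e (mset p) = mset_set A \<longleftrightarrow> e \<in> A \<and> mset p = mset_set (A - {e})" if "finite A" for p A
  proof (cases "e \<in> A")
    case True
    with that show ?thesis by (simp add: mset_set.remove)
  next
    case False
    then have "e \<notin># mset_set A" using that by simp
    then have "add_mset e (mset p) \<noteq> mset_set A" by (metis union_single_eq_member)
    with False show ?thesis by simp
  qed
  have left: "length (filter (\<lambda>(p, q). add_mset e (mset p) = mset_set S \<and> mset q = mset_set T) (splits c))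
    = (if e \<in> S then ?N (S - {e}) T else 0)"
    using Cons.prems(1) by (simp add: add filter_False)
  have right: "length (filter (\<lambda>(p, q). mset p = mset_set S \<and> add_mset e (mset q) = mset_set T) (splits c))
    = (if e \<in> T then ?N S (T - {e}) else 0)"
    using Cons.prems(2) by (simp add: add filter_False)
  have "length (filter (\<lambda>(p, q). mset p = mset_set S \<and> mset q = mset_set T) (splits (e # c)))
    = (if e \<in> S then ?N (S - {e}) T else 0) + (if e \<in> T then ?N S (T - {e}) else 0)"
    unfolding left[symmetric] right[symmetric]
    by (simp add: filter_map comp_def case_prod_unfold)
  moreover have "?N (S - {e}) T = 2 ^ card ((S - {e}) \<inter> T)" if "e \<in> S"
  proof (rule Cons.IH)
    have "add_mset e (mset c) = add_mset e (mset_set (S - {e}) + mset_set T)"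
      using Cons.prems that by (simp add: mset_set.remove)
    then show "mset c = mset_set (S - {e}) + mset_set T" by simp
  qed (use Cons.prems in auto)
  moreover have "?N S (T - {e}) = 2 ^ card (S \<inter> (T - {e}))" if "e \<in> T"
  proof (rule Cons.IH)
    have "add_mset e (mset c) = add_mset e (mset_set S + mset_set (T - {e}))"
      using Cons.prems that by (simp add: mset_set.remove)
    then show "mset c = mset_set S + mset_set (T - {e})" by simp
  qed (use Cons.prems in auto)
  moreover have "e \<in> S \<or> e \<in> T"
  proof -
    have "e \<in># mset_set S + mset_set T" unfolding Cons.prems(3)[symmetric] by simp
    with Cons.prems show ?thesis by auto
  qed
  moreover have "(S - {e}) \<inter> T = S \<inter> T - {e}" "S \<inter> (T - {e}) = S \<inter> T - {e}" by auto
  moreover have "2 ^ card (S \<inter> T - {e}) + 2 ^ card (S \<inter> T - {e}) = (2::nat) ^ card (S \<inter> T)" if "e \<in> S" "e \<in> T"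
  proof -
    have "card (S \<inter> T) = Suc (card (S \<inter> T - {e}))"
      using that Cons.prems by (intro card.remove) auto
    then show ?thesis by simp
  qed
  ultimately show ?case by auto
qed

text \<open>Generators with even index are called \<open>y\<^sub>i\<close> below, those with odd index \<open>z\<^sub>i\<close>.\<close>

definition even_gens :: "(nat \<times> nat) list \<Rightarrow> nat list"
  where "even_gens p = concat (map (\<lambda>e. [2 * fst e, 2 * snd e]) p)"

definition odd_gens :: "(nat \<times> nat) list \<Rightarrow> nat list"
  where "odd_gens p = concat (map (\<lambda>e. [2 * fst e + 1, 2 * snd e + 1]) p)"

definition support :: "(nat \<times> nat) list \<Rightarrow> (nat \<times> nat) list \<Rightarrow> nat set"
  where "support r s = set (even_gens r @ odd_gens s)"

lemma mset_even_gens: "mset (even_gens p) = image_mset (\<lambda>i. 2 * i) (verts (mset p))"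
  by (induction p) (simp_all add: even_gens_def)

lemma mset_odd_gens: "mset (odd_gens p) = image_mset (\<lambda>i. 2 * i + 1) (verts (mset p))"
  by (induction p) (simp_all add: odd_gens_def)

lemma image_mset_even_odd_cancel:
  fixes A B A' B' :: "nat multiset"
  assumes "image_mset (\<lambda>i. 2 * i) A + image_mset (\<lambda>i. 2 * i + 1) B
    = image_mset (\<lambda>i. 2 * i) A' + image_mset (\<lambda>i. 2 * i + 1) B'"
  shows "A = A'" "B = B'"
proof -
  have *: "filter_mset even (image_mset (\<lambda>i. 2 * i) A + image_mset (\<lambda>i. 2 * i + 1) B) = image_mset (\<lambda>i. 2 * i) A"
    "filter_mset odd (image_mset (\<lambda>i. 2 * i) A + image_mset (\<lambda>i. 2 * i + 1) B) = image_mset (\<lambda>i. 2 * i + 1) B"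
    for A B :: "nat multiset"
    by (simp_all add: filter_mset_image_mset filter_mset_eq_conv)
  have half: "image_mset (\<lambda>i. i div 2) (image_mset (\<lambda>i. 2 * i) A) = A"
    "image_mset (\<lambda>i. i div 2) (image_mset (\<lambda>i. 2 * i + 1) A) = A" for A :: "nat multiset"
    by (simp_all add: multiset.map_comp comp_def)
  show "A = A'" using *(1) half(1) assms by metis
  show "B = B'" using *(2) half(2) assms by metis
qed

lemma count_image_inj: "inj f \<Longrightarrow> count (image_mset f M) (f x) = count M x"
  by (induction M) (auto simp: inj_eq)

lemma gens_even_odd_support:
  assumes "nested r" "nested s"
  shows "distinct (even_gens r @ odd_gens s)"
proof -
  have "count (mset (even_gens r @ odd_gens s)) i \<le> 1" for i
  proof (cases "even i")
    case True
    then obtain j where j: "i = 2 * j" by blast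
    have "count (image_mset (\<lambda>i. 2 * i + 1) (verts (mset s))) i = 0" using True by (auto simp: count_eq_zero_iff)
    moreover have "count (image_mset (\<lambda>i. 2 * i) (verts (mset r))) i = count (verts (mset r)) j"
      unfolding j by (rule count_image_inj) (auto simp: inj_def)
    ultimately show ?thesis using nested_verts_distinct[OF assms(1), of j]
      by (simp add: mset_even_gens mset_odd_gens)
  next
    case False
    then obtain j where j: "i = 2 * j + 1" using oddE by blast
    have "count (image_mset (\<lambda>i. 2 * i) (verts (mset r))) i = 0" using False by (auto simp: count_eq_zero_iff)
    moreover have "count (image_mset (\<lambda>i. 2 * i + 1) (verts (mset s))) i = count (verts (mset s)) j"
      unfolding j by (rule count_image_inj) (auto simp: inj_def)
    ultimately show ?thesis using nested_verts_distinct[OF assms(2), of j]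
      by (simp add: mset_even_gens mset_odd_gens)
  qed
  moreover have "count (mset (even_gens r @ odd_gens s)) i \<ge> 1" if "i \<in> set (even_gens r @ odd_gens s)" for i
    using that by (simp only: count_greater_eq_one_iff set_mset_mset)
  moreover have "count (mset (even_gens r @ odd_gens s)) i = 0" if "i \<notin> set (even_gens r @ odd_gens s)" for i
    using that by (simp add: count_eq_zero_iff del: count_mset set_append mset_append)
  ultimately show ?thesis
    unfolding distinct_count_atmost_1 by (metis le_antisym)
qed

text \<open>The value of \<open>[x\<^sub>i, x\<^sub>j]\<close> for \<open>b\<^sub>i = y\<^sub>i + z\<^sub>i\<close> and \<open>c\<^sub>i = y\<^sub>i - z\<^sub>i\<close>, namely \<open>2 y\<^sub>i y\<^sub>j - 2 z\<^sub>i z\<^sub>j\<close>. In this basis,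
  expanding a product of commutators distributes its edges between \<open>y\<close> and \<open>z\<close>.\<close>

definition edge :: "nat \<times> nat \<Rightarrow> 'a::field grassmann"
  where "edge e = scale_grassmann 2 (gens [2 * fst e, 2 * snd e])
    + scale_grassmann (- 2) (gens [2 * fst e + 1, 2 * snd e + 1])"

lemma prod_edge:
  "prod_list (map edge c) = (\<Sum>(p, q)\<leftarrow>splits c.
    scale_grassmann (2 ^ length p * (- 2) ^ length q) (gens (even_gens p @ odd_gens q)) :: 'a::field grassmann)"
proof -
  have even: "scale_grassmann c (gens [i, j]) \<in> grassmann_even" for c :: 'a and i j
    by (simp add: odd_times_odd gen_odd grassmann_even_closed)
  have Y: "prod_list (map (\<lambda>e. scale_grassmann 2 (gens [2 * fst e, 2 * snd e])) p)
    = (scale_grassmann (2 ^ length p) (gens (even_gens p)) :: 'a grassmann)" for p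
    by (induction p) (simp_all add: even_gens_def scale_grassmann_simps mult.assoc)
  have Z: "prod_list (map (\<lambda>e. scale_grassmann (- 2) (gens [2 * fst e + 1, 2 * snd e + 1])) p)
    = (scale_grassmann ((- 2) ^ length p) (gens (odd_gens p)) :: 'a grassmann)" for p
    by (induction p) (simp_all add: odd_gens_def scale_grassmann_simps mult.assoc)
  have "prod_list (map edge c)
    = (\<Sum>(p, q)\<leftarrow>splits c. prod_list (map (\<lambda>e. scale_grassmann 2 (gens [2 * fst e, 2 * snd e])) p)
      * prod_list (map (\<lambda>e. scale_grassmann (- 2) (gens [2 * fst e + 1, 2 * snd e + 1])) q) :: 'a grassmann)"
    unfolding edge_def by (intro prod_list_add_expand even_central even)
  then show ?thesis
    by (simp only: Y Z scale_grassmann_simps(3) gens_append)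
qed

lemma coeff_sum_list: "coeff_grassmann (sum_list xs) A = (\<Sum>x\<leftarrow>xs. coeff_grassmann x A)"
  by (induction xs) (simp_all add: coeff_simps)

lemma coeff_prod_edge:
  "coeff_grassmann (prod_list (map edge c)) A = (\<Sum>(p, q)\<leftarrow>splits c.
    2 ^ length p * (- 2) ^ length q * coeff_grassmann (gens (even_gens p @ odd_gens q) :: 'a::field grassmann) A)"
  by (simp add: prod_edge coeff_sum_list comp_def case_prod_unfold coeff_simps)

lemma coeff_gens_verts:
  assumes "nested r" "nested s"
    and "coeff_grassmann (gens (even_gens p @ odd_gens q)) (support r s) \<noteq> 0"
  shows "verts (mset p) = verts (mset r) \<and> verts (mset q) = verts (mset s)"
proof -
  have "mset (even_gens p @ odd_gens q) = mset_set (support r s)"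
    using assms(3) by (rule coeff_gens_nonzero)
  also have "\<dots> = mset (even_gens r @ odd_gens s)"
    unfolding support_def using gens_even_odd_support[OF assms(1,2)] by (rule mset_set_set)
  finally have "image_mset (\<lambda>i. 2 * i) (verts (mset p)) + image_mset (\<lambda>i. 2 * i + 1) (verts (mset q))
    = image_mset (\<lambda>i. 2 * i) (verts (mset r)) + image_mset (\<lambda>i. 2 * i + 1) (verts (mset s))"
    by (simp only: mset_append mset_even_gens mset_odd_gens)
  then show ?thesis using image_mset_even_odd_cancel by blast
qed

text \<open>A nonzero coefficient requires that the edges of \<open>c\<close> split into a perfect matching of the vertices
  of \<open>r\<close> and one of the vertices of \<open>s\<close>. Rainbows have the smallest weight among these.\<close>

lemma coeff_prod_edge_weight:
  assumes rs: "nested r" "nested s" and c: "\<forall>e\<in>set c. fst e < snd e"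
    and nz: "coeff_grassmann (prod_list (map edge c) :: 'a::field grassmann) (support r s) \<noteq> 0"
  shows "pair_weight (mset (r @ s)) \<le> pair_weight (mset c)
    \<and> (pair_weight (mset (r @ s)) = pair_weight (mset c) \<longrightarrow> mset c = mset (r @ s))"
proof -
  have sum_list_nonzero: "\<exists>x\<in>set xs. f x \<noteq> 0" if "(\<Sum>x\<leftarrow>xs. f x) \<noteq> 0" for f :: "_ \<Rightarrow> 'a" and xs
    using that by (induction xs) auto
  obtain p q where pq: "(p, q) \<in> set (splits c)"
    and "coeff_grassmann (gens (even_gens p @ odd_gens q) :: 'a grassmann) (support r s) \<noteq> 0"
    using sum_list_nonzero[OF nz[unfolded coeff_prod_edge]] by auto
  then have v: "verts (mset p) = verts (mset r)" "verts (mset q) = verts (mset s)"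
    using coeff_gens_verts[OF rs] by blast+
  have m: "mset c = mset p + mset q" by (rule splits_mset[OF pq])
  have "\<forall>e\<in>#mset p. fst e < snd e" "\<forall>e\<in>#mset q. fst e < snd e"
    using c m by (metis set_mset_mset union_iff)+
  with nested_minimal[OF rs(1) _ v(1)] nested_minimal[OF rs(2) _ v(2)] m show ?thesis
    by auto
qed

lemma gens_pairs_mset:
  assumes "mset p = mset p'"
  shows "(gens (even_gens p) :: 'a::comm_ring_1 grassmann) = gens (even_gens p')"
    "(gens (odd_gens p) :: 'a grassmann) = gens (odd_gens p')"
proof -
  have perm: "prod_list (map f p) = prod_list (map f p')"
    if "\<And>e. f e \<in> grassmann_even" for f :: "nat \<times> nat \<Rightarrow> 'a grassmann"
    using assms
  proof (induction p arbitrary: p')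
    case (Cons e p)
    then have "e \<in> set p'" by (metis list.set_intros(1) set_mset_mset)
    then obtain p1 p2 where p': "p' = p1 @ e # p2" by (meson split_list)
    have "prod_list (map f p) = prod_list (map f (p1 @ p2))"
      using Cons.prems by (intro Cons.IH) (simp add: p')
    then show ?case
      using even_central[OF that[of e], of "prod_list (map f p1)"]
      by (simp add: p' mult.assoc[symmetric])
  qed simp
  have "gens (even_gens p) = (prod_list (map (\<lambda>e. gen (2 * fst e) * gen (2 * snd e)) p) :: 'a grassmann)" for p
    by (induction p) (simp_all add: even_gens_def mult.assoc)
  then show "(gens (even_gens p) :: 'a grassmann) = gens (even_gens p')"
    by (simp add: perm odd_times_odd gen_odd)
  have "gens (odd_gens p) = (prod_list (map (\<lambda>e. gen (2 * fst e + 1) * gen (2 * snd e + 1)) p) :: 'a grassmann)" for p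
    by (induction p) (simp_all add: odd_gens_def mult.assoc)
  then show "(gens (odd_gens p) :: 'a grassmann) = gens (odd_gens p')"
    by (simp only: perm odd_times_odd gen_odd)
qed

text \<open>The only splittings that contribute are those into the rainbows \<open>r\<close> and \<open>s\<close> themselves, as any other
  would have larger weight. They all contribute the same term, and their number is a power of two.\<close>

lemma coeff_prod_edge_self:
  assumes rs: "nested r" "nested s" and c: "mset c = mset (r @ s)" and two: "(2 :: 'a::field) \<noteq> 0"
  shows "coeff_grassmann (prod_list (map edge c) :: 'a grassmann) (support r s) \<noteq> 0"
proof -
  let ?t = "2 ^ length r * (- 2) ^ length s * coeff_grassmann (gens (even_gens r @ odd_gens s) :: 'a grassmann) (support r s)"
  let ?P = "\<lambda>(p, q). mset p = mset r \<and> mset q = mset s"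
  have less: "\<forall>e\<in>#mset c. fst e < snd e"
    using rs nested_less by (auto simp: c)
  have t: "2 ^ length p * (- 2) ^ length q * coeff_grassmann (gens (even_gens p @ odd_gens q) :: 'a grassmann) (support r s)
    = (if ?P (p, q) then ?t else 0)" if "(p, q) \<in> set (splits c)" for p q
  proof (cases "mset p = mset r \<and> mset q = mset s")
    case True
    moreover from True have "length p = length r" "length q = length s" by (metis size_mset)+
    ultimately show ?thesis
      using gens_pairs_mset[of p r, where 'a='a] gens_pairs_mset[of q s, where 'a='a] by (simp add: gens_append)
  next
    case False
    have m: "mset c = mset p + mset q" by (rule splits_mset[OF that])
    have "coeff_grassmann (gens (even_gens p @ odd_gens q) :: 'a grassmann) (support r s) = 0"
    proof (rule ccontr)
      assume "coeff_grassmann (gens (even_gens p @ odd_gens q) :: 'a grassmann) (support r s) \<noteq> 0"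
      then have v: "verts (mset p) = verts (mset r)" "verts (mset q) = verts (mset s)"
        using coeff_gens_verts[OF rs] by blast+
      have "\<forall>e\<in>#mset p. fst e < snd e" "\<forall>e\<in>#mset q. fst e < snd e" using less m by auto
      with nested_minimal[OF rs(1) _ v(1)] nested_minimal[OF rs(2) _ v(2)]
      have *: "pair_weight (mset r) \<le> pair_weight (mset p)" "pair_weight (mset s) \<le> pair_weight (mset q)"
        "pair_weight (mset r) = pair_weight (mset p) \<Longrightarrow> mset p = mset r"
        "pair_weight (mset s) = pair_weight (mset q) \<Longrightarrow> mset q = mset s"
        by auto
      moreover have "pair_weight (mset r) + pair_weight (mset s) = pair_weight (mset p) + pair_weight (mset q)"
        using c m by (metis mset_append pair_weight_simps(3))
      ultimately show False using False by linarith
    qed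
    with False show ?thesis by auto
  qed
  have const: "(\<Sum>x\<leftarrow>xs. if ?P x then ?t else 0) = of_nat (length (filter ?P xs)) * ?t" for xs
    by (induction xs) (auto simp: algebra_simps)
  have "coeff_grassmann (prod_list (map edge c) :: 'a grassmann) (support r s) = (\<Sum>x\<leftarrow>splits c. if ?P x then ?t else 0)"
    unfolding coeff_prod_edge
    by (intro arg_cong[of _ _ sum_list] map_cong refl) (use t in \<open>simp only: split_paired_all prod.case\<close>)
  also have "\<dots> = of_nat (length (filter ?P (splits c))) * ?t" by (rule const)
  also have "length (filter ?P (splits c)) = 2 ^ card (set r \<inter> set s)"
    using count_splits[of "set r" "set s" c] c rs by (simp add: mset_set_set nested_distinct)
  also have "of_nat (2 ^ card (set r \<inter> set s)) * ?t \<noteq> 0"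
    using two coeff_gens_set[OF gens_even_odd_support[OF rs], where 'a='a] by (simp add: support_def)
  finally show ?thesis .
qed

section \<open>The weak identities lie in the ideal\<close>

definition offdiag :: "'b \<Rightarrow> 'b \<Rightarrow> 'b::zero^2^2"
  where "offdiag b c = (\<chi> i j. if i = j then 0 else if i = 1 then b else c)"

lemma offdiag_nth [simp]:
  "offdiag b c $ 1 $ 1 = 0" "offdiag b c $ 1 $ 2 = b" "offdiag b c $ 2 $ 1 = c" "offdiag b c $ 2 $ 2 = 0"
  by (simp_all add: offdiag_def)

lemma scale_mat_nth [simp]: "scale_mat c A $ i $ j = scale_grassmann c (A $ i $ j)"
  by (simp add: scale_mat_def)

text \<open>The scalar parts are distinct powers of one parameter \<open>x\<close>, so that the words in a polynomial can be
  told apart by the degrees in \<open>x\<close> of their values.\<close>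

definition generic :: "(nat \<Rightarrow> nat) \<Rightarrow> 'a::field \<Rightarrow> nat \<Rightarrow> 'a grassmann^2^2"
  where "generic s x i = scale_mat (x ^ s i) (mat 1)
    + offdiag (gen (2 * i) + gen (2 * i + 1)) (gen (2 * i) - gen (2 * i + 1))"

lemma admissible_generic: "admissible (generic s x)"
  by (simp add: admissible_def M11_str0_def M11_def str_def generic_def scale_grassmann_simps
      grassmann_even_closed grassmann_odd_closed gen_odd)

lemma pairing_generic: "pairing (generic s x) e = edge e"
proof -
  have two: "scale_grassmann 2 f = f + f" "scale_grassmann (- 2) f = - f - f" for f :: "'a grassmann"
    by (rule grassmann_eqI, simp add: coeff_simps)+
  show ?thesis
    by (simp add: pairing_def edge_def generic_def two scale_grassmann_simps algebra_simps)
qed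

text \<open>Polynomial functions of degree less than \<open>d\<close> with matrix coefficients, built from monomials.\<close>

inductive lower_terms :: "nat \<Rightarrow> ('a::field \<Rightarrow> 'a grassmann^2^2) \<Rightarrow> bool" for d where
  zero: "lower_terms d (\<lambda>_. 0)"
| add: "lower_terms d r \<Longrightarrow> j < d \<Longrightarrow> lower_terms d (\<lambda>x. r x + scale_mat (x ^ j) A)"

lemma lower_terms_mono: "lower_terms d r \<Longrightarrow> d \<le> d' \<Longrightarrow> lower_terms d' r"
  by (induction rule: lower_terms.induct) (auto intro: lower_terms.intros)

lemma lower_terms_add:
  assumes "lower_terms d r'" "lower_terms d r" shows "lower_terms d (\<lambda>x. r x + r' x)"
  using assms
proof (induction rule: lower_terms.induct)
  case (add r' j A)
  then have "lower_terms d (\<lambda>x. (r x + r' x) + scale_mat (x ^ j) A)"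
    by (intro lower_terms.add) auto
  then show ?case by (simp add: add.assoc)
qed simp

lemma scale_mat_scale: "scale_mat c (scale_mat d A) = scale_mat (c * d) A"
  by (simp add: vec_eq_iff scale_grassmann_scale)

lemma scale_mat_0 [simp]: "scale_mat c 0 = 0"
  by (simp add: vec_eq_iff scale_grassmann_simps)

lemma lower_terms_power:
  assumes "lower_terms d r" shows "lower_terms (k + d) (\<lambda>x. scale_mat (x ^ k) (r x))"
  using assms
proof (induction rule: lower_terms.induct)
  case (add r j A)
  then have "lower_terms (k + d) (\<lambda>x. scale_mat (x ^ k) (r x) + scale_mat (x ^ (k + j)) A)"
    by (intro lower_terms.add) auto
  then show ?case by (simp add: scale_mat_simps scale_mat_scale power_add)
qed (simp add: lower_terms.zero)

lemma mult_scale_mat: "N ** scale_mat c A = scale_mat c (N ** A)" "scale_mat c A ** N = scale_mat c (A ** N)"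
  using scale_mat_simps(3)[of 1 N c A] scale_mat_simps(3)[of c A 1 N] by (simp_all add: scale_mat_simps)

lemma matrix_add_distrib:
  fixes A B C :: "'b::ring_1^2^2"
  shows "(A + B) ** C = A ** C + B ** C" "C ** (A + B) = C ** A + C ** B"
  by (simp_all add: matrix_matrix_mult_def vec_eq_iff sum_2 distrib_left distrib_right)

lemma lower_terms_mult:
  assumes "lower_terms d r" shows "lower_terms d (\<lambda>x. N ** r x)"
  using assms
proof (induction rule: lower_terms.induct)
  case zero
  have "N ** 0 = 0" by (simp add: matrix_matrix_mult_def vec_eq_iff)
  then show ?case by (simp add: lower_terms.zero)
next
  case (add r j A)
  then have "lower_terms d (\<lambda>x. N ** r x + scale_mat (x ^ j) (N ** A))"
    by (intro lower_terms.add)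
  then show ?case by (simp add: matrix_add_distrib mult_scale_mat)
qed

lemma eval_word_generic:
  assumes "\<And>i. 0 < s i"
  shows "\<exists>r. lower_terms (sum_list (map s l)) r
    \<and> (\<forall>x::'a::field. eval_poly (generic s x) (prod_list (map var l)) = scale_mat (x ^ sum_list (map s l)) (mat 1) + r x)"
proof (induction l)
  case Nil
  show ?case
    by (intro exI[of _ "\<lambda>_. 0"]) (simp add: lower_terms.zero eval_1 scale_mat_simps)
next
  case (Cons i l)
  let ?d = "sum_list (map s l)"
  obtain r :: "'a \<Rightarrow> 'a grassmann^2^2" where r: "lower_terms ?d r"
    "\<And>x. eval_poly (generic s x) (prod_list (map var l)) = scale_mat (x ^ ?d) (mat 1) + r x"
    using Cons by blast
  define N :: "'a grassmann^2^2" where "N = offdiag (gen (2 * i) + gen (2 * i + 1)) (gen (2 * i) - gen (2 * i + 1))"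
  define r' where "r' x = (scale_mat (x ^ s i) (r x) + N ** r x) + scale_mat (x ^ ?d) N" for x
  have "lower_terms (s i + ?d) (\<lambda>x. N ** r x)"
    using lower_terms_mult[OF r(1)] by (rule lower_terms_mono) simp
  then have "lower_terms (s i + ?d) r'"
    unfolding r'_def using assms[of i]
    by (intro lower_terms.add lower_terms_add lower_terms_power r) auto
  moreover have "eval_poly (generic s x) (prod_list (map var (i # l)))
    = scale_mat (x ^ (s i + ?d)) (mat 1) + r' x" for x
  proof -
    have "generic s x i = scale_mat (x ^ s i) (mat 1) + N" by (simp add: generic_def N_def)
    then have "eval_poly (generic s x) (prod_list (map var (i # l)))
      = (scale_mat (x ^ s i) (mat 1) + N) ** (scale_mat (x ^ ?d) (mat 1) + r x)"
      by (simp add: eval_mult eval_var r(2))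
    also have "\<dots> = scale_mat (x ^ (s i + ?d)) (mat 1) + r' x"
      by (simp add: r'_def matrix_add_distrib mult_scale_mat scale_mat_simps(2) scale_mat_scale
          power_add mult.commute add_ac)
    finally show ?thesis .
  qed
  ultimately show ?case by auto
qed

lemma lower_terms_poly:
  fixes M :: "'a::field grassmann^2^2"
  assumes "lower_terms d r"
  shows "\<exists>q. (\<forall>i\<ge>d. poly.coeff q i = 0) \<and> (\<forall>x. coeff_grassmann ((r x ** M) $ 1 $ 1) A = poly q x)"
  using assms
proof (induction rule: lower_terms.induct)
  case zero
  have "0 ** M = 0" by (simp add: matrix_matrix_mult_def vec_eq_iff)
  then show ?case by (intro exI[of _ 0]) (simp add: coeff_simps)
next
  case (add r j A')
  then obtain q where q: "\<forall>i\<ge>d. poly.coeff q i = 0" "\<forall>x. coeff_grassmann ((r x ** M) $ 1 $ 1) A = poly q x"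
    by blast
  let ?q = "q + monom (coeff_grassmann ((A' ** M) $ 1 $ 1) A) j"
  have "\<forall>x. coeff_grassmann (((r x + scale_mat (x ^ j) A') ** M) $ 1 $ 1) A = poly ?q x"
    using q(2) by (simp add: matrix_add_distrib mult_scale_mat coeff_simps poly_monom)
  moreover have "\<forall>i\<ge>d. poly.coeff ?q i = 0" using q(1) add(2) by simp
  ultimately show ?case by blast
qed

lemma digits_unique:
  fixes a b :: "nat \<Rightarrow> nat"
  assumes "\<And>i. i < n \<Longrightarrow> a i < N" "\<And>i. i < n \<Longrightarrow> b i < N"
    and "(\<Sum>i<n. a i * N ^ i) = (\<Sum>i<n. b i * N ^ i)" and "i < n"
  shows "a i = b i"
  using assms
proof (induction n arbitrary: a b i)
  case (Suc n)
  have split: "(\<Sum>i<Suc n. a i * N ^ i) = a 0 + N * (\<Sum>i<n. a (Suc i) * N ^ i)" for a :: "nat \<Rightarrow> nat"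
    by (simp only: sum.lessThan_Suc_shift) (simp add: sum_distrib_left mult_ac)
  have N: "a 0 < N" "b 0 < N" using Suc.prems by auto
  have eq: "a 0 + N * (\<Sum>i<n. a (Suc i) * N ^ i) = b 0 + N * (\<Sum>i<n. b (Suc i) * N ^ i)"
    using Suc.prems(3) unfolding split .
  have "(a 0 + N * (\<Sum>i<n. a (Suc i) * N ^ i)) mod N = a 0" "(b 0 + N * (\<Sum>i<n. b (Suc i) * N ^ i)) mod N = b 0"
    using N by simp_all
  with eq have 0: "a 0 = b 0" by metis
  with eq N have "(\<Sum>i<n. a (Suc i) * N ^ i) = (\<Sum>i<n. b (Suc i) * N ^ i)" by simp
  then have "a (Suc i) = b (Suc i)" if "i < n" for i
    using that Suc.prems by (intro Suc.IH[of "\<lambda>i. a (Suc i)" "\<lambda>i. b (Suc i)"]) auto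
  with 0 Suc.prems(4) show ?case by (cases i) auto
qed simp

text \<open>The weight of a word has the multiplicities of its letters as digits in base \<open>N\<close>.\<close>

lemma sorted_weight_unique:
  assumes "sorted l" "sorted l'" "length l < N" "length l' < N"
    and "sum_list (map (\<lambda>i. N ^ i) l) = sum_list (map (\<lambda>i. N ^ i) l')"
  shows "l = l'"
proof -
  obtain n where n: "set l \<union> set l' \<subseteq> {..<n}"
    using finite_nat_set_iff_bounded[of "set l \<union> set l'"] by auto
  have w: "sum_list (map (\<lambda>i. N ^ i) l) = (\<Sum>i<n. count_list l i * N ^ i)" if "set l \<subseteq> {..<n}" for l
    unfolding sum_list_map_eq_sum_count using that
    by (intro sum.mono_neutral_left) (auto simp: count_list_0_iff)
  have "count_list l i = count_list l' i" for i
  proof (cases "i < n")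
    case True
    show ?thesis
    proof (rule digits_unique[of n "count_list l" N "count_list l'"])
      show "(\<Sum>i<n. count_list l i * N ^ i) = (\<Sum>i<n. count_list l' i * N ^ i)"
        using assms(5) n by (simp add: w)
      show "count_list l j < N" "count_list l' j < N" for j
        using assms(3,4) count_le_length[of l j] count_le_length[of l' j] by linarith+
    qed (rule True)
  next
    case False
    with n have "i \<notin> set l" "i \<notin> set l'" by auto
    then show ?thesis by (simp add: count_list_0_iff)
  qed
  then have "mset l = mset l'" by (simp add: multiset_eq_iff count_mset)
  then have "sort l = l'" using assms(2) by (intro properties_for_sort) simp_all
  with assms(1) show ?thesis by (simp add: sorted_sort_id)
qed

text \<open>Modulo the ideal, the product of the commutators in a multiset does not depend on their order.\<close>

definition list_of :: "'b multiset \<Rightarrow> 'b list"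
  where "list_of M = (SOME c. mset c = M)"

lemma mset_list_of [simp]: "mset (list_of M) = M"
  unfolding list_of_def by (rule someI_ex) (rule ex_mset)

definition normal_basis :: "nat list \<times> (nat \<times> nat) multiset \<Rightarrow> 'a::field free_alg"
  where "normal_basis x = prod_list (map var (fst x)) * comm_prod (list_of (snd x))"

definition normal_index :: "(nat list \<times> (nat \<times> nat) multiset) set"
  where "normal_index = {(l, M). sorted l \<and> normal_pairs M}"

lemma (in cubic_ideal) normal_form:
  assumes two: "(2 :: 'a) \<noteq> 0"
  obtains j G k where "j \<in> J" "finite G" "G \<subseteq> normal_index"
    "f = j + (\<Sum>x\<in>G. scale_free (k x) (normal_basis x))"
proof -
  have "f \<in> span_mod (normal_basis ` normal_index)"
    using span_sorted[OF two]
  proof (rule span_mod_mono)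
    fix a :: "'a free_alg" assume "a \<in> {prod_list (map var l) * comm_prod c | l c. sorted l \<and> normal_pairs (mset c)}"
    then obtain l c where a: "a = prod_list (map var l) * comm_prod c" "sorted l" "normal_pairs (mset c)"
      by blast
    have "comm_prod c - comm_prod (list_of (mset c)) \<in> J" by (rule comm_prod_cong_mset) simp
    then have "a - normal_basis (l, mset c) \<in> J"
      unfolding a normal_basis_def by (simp add: mult_in flip: right_diff_distrib)
    moreover have "normal_basis (l, mset c) \<in> span_mod (normal_basis ` normal_index)"
      using a by (intro span_mod_base) (auto simp: normal_index_def)
    ultimately show "a \<in> span_mod (normal_basis ` normal_index)" by (rule span_mod_cong)
  qed
  then have "\<exists>j G k. j \<in> J \<and> finite G \<and> G \<subseteq> normal_index \<and> f = j + (\<Sum>x\<in>G. scale_free (k x) (normal_basis x))"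
    unfolding span_mod_def
  proof (induction rule: free.span_induct_alt)
    case base
    show ?case by (intro exI[of _ 0] exI[of _ "{}"]) (simp add: zero_in)
  next
    case (step c a y)
    then obtain j G k where y: "j \<in> J" "finite G" "G \<subseteq> normal_index"
      "y = j + (\<Sum>x\<in>G. scale_free (k x) (normal_basis x))" by blast
    from step(1) show ?case
    proof
      assume "a \<in> J"
      with y show ?thesis
        by (intro exI[of _ "scale_free c a + j"] exI[of _ G] exI[of _ k]) (auto simp: add_in scale_in)
    next
      assume "a \<in> normal_basis ` normal_index"
      then obtain z where z: "z \<in> normal_index" "a = normal_basis z" by blast
      define k' where "k' x = (if x \<in> G then k x else 0) + (if x = z then c else 0)" for x
      have "(\<Sum>x\<in>insert z G. scale_free (k' x) (normal_basis x))
        = (\<Sum>x\<in>insert z G. if x \<in> G then scale_free (k x) (normal_basis x) else 0)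
          + (\<Sum>x\<in>insert z G. if x = z then scale_free c (normal_basis x) else 0)"
        unfolding sum.distrib[symmetric]
        by (rule sum.cong) (auto simp: k'_def free.scale_left_distrib)
      also have "(\<Sum>x\<in>insert z G. if x \<in> G then scale_free (k x) (normal_basis x) else 0)
        = (\<Sum>x\<in>G. scale_free (k x) (normal_basis x))"
        using y(2) by (intro sum.mono_neutral_cong_right) auto
      also have "(\<Sum>x\<in>insert z G. if x = z then scale_free c (normal_basis x) else 0) = scale_free c a"
        using y(2) z(2) by simp
      finally show ?thesis
        using y z by (intro exI[of _ j] exI[of _ "insert z G"] exI[of _ k']) auto
    qed
  qed
  with that show thesis by blast
qed

text \<open>The value of \<open>x\<^sub>l\<close> times a product of commutators is a polynomial in the parameter of the generic
  matrices. Its leading term has the weight of \<open>l\<close> as exponent and the product of the edges as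
  coefficient. Over an infinite field the coefficient of the highest power that occurs must vanish.
  As only one word has the highest weight, this is a linear relation between products of edges.
  The coefficient of such a relation at a normal form of largest weight is zero by triangularity.\<close>

lemma normal_basis_independent:
  assumes inf: "infinite (UNIV :: 'a::field set)" and two: "(2 :: 'a) \<noteq> 0"
    and G: "finite G" "G \<subseteq> normal_index"
    and f: "(\<Sum>x\<in>G. scale_free (k x) (normal_basis x)) \<in> (I_w :: 'a free_alg set)"
  shows "\<forall>x\<in>G. k x = 0"
proof (rule ccontr)
  assume nz: "\<not> (\<forall>x\<in>G. k x = 0)"
  define H where "H = {x \<in> G. k x \<noteq> 0}"
  have H: "finite H" "H \<noteq> {}" "H \<subseteq> normal_index" using G nz by (auto simp: H_def)
  define N where "N = Suc (Max ((\<lambda>x. length (fst x)) ` H))"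
  define s where "s = (\<lambda>i::nat. N ^ i)"
  define wt where "wt l = sum_list (map s l)" for l
  have lenN: "length (fst x) < N" if "x \<in> H" for x
    using that H(1) by (auto simp: N_def less_Suc_eq_le intro: Max_ge)
  have s: "0 < s i" for i by (simp add: s_def N_def)
  define d where "d = Max ((\<lambda>x. wt (fst x)) ` H)"
  have dmax: "wt (fst x) \<le> d" if "x \<in> H" for x using that H(1) by (auto simp: d_def)
  define K where "K = {x \<in> H. wt (fst x) = d}"
  have "d \<in> (\<lambda>x. wt (fst x)) ` H" unfolding d_def using H by (intro Max_in) auto
  then have K: "K \<noteq> {}" "finite K" using H(1) by (auto simp: K_def)
  \<comment> \<open>The elements of \<open>K\<close> have the same word, by the choice of the weights.\<close>
  have same: "fst x = fst y" if "x \<in> K" "y \<in> K" for x y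
  proof (rule sorted_weight_unique[of _ _ N])
    show "sum_list (map (\<lambda>i. N ^ i) (fst x)) = sum_list (map (\<lambda>i. N ^ i) (fst y))"
      using that by (simp add: K_def wt_def s_def)
  qed (use that H lenN in \<open>auto simp: K_def normal_index_def\<close>)
  define m where "m = Max ((\<lambda>x. pair_weight (snd x)) ` K)"
  have "m \<in> (\<lambda>x. pair_weight (snd x)) ` K" unfolding m_def using K by (intro Max_in) auto
  then obtain z where z: "z \<in> K" "pair_weight (snd z) = m" by auto
  have mmax: "pair_weight (snd x) \<le> pair_weight (snd z)" if "x \<in> K" for x
    using that K(2) z(2) by (auto simp: m_def)
  have normal: "normal_pairs (snd x)" if "x \<in> H" for x
    using that H by (auto simp: normal_index_def)
  have "z \<in> H" using z by (simp add: K_def)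
  obtain r r' where rr: "nested r" "nested r'" "snd z = mset r + mset r'"
    using normal_pairs_nested[OF normal[OF \<open>z \<in> H\<close>]] by blast
  define A where "A = support r r'"
  define P :: "_ \<Rightarrow> 'a grassmann" where "P x = prod_list (map edge (list_of (snd x)))" for x :: "nat list \<times> (nat \<times> nat) multiset"
  define \<kappa> where "\<kappa> x = coeff_grassmann (P x :: 'a grassmann) A" for x
  have \<kappa>z: "\<kappa> z \<noteq> 0"
    unfolding \<kappa>_def A_def P_def using rr two by (intro coeff_prod_edge_self) simp_all
  have \<kappa>0: "\<kappa> x = 0" if "x \<in> K" "x \<noteq> z" for x
  proof (rule ccontr)
    assume "\<kappa> x \<noteq> 0"
    moreover have "\<forall>e\<in>set (list_of (snd x)). fst e < snd e"
    proof -
      have "set (list_of (snd x)) = set_mset (snd x)" by (metis mset_list_of set_mset_mset)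
      moreover have "normal_pairs (snd x)" using normal that by (simp add: K_def)
      ultimately show ?thesis by (simp add: normal_pairs_def)
    qed
    ultimately have "snd x = snd z"
      using coeff_prod_edge_weight[OF rr(1,2), of "list_of (snd x)"] mmax[OF that(1)] rr(3)
      by (auto simp: \<kappa>_def A_def P_def)
    with same[OF that(1) z(1)] that(2) show False by (simp add: prod_eq_iff)
  qed
  \<comment> \<open>For each \<open>x\<close>, the coefficient of the evaluation is a polynomial in the shift.\<close>
  have "\<exists>q. poly.coeff q (wt (fst x)) = \<kappa> x \<and> (\<forall>i>wt (fst x). poly.coeff q i = 0)
    \<and> (\<forall>t. coeff_grassmann (eval_poly (generic s t) (normal_basis x) $ 1 $ 1) A = poly q t)" for x
  proof -
    obtain r :: "'a \<Rightarrow> 'a grassmann^2^2" where r: "lower_terms (wt (fst x)) r"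
      "\<And>t. eval_poly (generic s t) (prod_list (map var (fst x))) = scale_mat (t ^ wt (fst x)) (mat 1) + r t"
      using eval_word_generic[of s "fst x", OF s] unfolding wt_def by blast
    obtain q where q: "\<forall>i\<ge>wt (fst x). poly.coeff q i = 0"
      "\<forall>t. coeff_grassmann ((r t ** mat (P x)) $ 1 $ 1) A = poly q t"
      using lower_terms_poly[OF r(1)] by blast
    let ?q = "q + monom (\<kappa> x) (wt (fst x))"
    have "coeff_grassmann (eval_poly (generic s t) (normal_basis x) $ 1 $ 1) A = poly ?q t" for t
    proof -
      have "pairing (generic s t) = edge"
        by (rule ext) (rule pairing_generic)
      then have "eval_poly (generic s t) (normal_basis x)
        = scale_mat (t ^ wt (fst x)) (mat (P x)) + r t ** mat (P x)"
        by (simp add: normal_basis_def eval_mult r(2) eval_comm_prod[OF admissible_generic] P_def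
            matrix_add_distrib mult_scale_mat)
      then show ?thesis using q(2) by (simp add: coeff_simps \<kappa>_def poly_monom)
    qed
    then show ?thesis using q(1) by (intro exI[of _ ?q]) auto
  qed
  then obtain q where q: "\<And>x. poly.coeff (q x) (wt (fst x)) = \<kappa> x" "\<And>x i. i > wt (fst x) \<Longrightarrow> poly.coeff (q x) i = 0"
    "\<And>x t. coeff_grassmann (eval_poly (generic s t) (normal_basis x) $ 1 $ 1) A = poly (q x) t"
    by metis
  define Q where "Q = (\<Sum>x\<in>H. smult (k x) (q x))"
  have "poly Q t = 0" for t
  proof -
    have "(\<Sum>x\<in>G. scale_free (k x) (normal_basis x)) = (\<Sum>x\<in>H. scale_free (k x) (normal_basis x) :: 'a free_alg)"
      using G(1) by (intro sum.mono_neutral_right) (auto simp: H_def)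
    with f have "(\<Sum>x\<in>H. scale_free (k x) (normal_basis x)) \<in> (I_w :: 'a free_alg set)"
      by (simp only:)
    then have "eval_poly (generic s t) (\<Sum>x\<in>H. scale_free (k x) (normal_basis x)) = 0"
      using admissible_generic[of s t] unfolding I_w_iff by blast
    then have "(\<Sum>x\<in>H. scale_mat (k x) (eval_poly (generic s t) (normal_basis x))) $ 1 $ 1 = 0"
      by (simp add: eval_sum eval_scale)
    then have "coeff_grassmann (\<Sum>x\<in>H. scale_grassmann (k x) (eval_poly (generic s t) (normal_basis x) $ 1 $ 1)) A = 0"
      by (simp add: coeff_simps)
    then show ?thesis
      by (simp add: coeff_grassmann_sum coeff_simps q(3) Q_def poly_sum)
  qed
  then have "Q = 0" using poly_roots_finite[of Q] inf by auto
  then have "0 = poly.coeff Q d" by simp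
  also have "\<dots> = (\<Sum>x\<in>H. k x * poly.coeff (q x) d)" by (simp add: Q_def coeff_sum)
  also have "\<dots> = (\<Sum>x\<in>K. k x * \<kappa> x)"
  proof (rule sum.mono_neutral_cong_right)
    show "\<forall>x\<in>H - K. k x * poly.coeff (q x) d = 0"
      using q(2) dmax by (force simp: K_def le_less)
    show "k x * poly.coeff (q x) d = k x * \<kappa> x" if "x \<in> K" for x
      using q(1)[of x] that by (simp add: K_def)
  qed (use H in \<open>auto simp: K_def\<close>)
  also have "\<dots> = k z * \<kappa> z"
    using K(2) z(1) \<kappa>0 by (subst sum.remove[of _ z]) auto
  finally show False
    using \<kappa>z \<open>z \<in> H\<close> by (auto simp: H_def)
qed

theorem I_w_eq_Omega_generated:
  assumes inf: "infinite (UNIV :: 'a::field set)" and two: "(2 :: 'a) \<noteq> 0"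
  shows "(I_w :: 'a free_alg set) = Omega_generated {commutator (commutator (var 0) (var 1)) (var 2),
    commutator (var 1) (var 0) * commutator (var 2) (var 0) * commutator (var 3) (var 0)}"
    (is "_ = ?J")
proof
  show "?J \<subseteq> I_w" by (rule Omega_generated_subset_I_w[OF two])
  interpret cubic_ideal ?J by (rule cubic_ideal_Omega_generated)
  show "I_w \<subseteq> ?J"
  proof
    fix f :: "'a free_alg" assume f: "f \<in> I_w"
    obtain j G k where jG: "j \<in> ?J" "finite G" "G \<subseteq> normal_index"
      "f = j + (\<Sum>x\<in>G. scale_free (k x) (normal_basis x))"
      using normal_form[OF two] by blast
    have "j \<in> I_w" using jG(1) \<open>?J \<subseteq> I_w\<close> by blast
    with f have "f - j \<in> I_w" by (simp add: I_w_iff eval_diff)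
    then have "\<forall>x\<in>G. k x = 0"
      using normal_basis_independent[OF inf two jG(2,3)] jG(4) by simp
    then have "f = j" using jG(4) by simp
    with jG(1) show "f \<in> ?J" by simp
  qed
qed

section \<open>Multihomogeneous components\<close>

definition deg :: "nat list \<Rightarrow> nat \<Rightarrow>\<^sub>0 nat"
  where "deg l = sum_list (map (\<lambda>i. Poly_Mapping.single i 1) l)"

lemma deg_simps [simp]: "deg [] = 0" "deg (i # l) = Poly_Mapping.single i 1 + deg l"
  "deg (l @ l') = deg l + deg l'"
  by (simp_all add: deg_def)

lemma lookup_deg: "Poly_Mapping.lookup (deg l) i = count_list l i"
  by (induction l) (auto simp: lookup_add lookup_single when_def)

lemma keys_deg: "Poly_Mapping.keys (deg l) = set l"
  by (auto simp: in_keys_iff lookup_deg count_list_0_iff)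

lemma multihomogeneous_iff: "multihomogeneous n f \<longleftrightarrow> (\<forall>m\<in>Poly_Mapping.keys f. deg (letters m) = n)"
  by (auto simp: multihomogeneous_def poly_mapping_eq_iff lookup_deg fun_eq_iff)

lemma multihomogeneous_add: "multihomogeneous n f \<Longrightarrow> multihomogeneous n g \<Longrightarrow> multihomogeneous n (f + g)"
  using keys_add[of f g] by (auto simp: multihomogeneous_iff)

lemma multihomogeneous_mult:
  assumes "multihomogeneous m f" "multihomogeneous n g" shows "multihomogeneous (m + n) (f * g)"
  unfolding multihomogeneous_iff
proof
  fix x assume "x \<in> Poly_Mapping.keys (f * g)"
  then obtain u v where "u \<in> Poly_Mapping.keys f" "v \<in> Poly_Mapping.keys g" "x = u + v"
    using keys_mult[of f g] by blast
  then show "deg (letters x) = m + n"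
    using assms by (simp add: multihomogeneous_iff plus_word_def)
qed

lemma multihomogeneous_const: "multihomogeneous 0 (Poly_Mapping.single 0 c)"
  by (cases "c = 0") (simp_all add: multihomogeneous_iff)

lemma multihomogeneous_scale: "multihomogeneous n f \<Longrightarrow> multihomogeneous n (scale_free c f)"
  using multihomogeneous_mult[OF multihomogeneous_const] by (fastforce simp: scale_free_def)

lemma multihomogeneous_minus: "multihomogeneous n f \<Longrightarrow> multihomogeneous n g \<Longrightarrow> multihomogeneous n (f - g)"
  using keys_diff[of f g] by (auto simp: multihomogeneous_iff)

lemma multihomogeneous_var: "multihomogeneous (deg [i]) (var i)"
  by (simp add: multihomogeneous_iff var_def)

lemma multihomogeneous_commutator:
  "multihomogeneous m f \<Longrightarrow> multihomogeneous n g \<Longrightarrow> multihomogeneous (m + n) (commutator f g)"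
  unfolding commutator_def
  using multihomogeneous_mult[of m f n g] multihomogeneous_mult[of n g m f]
  by (auto simp: add.commute intro: multihomogeneous_minus)

lemma multihomogeneous_long_commutator: "multihomogeneous (deg (i # js)) (long_commutator i js)"
proof -
  have "multihomogeneous (n + deg js) (foldl commutator f (map var js))" if "multihomogeneous n f"
    for n and f :: "'a free_alg"
    using that
  proof (induction js arbitrary: n f)
    case (Cons j js)
    then show ?case
      using Cons.IH[OF multihomogeneous_commutator[OF Cons.prems multihomogeneous_var[of j]]]
      by (simp add: add.assoc)
  qed simp
  from this[OF multihomogeneous_var[of i]] show ?thesis
    by (simp add: long_commutator_def)
qed

definition homogeneous_part :: "(nat \<Rightarrow>\<^sub>0 nat) \<Rightarrow> 'a::field free_alg \<Rightarrow> 'a free_alg"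
  where "homogeneous_part n f
    = (\<Sum>m\<in>Poly_Mapping.keys f. if deg (letters m) = n then Poly_Mapping.single m (Poly_Mapping.lookup f m) else 0)"

lemma lookup_homogeneous_part:
  "Poly_Mapping.lookup (homogeneous_part n f) m = (if deg (letters m) = n then Poly_Mapping.lookup f m else 0)"
proof -
  have "Poly_Mapping.lookup (homogeneous_part n f) m
    = (\<Sum>x\<in>Poly_Mapping.keys f. if x = m then (if deg (letters m) = n then Poly_Mapping.lookup f m else 0) else 0)"
    unfolding homogeneous_part_def lookup_sum
    by (rule sum.cong) (auto simp: lookup_single when_def)
  then show ?thesis by (auto simp: in_keys_iff)
qed

lemma lookup_scale_free: "Poly_Mapping.lookup (scale_free c f) m = c * Poly_Mapping.lookup f m"
proof -
  have "scale_free c f = (\<Sum>x\<in>Poly_Mapping.keys f. Poly_Mapping.single x (c * Poly_Mapping.lookup f x))"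
    by (subst free_alg_sum_single) (simp add: scale_free_def sum_distrib_left mult_single)
  then show ?thesis
    by (auto simp: lookup_sum lookup_single when_def in_keys_iff)
qed

lemma homogeneous_part_linear:
  "homogeneous_part n (f + g) = homogeneous_part n f + homogeneous_part n g"
  "homogeneous_part n (scale_free c f) = scale_free c (homogeneous_part n f)"
  by (rule poly_mapping_eqI, simp add: lookup_homogeneous_part lookup_add lookup_scale_free)+

lemma homogeneous_part_multihomogeneous:
  assumes "multihomogeneous m f"
  shows "homogeneous_part n f = (if m = n then f else 0)"
  by (rule poly_mapping_eqI)
    (use assms in \<open>auto simp: lookup_homogeneous_part multihomogeneous_iff in_keys_iff\<close>)

definition commutator_products :: "'a::field free_alg set"
  where "commutator_products = {prod_list (map (\<lambda>(i, js). long_commutator i js) xs) | xs. \<forall>(i, js)\<in>set xs. js \<noteq> []}"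

lemma free_span_mult_closed:
  assumes A: "\<And>a b. a \<in> A \<Longrightarrow> b \<in> A \<Longrightarrow> a * b \<in> A" and "f \<in> free_span A" "g \<in> free_span A"
  shows "f * g \<in> free_span A"
  using assms(2)
proof (induction rule: free.span_induct_alt)
  case (step c a y)
  have "a * g \<in> free_span A"
    using assms(3)
  proof (induction rule: free.span_induct_alt)
    case (step c b z)
    then show ?case using A[OF \<open>a \<in> A\<close>]
      by (simp add: distrib_left scale_free_mult free.span_add free.span_scale free.span_base)
  qed (simp add: free.span_zero)
  with step show ?case
    by (simp add: distrib_right scale_free_mult free.span_add free.span_scale)
qed (simp add: free.span_zero)

lemma proper_polys_span: "proper_polys \<subseteq> free_span commutator_products"
  unfolding proper_polys_def
proof (rule hull_minimal)
  show "{long_commutator i js | i js. js \<noteq> []} \<subseteq> (free_span commutator_products :: 'a free_alg set)"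
  proof
    fix f :: "'a free_alg" assume "f \<in> {long_commutator i js | i js. js \<noteq> []}"
    then obtain i js where "f = long_commutator i js" "js \<noteq> []" by blast
    then show "f \<in> free_span commutator_products"
      by (intro free.span_base) (auto simp: commutator_products_def intro!: exI[of _ "[(i, js)]"])
  qed
  have "a * b \<in> commutator_products" if ab: "a \<in> commutator_products" "b \<in> commutator_products"
    for a b :: "'a free_alg"
  proof -
    obtain xs ys where "a = prod_list (map (\<lambda>(i, js). long_commutator i js) xs)" "\<forall>(i, js)\<in>set xs. js \<noteq> []"
      "b = prod_list (map (\<lambda>(i, js). long_commutator i js) ys)" "\<forall>(i, js)\<in>set ys. js \<noteq> []"
      using ab unfolding commutator_products_def by blast
    then show ?thesis
      unfolding commutator_products_def by (intro CollectI exI[of _ "xs @ ys"]) auto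
  qed
  moreover have "1 \<in> (commutator_products :: 'a free_alg set)"
    unfolding commutator_products_def by (intro CollectI exI[of _ "[]"]) auto
  ultimately show "subalgebra (free_span commutator_products :: 'a free_alg set)"
    by (auto simp: subalgebra_def free.span_base intro: free_span_mult_closed)
qed

lemma I_w_closed:
  "0 \<in> I_w" "f \<in> I_w \<Longrightarrow> g \<in> I_w \<Longrightarrow> f + g \<in> I_w" "f \<in> I_w \<Longrightarrow> h * f \<in> I_w" "f \<in> I_w \<Longrightarrow> f * h \<in> I_w"
  "f \<in> I_w \<Longrightarrow> g \<in> I_w \<Longrightarrow> f - g \<in> I_w"
proof -
  show "f \<in> I_w \<Longrightarrow> g \<in> I_w \<Longrightarrow> f - g \<in> I_w" by (simp add: I_w_iff eval_diff)
qed (use two_sided_ideal_I_w in \<open>auto simp: two_sided_ideal_def\<close>)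

lemma long_commutator_in_I_w:
  assumes "length js \<ge> 2" shows "long_commutator i js \<in> (I_w :: 'a::field free_alg set)"
proof -
  obtain j l js' where js: "js = j # l # js'" using assms by (auto simp: Suc_le_length_iff numeral_2_eq_2)
  have "commutator (comm_pair (i, j)) (var l) \<in> (I_w :: 'a free_alg set)"
    by (simp add: I_w_iff eval_triple_commutator)
  moreover have "foldl commutator f (map var js') \<in> I_w" if "f \<in> I_w" for f :: "'a free_alg"
    using that
  proof (induction js' arbitrary: f)
    case (Cons a js')
    have "commutator f (var a) \<in> I_w"
      unfolding commutator_def using Cons.prems by (intro I_w_closed)
    then show ?case using Cons.IH by simp
  qed simp
  ultimately show ?thesis by (simp add: long_commutator_def js comm_pair_def)
qed

lemma commutator_product_cases:
  assumes "\<forall>(i, js)\<in>set xs. js \<noteq> []"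
  shows "(prod_list (map (\<lambda>(i, js). long_commutator i js) xs) :: 'a::field free_alg) \<in> I_w
    \<or> (\<exists>c. prod_list (map (\<lambda>(i, js). long_commutator i js) xs) = (comm_prod c :: 'a free_alg)
      \<and> deg (concat (map (\<lambda>(i, js). i # js) xs)) = deg (concat (map (\<lambda>e. [fst e, snd e]) c)))"
  using assms
proof (induction xs)
  case Nil
  show ?case by (intro disjI2 exI[of _ "[]"]) simp
next
  case (Cons x xs)
  obtain i js where x: "x = (i, js)" by force
  show ?case
  proof (cases "length js \<ge> 2")
    case True
    then show ?thesis
      using long_commutator_in_I_w[OF True, of i, where 'a='a] by (simp add: x I_w_closed)
  next
    case False
    with Cons.prems obtain j where js: "js = [j]"
      by (cases js; cases "tl js") (auto simp: x)
    have lc: "long_commutator i js = (comm_pair (i, j) :: 'a free_alg)"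
      by (simp add: long_commutator_def js comm_pair_def)
    have "\<forall>(i, js)\<in>set xs. js \<noteq> []" using Cons.prems by simp
    from Cons.IH[OF this] show ?thesis
    proof (elim disjE exE conjE, goal_cases)
      case 1
      then show ?case by (simp add: x I_w_closed)
    next
      case (2 c)
      then show ?case
        by (intro disjI2 exI[of _ "(i, j) # c"]) (simp add: x lc[unfolded js] js)
    qed
  qed
qed

text \<open>A proper polynomial is a linear combination of products of commutators. Its part of degree \<open>n\<close> keeps
  exactly the products of degree \<open>n\<close>, and those with a factor of length at least three are weak
  identities.\<close>

lemma multihomogeneous_proper_span:
  assumes f: "f \<in> proper_polys" "multihomogeneous n f"
  shows "f \<in> free_span (I_w \<union> {comm_prod c | c. deg (concat (map (\<lambda>e. [fst e, snd e]) c)) = n})"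
    (is "f \<in> free_span ?A")
proof -
  have "f \<in> free_span commutator_products" using f(1) proper_polys_span by blast
  then have "homogeneous_part n f \<in> free_span ?A"
  proof (induction rule: free.span_induct_alt)
    case base
    have "homogeneous_part n 0 = (0 :: 'a free_alg)" by (simp add: homogeneous_part_def)
    then show ?case by (simp add: free.span_zero)
  next
    case (step c a y)
    then obtain xs where xs: "a = prod_list (map (\<lambda>(i, js). long_commutator i js) xs)" "\<forall>(i, js)\<in>set xs. js \<noteq> []"
      unfolding commutator_products_def by blast
    define m where "m = deg (concat (map (\<lambda>(i, js). i # js) xs))"
    have "multihomogeneous m a"
      unfolding xs(1) m_def
    proof (induction xs)
      case Nil
      show ?case using multihomogeneous_const[of "1 :: 'a"] by simp
    next
      case (Cons x xs)
      then show ?case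
        using multihomogeneous_mult[OF multihomogeneous_long_commutator Cons.IH]
        by (cases x) (simp add: add.assoc)
    qed
    then have a: "homogeneous_part n a = (if m = n then a else 0)"
      by (rule homogeneous_part_multihomogeneous)
    have "a \<in> free_span ?A" if "m = n"
      using commutator_product_cases[OF xs(2), where 'a='a] that unfolding xs(1)[symmetric] m_def[symmetric]
      by (intro free.span_base) auto
    with step show ?case
      by (auto simp: homogeneous_part_linear a free.span_zero intro!: free.span_add free.span_scale)
  qed
  then show ?thesis using homogeneous_part_multihomogeneous[OF f(2), of n] by simp
qed

section \<open>Symmetrized products\<close>

definition top_prod :: "(nat \<Rightarrow> 'a::comm_ring_1 grassmann^2^2) \<Rightarrow> nat list \<Rightarrow> 'a grassmann"
  where "top_prod w s = prod_list (map (\<lambda>i. w i $ 1 $ 2) s)"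

definition bot_prod :: "(nat \<Rightarrow> 'a::comm_ring_1 grassmann^2^2) \<Rightarrow> nat list \<Rightarrow> 'a grassmann"
  where "bot_prod w s = prod_list (map (\<lambda>i. w i $ 2 $ 1) s)"

text \<open>With \<open>b\<^sub>i\<close> and \<open>c\<^sub>i\<close> the off-diagonal entries of \<open>w\<^sub>i\<close>, this is the orbit sum of \<open>b\<^sub>s c\<^sub>t\<close> under the exchange of
  all \<open>b\<^sub>i\<close> with \<open>c\<^sub>i\<close>. Values of commutators are invariant under the exchange and have equal degrees
  in the \<open>b\<^sub>i\<close> and in the \<open>c\<^sub>i\<close>, which is why lists of equal length matter.\<close>

definition sym_prod :: "(nat \<Rightarrow> 'a::comm_ring_1 grassmann^2^2) \<Rightarrow> nat list \<Rightarrow> nat list \<Rightarrow> 'a grassmann"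
  where "sym_prod w s t = top_prod w s * bot_prod w t + bot_prod w s * top_prod w t"

lemma prod_simps [simp]: "top_prod w [] = 1" "bot_prod w [] = 1"
  "top_prod w (i # s) = w i $ 1 $ 2 * top_prod w s" "bot_prod w (i # s) = w i $ 2 $ 1 * bot_prod w s"
  by (simp_all add: top_prod_def bot_prod_def)

text \<open>The identity holds for all values in \<open>W\<close> at once. So two polynomials that represent the same
  function differ by a weak identity.\<close>

definition represents :: "'a::field free_alg \<Rightarrow> ((nat \<Rightarrow> 'a grassmann^2^2) \<Rightarrow> 'a grassmann) \<Rightarrow> bool"
  where "represents f g \<longleftrightarrow> (\<forall>w. admissible w \<longrightarrow> eval_poly w f = mat (g w))"

lemma mat_arith:
  "mat (g + h) = (mat g + mat h :: 'a::field grassmann^2^2)"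
  "mat (g - h) = (mat g - mat h :: 'a grassmann^2^2)"
  "scale_mat c (mat g) = (mat (scale_grassmann c g) :: 'a grassmann^2^2)"
  by (rule matrix_2_eqI; simp add: scale_grassmann_simps)+

lemma represents_closed:
  "represents f g \<Longrightarrow> represents f' g' \<Longrightarrow> represents (f + f') (\<lambda>w. g w + g' w)"
  "represents f g \<Longrightarrow> represents f' g' \<Longrightarrow> represents (f - f') (\<lambda>w. g w - g' w)"
  "represents f g \<Longrightarrow> represents f' g' \<Longrightarrow> represents (f * f') (\<lambda>w. g w * g' w)"
  "represents f g \<Longrightarrow> represents (scale_free c f) (\<lambda>w. scale_grassmann c (g w))"
  by (simp_all add: represents_def eval_add eval_diff eval_mult eval_scale mat_arith mat_mult_mat)

lemma represents_comm_pair: "represents (comm_pair e) (\<lambda>w. pairing w e)"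
  by (simp add: represents_def eval_comm_pair)

lemma represents_one: "represents 1 (\<lambda>_. 1)"
  by (simp add: represents_def eval_1)

lemma represents_cong:
  "represents f g \<Longrightarrow> (\<And>w. admissible w \<Longrightarrow> g w = g' w) \<Longrightarrow> represents f g'"
  by (simp add: represents_def)

lemma represents_unique: "represents f g \<Longrightarrow> represents f' g \<Longrightarrow> f - f' \<in> I_w"
  by (simp add: represents_def I_w_iff eval_diff)

lemma represents_zero_in_I_w: "represents f (\<lambda>_. 0) \<Longrightarrow> f \<in> I_w"
  by (simp add: represents_def I_w_iff)

lemma scale_grassmann_add: "scale_grassmann c (f - g) = scale_grassmann c f - scale_grassmann c g"
  "scale_grassmann c (- f) = - scale_grassmann c f"
  by (rule grassmann_eqI, simp add: coeff_simps algebra_simps)+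

lemma odd_list_commute:
  assumes "\<forall>x\<in>set xs. x \<in> grassmann_odd" "y \<in> grassmann_odd"
  shows "prod_list xs * y = scale_grassmann ((- 1) ^ length xs) (y * prod_list xs)"
  using assms(1)
proof (induction xs)
  case (Cons x xs)
  then have "prod_list (x # xs) * y = x * scale_grassmann ((- 1) ^ length xs) (y * prod_list xs)"
    by (simp add: mult.assoc)
  also have "\<dots> = scale_grassmann ((- 1) ^ length xs) (x * y * prod_list xs)"
    by (simp add: scale_grassmann_mult mult.assoc)
  also have "\<dots> = scale_grassmann ((- 1) ^ length (x # xs)) (y * prod_list (x # xs))"
    using odd_anticommute[of x y] Cons.prems assms(2)
    by (intro grassmann_eqI) (simp add: coeff_simps mult.assoc)
  finally show ?case .
qed (simp add: scale_grassmann_simps)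

lemma odd_lists_commute:
  assumes "\<forall>x\<in>set xs. x \<in> grassmann_odd" "\<forall>y\<in>set ys. y \<in> grassmann_odd"
  shows "prod_list xs * prod_list ys = scale_grassmann ((- 1) ^ (length xs * length ys)) (prod_list ys * prod_list xs)"
  using assms(2)
proof (induction ys)
  case (Cons y ys)
  have "prod_list xs * prod_list (y # ys) = prod_list xs * y * prod_list ys" by (simp add: mult.assoc)
  also have "\<dots> = scale_grassmann ((- 1) ^ length xs) (y * (prod_list xs * prod_list ys))"
    using Cons.prems by (simp add: odd_list_commute[OF assms(1)] scale_grassmann_mult mult.assoc)
  also have "\<dots> = scale_grassmann ((- 1) ^ (length xs * length (y # ys))) (prod_list (y # ys) * prod_list xs)"
    using Cons by (simp add: scale_grassmann_mult scale_grassmann_scale power_add mult.assoc)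
  finally show ?case .
qed (simp add: scale_grassmann_simps)

section \<open>Commutators generate the symmetrized products\<close>

lemma top_prod_odd: "admissible w \<Longrightarrow> \<forall>x\<in>set (map (\<lambda>i. w i $ 1 $ 2) s). x \<in> grassmann_odd"
  and bot_prod_odd: "admissible w \<Longrightarrow> \<forall>x\<in>set (map (\<lambda>i. w i $ 2 $ 1) s). x \<in> grassmann_odd"
  by (auto simp: admissibleD)

lemma prod_commute_one:
  assumes "admissible w"
  shows "top_prod w s * w i $ 2 $ 1 = scale_grassmann ((- 1) ^ length s) (w i $ 2 $ 1 * top_prod w s)"
    "bot_prod w s * w i $ 1 $ 2 = scale_grassmann ((- 1) ^ length s) (w i $ 1 $ 2 * bot_prod w s)"
  using odd_list_commute[OF top_prod_odd[OF assms, of s] admissibleD(4)[OF assms, of i]]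
    odd_list_commute[OF bot_prod_odd[OF assms, of s] admissibleD(3)[OF assms, of i]]
  by (simp_all add: top_prod_def bot_prod_def)

lemma sign_square: "((- 1) ^ n * (- 1) ^ n :: 'a::comm_ring_1) = 1"
  by (metis minus_one_power_iff mult_minus1 mult_1 minus_minus)

lemma sym_prod_Cons_right:
  assumes "admissible w"
  shows "w i $ 2 $ 1 * (top_prod w s * bot_prod w t) + w i $ 1 $ 2 * (bot_prod w s * top_prod w t)
    = scale_grassmann ((- 1) ^ length s) (sym_prod w s (i # t))"
proof -
  have "sym_prod w s (i # t) = (top_prod w s * w i $ 2 $ 1) * bot_prod w t + (bot_prod w s * w i $ 1 $ 2) * top_prod w t"
    by (simp add: sym_prod_def mult.assoc)
  also have "\<dots> = scale_grassmann ((- 1) ^ length s)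
    (w i $ 2 $ 1 * (top_prod w s * bot_prod w t) + w i $ 1 $ 2 * (bot_prod w s * top_prod w t))"
    by (simp add: prod_commute_one[OF assms] scale_grassmann_mult scale_grassmann_simps(1) mult.assoc)
  finally show ?thesis
    by (simp add: scale_grassmann_scale sign_square scale_grassmann_simps)
qed

text \<open>Write \<open>p = z x' y'\<close> and \<open>q = x y' z'\<close>, \<open>r = y z' x'\<close>. The three terms are \<open>p + r\<close>, \<open>p + q\<close> and
  \<open>-(q + r)\<close>: going around a triangle of exchanges leaves \<open>2 p\<close>.\<close>

lemma pairing_identity:
  fixes x y z x' y' z' :: "'a::comm_ring_1 grassmann"
  assumes odd: "x \<in> grassmann_odd" "y \<in> grassmann_odd" "z \<in> grassmann_odd"
    "x' \<in> grassmann_odd" "y' \<in> grassmann_odd" "z' \<in> grassmann_odd"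
  shows "- ((z * y' + z' * y) * x') + (z * x' + z' * x) * y' - (x * y' + x' * y) * z' = z * x' * y' + z * x' * y'"
proof -
  have anti: "f * g = - (g * f)" "f * (g * h) = - (g * (f * h))"
    if "f \<in> grassmann_odd" "g \<in> grassmann_odd" for f g h :: "'b::comm_ring_1 grassmann"
  proof -
    show *: "f * g = - (g * f)" using that by (rule odd_anticommute)
    have "f * (g * h) = f * g * h" by (simp add: mult.assoc)
    then show "f * (g * h) = - (g * (f * h))" unfolding * by (simp add: mult.assoc)
  qed
  have r: "y' * x' = - (x' * y')" "z' * (y * x') = - (y * (z' * x'))" "z' * (x * y') = - (x * (z' * y'))"
    "x' * (y * z') = - (y * (x' * z'))" "x' * z' = - (z' * x')" "z' * y' = - (y' * z')"
    by (rule anti; rule odd)+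
  show ?thesis
    by (simp add: distrib_right mult.assoc r)
qed

text \<open>This expresses a symmetrized product by shorter ones after division by two. It combines the
  preceding identity with its image under the exchange of \<open>b\<close> and \<open>c\<close>, which leaves the pairings
  unchanged.\<close>

lemma sym_prod_step:
  assumes w: "admissible w"
  shows "scale_grassmann ((- 1) ^ length s) (pairing w (z, x) * sym_prod w s (y # t)
      - pairing w (z, y) * sym_prod w s (x # t) - pairing w (x, y) * sym_prod w s (z # t))
    = sym_prod w (z # s) (x # y # t) + sym_prod w (z # s) (x # y # t)"
proof -
  note d = admissibleD(3,4)[OF w]
  define G where "G = top_prod w s * bot_prod w t"
  define G' where "G' = bot_prod w s * top_prod w t"
  let ?b = "\<lambda>i. w i $ 1 $ 2" and ?c = "\<lambda>i. w i $ 2 $ 1"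
  have even: "?c x * ?c y \<in> grassmann_even" "?b x * ?b y \<in> grassmann_even"
    by (simp_all add: odd_times_odd d)
  have T: "sym_prod w (z # s) (x # y # t) = ?b z * ?c x * ?c y * G + ?c z * ?b x * ?b y * G'"
  proof -
    have "top_prod w s * (?c x * (?c y * bot_prod w t)) = ?c x * (?c y * (top_prod w s * bot_prod w t))"
      using arg_cong[OF even_central[OF even(1), of "top_prod w s"], of "\<lambda>f. f * bot_prod w t"]
      by (simp add: mult.assoc)
    moreover have "bot_prod w s * (?b x * (?b y * top_prod w t)) = ?b x * (?b y * (bot_prod w s * top_prod w t))"
      using arg_cong[OF even_central[OF even(2), of "bot_prod w s"], of "\<lambda>f. f * top_prod w t"]
      by (simp add: mult.assoc)
    ultimately show ?thesis by (simp add: sym_prod_def G_def G'_def mult.assoc)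
  qed
  have X: "scale_grassmann ((- 1) ^ length s) (pairing w e * sym_prod w s (i # t))
    = pairing w e * ?c i * G + pairing w e * ?b i * G'" for e i
  proof -
    have "scale_grassmann ((- 1) ^ length s) (pairing w e * sym_prod w s (i # t))
      = pairing w e * scale_grassmann ((- 1) ^ length s) (sym_prod w s (i # t))"
      by (simp add: scale_grassmann_mult)
    also have "\<dots> = pairing w e * (?c i * G + ?b i * G')"
      by (simp only: sym_prod_Cons_right[OF w, symmetric] G_def G'_def)
    finally show ?thesis by (simp add: distrib_left mult.assoc)
  qed
  have sw: "pairing w (i, j) = ?c i * ?b j + ?b i * ?c j" for i j
    by (simp add: pairing_def add.commute)
  have "scale_grassmann ((- 1) ^ length s) (pairing w (z, x) * sym_prod w s (y # t)
      - pairing w (z, y) * sym_prod w s (x # t) - pairing w (x, y) * sym_prod w s (z # t))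
    = (- (pairing w (z, y) * ?c x) + pairing w (z, x) * ?c y - pairing w (x, y) * ?c z) * G
      + (- (pairing w (z, y) * ?b x) + pairing w (z, x) * ?b y - pairing w (x, y) * ?b z) * G'"
    unfolding scale_grassmann_add X by (simp add: algebra_simps)
  also have "- (pairing w (z, y) * ?c x) + pairing w (z, x) * ?c y - pairing w (x, y) * ?c z
    = ?b z * ?c x * ?c y + ?b z * ?c x * ?c y"
    unfolding pairing_def fst_conv snd_conv by (rule pairing_identity) (simp_all add: d)
  also have "- (pairing w (z, y) * ?b x) + pairing w (z, x) * ?b y - pairing w (x, y) * ?b z
    = ?c z * ?b x * ?b y + ?c z * ?b x * ?b y"
    unfolding sw by (rule pairing_identity) (simp_all add: d)
  finally show ?thesis by (simp add: T distrib_right add_ac)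
qed

definition component :: "nat \<Rightarrow> (nat \<Rightarrow>\<^sub>0 nat) \<Rightarrow> 'a::field free_alg set"
  where "component k n = {f \<in> B_polys k. multihomogeneous n f}"

lemma subalgebra_B_polys: "subalgebra (B_polys k)"
proof -
  have s: "subalgebra proper_polys" by (rule subalgebra_proper_polys)
  have add: "f + g \<in> polys_in k" if "f \<in> polys_in k" "g \<in> polys_in k" for f g :: "'a free_alg"
    using that keys_add[of f g] by (auto simp: polys_in_def)
  have mult: "f * g \<in> polys_in k" if "f \<in> polys_in k" "g \<in> polys_in k" for f g :: "'a free_alg"
    using that keys_mult[of f g] by (fastforce simp: polys_in_def plus_word_def)
  have scale: "scale_free c f \<in> polys_in k" if "f \<in> polys_in k" for c and f :: "'a free_alg"
    using that by (auto simp: polys_in_def in_keys_iff lookup_scale_free)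
  have "0 \<in> polys_in k" "1 \<in> polys_in k" by (simp_all add: polys_in_def)
  with s add mult scale show ?thesis
    by (auto simp: subalgebra_def B_polys_def free.subspace_def)
qed

lemma component_closed:
  "1 \<in> (component k 0 :: 'a::field free_alg set)"
  "(f :: 'a free_alg) \<in> component k n \<Longrightarrow> g \<in> component k n \<Longrightarrow> f + g \<in> component k n"
  "f \<in> component k n \<Longrightarrow> g \<in> component k n \<Longrightarrow> f - g \<in> component k n"
  "f \<in> component k n \<Longrightarrow> scale_free c f \<in> component k n"
  "f \<in> component k m \<Longrightarrow> g \<in> component k n \<Longrightarrow> f * g \<in> component k (m + n)"
proof -
  have B: "free_subspace (B_polys k :: 'a free_alg set)" "1 \<in> (B_polys k :: 'a free_alg set)"
    "\<And>f g :: 'a free_alg. f \<in> B_polys k \<Longrightarrow> g \<in> B_polys k \<Longrightarrow> f * g \<in> B_polys k"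
    using subalgebra_B_polys[of k, where 'a='a] by (auto simp: subalgebra_def)
  show "1 \<in> (component k 0 :: 'a free_alg set)"
    using B multihomogeneous_const[of "1 :: 'a"] by (simp add: component_def)
qed (use subalgebra_B_polys[of k, where 'a='a] in \<open>simp_all add: component_def subalgebra_def
      multihomogeneous_add multihomogeneous_minus multihomogeneous_scale multihomogeneous_mult
      free.subspace_add free.subspace_diff free.subspace_scale\<close>)

lemma comm_pair_component:
  assumes "i < k" "j < k" shows "comm_pair (i, j) \<in> component k (deg [i, j])"
proof -
  have "comm_pair (i, j) = long_commutator i [j]"
    by (simp add: comm_pair_def long_commutator_def)
  also have "\<dots> \<in> proper_polys"
    unfolding proper_polys_def by (rule hull_inc) blast
  finally have "comm_pair (i, j) \<in> (proper_polys :: 'a free_alg set)" .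
  moreover have "comm_pair (i, j) \<in> (polys_in k :: 'a free_alg set)"
  proof -
    have "comm_pair (i, j) = (Poly_Mapping.single (Word [i, j]) 1 - Poly_Mapping.single (Word [j, i]) 1 :: 'a free_alg)"
      by (simp add: comm_pair_def commutator_def var_def mult_single plus_word_def)
    then show ?thesis
      using assms keys_diff[of "Poly_Mapping.single (Word [i, j]) (1 :: 'a)" "Poly_Mapping.single (Word [j, i]) 1"]
      by (auto simp: polys_in_def)
  qed
  moreover have "multihomogeneous (deg [i, j]) (comm_pair (i, j) :: 'a free_alg)"
    using multihomogeneous_commutator[OF multihomogeneous_var[of i] multihomogeneous_var[of j], where 'a='a]
    by (simp add: comm_pair_def)
  ultimately show ?thesis by (simp add: component_def B_polys_def)
qed

lemma represents_two: "represents (scale_free 2 1 :: 'a::field free_alg) (\<lambda>w. sym_prod w [] [])"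
proof -
  have "scale_grassmann 2 1 = (1 + 1 :: 'a grassmann)"
    using scale_grassmann_simps(2)[of 1 1 "1 :: 'a grassmann"] by (simp add: scale_grassmann_simps)
  then show ?thesis
    using represents_closed(4)[OF represents_one, of "2 :: 'a"] by (simp add: sym_prod_def)
qed

lemma sym_prod_realized:
  assumes two: "(2 :: 'a::field) \<noteq> 0" and "length s = length t" "set s \<union> set t \<subseteq> {..<k}"
  shows "\<exists>f \<in> component k (deg (s @ t)). represents (f :: 'a free_alg) (\<lambda>w. sym_prod w s t)"
  using assms(2,3)
proof (induction "length s" arbitrary: s t rule: less_induct)
  case less
  consider "s = []" | z x where "s = [z]" "t = [x]" | z s' x y t' where "s = z # s'" "s' \<noteq> []" "t = x # y # t'"
    using less.prems(1) by (cases s; cases t; cases "tl s"; cases "tl t") auto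
  then show ?case
  proof cases
    case 1
    with less.prems have "t = []" by simp
    then show ?thesis
      using 1 represents_two by (intro bexI[of _ "scale_free 2 1"]) (simp_all add: component_closed)
  next
    case 2
    have "represents (comm_pair (z, x) :: 'a free_alg) (\<lambda>w. pairing w (z, x))"
      by (rule represents_comm_pair)
    with 2 less.prems show ?thesis
      using comm_pair_component[of z k x, where 'a='a]
      by (intro bexI[of _ "comm_pair (z, x)"]) (auto simp: sym_prod_def pairing_def)
  next
    case 3
    have IH: "\<exists>f \<in> component k (deg (s' @ i # t')). represents (f :: 'a free_alg) (\<lambda>w. sym_prod w s' (i # t'))"
      if "i < k" for i
      using less.prems 3 that by (intro less.hyps) auto
    have xyz: "x < k" "y < k" "z < k" using less.prems(2) 3 by auto
    obtain fx fy fz :: "'a free_alg" where f: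
      "fx \<in> component k (deg (s' @ x # t'))" "represents fx (\<lambda>w. sym_prod w s' (x # t'))"
      "fy \<in> component k (deg (s' @ y # t'))" "represents fy (\<lambda>w. sym_prod w s' (y # t'))"
      "fz \<in> component k (deg (s' @ z # t'))" "represents fz (\<lambda>w. sym_prod w s' (z # t'))"
      using IH[OF xyz(1)] IH[OF xyz(2)] IH[OF xyz(3)] by blast
    define g where "g = scale_free (inverse 2 * (- 1) ^ length s')
      (comm_pair (z, x) * fy - comm_pair (z, y) * fx - comm_pair (x, y) * fz)"
    have d: "deg (s @ t) = deg [z, x] + deg (s' @ y # t')" "deg (s @ t) = deg [z, y] + deg (s' @ x # t')"
      "deg (s @ t) = deg [x, y] + deg (s' @ z # t')"
      by (simp_all add: 3 add_ac)
    have "comm_pair (z, x) * fy \<in> component k (deg (s @ t))"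
      unfolding d(1) by (intro component_closed(5) comm_pair_component xyz f)
    moreover have "comm_pair (z, y) * fx \<in> component k (deg (s @ t))"
      unfolding d(2) by (intro component_closed(5) comm_pair_component xyz f)
    moreover have "comm_pair (x, y) * fz \<in> component k (deg (s @ t))"
      unfolding d(3) by (intro component_closed(5) comm_pair_component xyz f)
    ultimately have "g \<in> component k (deg (s @ t))"
      unfolding g_def by (intro component_closed)
    moreover have "represents g (\<lambda>w. scale_grassmann (inverse 2 * (- 1) ^ length s') (pairing w (z, x) * sym_prod w s' (y # t')
      - pairing w (z, y) * sym_prod w s' (x # t') - pairing w (x, y) * sym_prod w s' (z # t')))"
      unfolding g_def by (intro represents_closed represents_comm_pair f)
    then have "represents g (\<lambda>w. sym_prod w s t)"
    proof (rule represents_cong)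
      fix w :: "nat \<Rightarrow> 'a grassmann^2^2" assume w: "admissible w"
      have half: "scale_grassmann (inverse 2) (h + h) = h" for h :: "'a grassmann"
      proof (rule grassmann_eqI)
        fix S
        have "inverse 2 * (a + a) = a" for a :: 'a using two by (simp add: field_simps)
        then show "coeff_grassmann (scale_grassmann (inverse 2) (h + h)) S = coeff_grassmann h S"
          by (simp only: coeff_simps)
      qed
      show "scale_grassmann (inverse 2 * (- 1) ^ length s') (pairing w (z, x) * sym_prod w s' (y # t')
        - pairing w (z, y) * sym_prod w s' (x # t') - pairing w (x, y) * sym_prod w s' (z # t')) = sym_prod w s t"
        unfolding scale_grassmann_scale[symmetric] sym_prod_step[OF w] 3 half ..
    qed
    ultimately show ?thesis by blast
  qed
qed

text \<open>Conversely, the symmetrized products span a subspace that is closed under multiplication with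
  values of commutators.\<close>

lemma pairing_times_sym_prod:
  assumes w: "admissible w" and len: "length s = length t"
  shows "pairing w (x, y) * sym_prod w s t
    = scale_grassmann ((- 1) ^ length s) (sym_prod w (x # s) (y # t) - sym_prod w (y # s) (x # t))"
proof -
  note d = admissibleD(3,4)[OF w]
  let ?b = "\<lambda>i. w i $ 1 $ 2" and ?c = "\<lambda>i. w i $ 2 $ 1"
  let ?\<delta> = "(- 1 :: 'a) ^ length s"
  have P: "scale_grassmann ?\<delta> (sym_prod w (i # s) (j # t))
    = ?b i * ?c j * (top_prod w s * bot_prod w t) + ?c i * ?b j * (bot_prod w s * top_prod w t)" for i j
  proof -
    have "sym_prod w (i # s) (j # t) = ?b i * (top_prod w s * ?c j) * bot_prod w t + ?c i * (bot_prod w s * ?b j) * top_prod w t"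
      by (simp add: sym_prod_def mult.assoc)
    also have "\<dots> = scale_grassmann ?\<delta> (?b i * ?c j * (top_prod w s * bot_prod w t) + ?c i * ?b j * (bot_prod w s * top_prod w t))"
      by (simp add: prod_commute_one[OF w] scale_grassmann_mult scale_grassmann_simps(1) mult.assoc)
    finally show ?thesis by (simp add: scale_grassmann_scale sign_square scale_grassmann_simps)
  qed
  have anti: "?c x * ?b y = - (?b y * ?c x)" "?b x * ?c y = - (?c y * ?b x)"
    using d odd_anticommute by blast+
  have "pairing w (x, y) * sym_prod w s t
    = (?b x * ?c y + ?c x * ?b y) * (top_prod w s * bot_prod w t) + (?b x * ?c y + ?c x * ?b y) * (bot_prod w s * top_prod w t)"
    by (simp add: pairing_def sym_prod_def distrib_left)
  also have "\<dots> = (?b x * ?c y - ?b y * ?c x) * (top_prod w s * bot_prod w t) + (- (?c y * ?b x) + ?c x * ?b y) * (bot_prod w s * top_prod w t)"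
    by (simp add: anti)
  also have "\<dots> = scale_grassmann ?\<delta> (sym_prod w (x # s) (y # t)) - scale_grassmann ?\<delta> (sym_prod w (y # s) (x # t))"
    unfolding P by (simp add: algebra_simps)
  finally show ?thesis by (simp add: scale_grassmann_add)
qed

definition sym_span :: "(nat \<Rightarrow>\<^sub>0 nat) \<Rightarrow> 'a::field free_alg set"
  where "sym_span n = free_span (I_w \<union> {f. \<exists>s t. length s = length t \<and> deg (s @ t) = n \<and> represents f (\<lambda>w. sym_prod w s t)})"

lemma sym_span_closed:
  "f \<in> I_w \<Longrightarrow> f \<in> sym_span n"
  "f \<in> sym_span n \<Longrightarrow> g \<in> sym_span n \<Longrightarrow> f + g \<in> sym_span n"
  "f \<in> sym_span n \<Longrightarrow> g \<in> sym_span n \<Longrightarrow> f - g \<in> sym_span n"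
  "f \<in> sym_span n \<Longrightarrow> scale_free c f \<in> sym_span n"
  "length s = length t \<Longrightarrow> represents f (\<lambda>w. sym_prod w s t) \<Longrightarrow> f \<in> sym_span (deg (s @ t))"
  by (auto simp: sym_span_def free.span_add free.span_diff free.span_scale intro: free.span_base)

lemma comm_prod_sym_span:
  assumes two: "(2 :: 'a::field) \<noteq> 0"
  shows "(comm_prod c :: 'a free_alg) \<in> sym_span (deg (concat (map (\<lambda>e. [fst e, snd e]) c)))"
proof (induction c)
  case Nil
  have "scale_free 2 1 \<in> (sym_span (deg ([] @ [])) :: 'a free_alg set)"
    by (intro sym_span_closed(5) represents_two) simp
  then have "scale_free (inverse 2) (scale_free 2 1) \<in> (sym_span 0 :: 'a free_alg set)"
    by (simp only: sym_span_closed(4) deg_simps append_Nil)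
  then show ?case using two by simp
next
  case (Cons e c)
  obtain x y where e: "e = (x, y)" by force
  let ?n = "deg (concat (map (\<lambda>e. [fst e, snd e]) c))"
  have "comm_pair e * f \<in> sym_span (deg [x, y] + ?n)" if "f \<in> sym_span ?n" for f :: "'a free_alg"
    using that unfolding sym_span_def[of ?n]
  proof (induction rule: free.span_induct_alt)
    case base
    show ?case by (simp add: sym_span_closed(1) I_w_closed)
  next
    case (step k a g)
    have "comm_pair e * a \<in> sym_span (deg [x, y] + ?n)"
    proof (cases "a \<in> I_w")
      case True
      then show ?thesis by (intro sym_span_closed(1) I_w_closed)
    next
      case False
      with step(1) obtain s t where st: "length s = length t" "deg (s @ t) = ?n" "represents a (\<lambda>w. sym_prod w s t)"
        by blast
      obtain N where N: "set (x # y # s @ t) \<subseteq> {..<N}"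
        using finite_nat_set_iff_bounded[of "set (x # y # s @ t)"] by auto
      obtain f1 f2 :: "'a free_alg" where f: "represents f1 (\<lambda>w. sym_prod w (x # s) (y # t))"
        "represents f2 (\<lambda>w. sym_prod w (y # s) (x # t))"
        using sym_prod_realized[OF two, of "x # s" "y # t" N] sym_prod_realized[OF two, of "y # s" "x # t" N] N st(1)
        by auto
      have deg: "deg ((x # s) @ (y # t)) = deg [x, y] + ?n" "deg ((y # s) @ (x # t)) = deg [x, y] + ?n"
        by (simp_all add: st(2)[symmetric] add_ac)
      let ?h = "scale_free ((- 1) ^ length s) (f1 - f2)"
      have "represents (comm_pair e * a) (\<lambda>w. pairing w e * sym_prod w s t)"
        by (intro represents_closed represents_comm_pair st)
      then have "represents (comm_pair e * a)
        (\<lambda>w. scale_grassmann ((- 1) ^ length s) (sym_prod w (x # s) (y # t) - sym_prod w (y # s) (x # t)))"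
        by (rule represents_cong) (simp add: e pairing_times_sym_prod st(1))
      moreover have "represents ?h
        (\<lambda>w. scale_grassmann ((- 1) ^ length s) (sym_prod w (x # s) (y # t) - sym_prod w (y # s) (x # t)))"
        by (intro represents_closed f)
      ultimately have "comm_pair e * a - ?h \<in> I_w" by (rule represents_unique)
      moreover have "f1 \<in> sym_span (deg [x, y] + ?n)"
        unfolding deg(1)[symmetric] using f(1) st(1) by (intro sym_span_closed(5)) simp_all
      moreover have "f2 \<in> sym_span (deg [x, y] + ?n)"
        unfolding deg(2)[symmetric] using f(2) st(1) by (intro sym_span_closed(5)) simp_all
      ultimately have "comm_pair e * a - ?h \<in> I_w" "?h \<in> sym_span (deg [x, y] + ?n)"
        by (auto intro: sym_span_closed)
      then have "(comm_pair e * a - ?h) + ?h \<in> sym_span (deg [x, y] + ?n)"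
        by (intro sym_span_closed(2)) (simp_all only: sym_span_closed(1))
      then show ?thesis by simp
    qed
    with step show ?case
      by (simp add: distrib_left scale_free_mult sym_span_closed)
  qed
  from this[OF Cons] show ?case by (simp add: e add.assoc)
qed

text \<open>Together with the preceding realization, this identifies a component of \<open>B\<^sub>k\<close> modulo the weak
  identities with the span of the symmetrized products of its degree.\<close>

lemma component_sym_span:
  assumes two: "(2 :: 'a::field) \<noteq> 0" and f: "f \<in> component k n"
  shows "(f :: 'a free_alg) \<in> sym_span n"
proof -
  have "f \<in> free_span (I_w \<union> {comm_prod c | c. deg (concat (map (\<lambda>e. [fst e, snd e]) c)) = n})"
    using f by (intro multihomogeneous_proper_span) (auto simp: component_def B_polys_def)
  then show ?thesis
  proof (induction rule: free.span_induct_alt)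
    case base
    show ?case by (intro sym_span_closed(1) I_w_closed)
  next
    case (step c a y)
    from step(1) have "a \<in> sym_span n"
      using comm_prod_sym_span[OF two] sym_span_closed(1) by blast
    with step show ?case by (simp add: sym_span_closed)
  qed
qed

section \<open>A basis of each component\<close>

lemma odd_prod_insort:
  "\<exists>\<sigma>. (\<sigma> = 1 \<or> \<sigma> = (- 1 :: 'a::field)) \<and> (\<forall>v. (\<forall>j. v j \<in> grassmann_odd)
    \<longrightarrow> v i * prod_list (map v l) = scale_grassmann \<sigma> (prod_list (map v (insort i l))))"
proof (induction l)
  case Nil
  show ?case by (intro exI[of _ 1]) (simp add: scale_grassmann_simps)
next
  case (Cons j l)
  then obtain \<sigma> :: 'a where \<sigma>: "\<sigma> = 1 \<or> \<sigma> = - 1" "\<And>v. (\<forall>j. v j \<in> grassmann_odd) \<Longrightarrow>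
    v i * prod_list (map v l) = scale_grassmann \<sigma> (prod_list (map v (insort i l)))" by blast
  show ?case
  proof (cases "i \<le> j")
    case True
    then show ?thesis by (intro exI[of _ 1]) (simp add: scale_grassmann_simps)
  next
    case False
    have "v i * prod_list (map v (j # l)) = scale_grassmann (- \<sigma>) (prod_list (map v (insort i (j # l))))"
      if v: "\<forall>j. v j \<in> grassmann_odd" for v
    proof -
      have "v i * prod_list (map v (j # l)) = v i * v j * prod_list (map v l)" by (simp add: mult.assoc)
      also have "\<dots> = - (v j * (v i * prod_list (map v l)))"
        using odd_anticommute[of "v i" "v j"] v by (simp add: mult.assoc)
      also have "\<dots> = scale_grassmann (- \<sigma>) (prod_list (map v (insort i (j # l))))"
        using False by (intro grassmann_eqI) (simp add: \<sigma>(2)[OF v] scale_grassmann_mult coeff_simps)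
      finally show ?thesis .
    qed
    then show ?thesis using \<sigma>(1) by (intro exI[of _ "- \<sigma>"]) auto
  qed
qed

text \<open>The sign does not depend on \<open>v\<close>. This is why sorting affects both summands of a symmetrized product
  in the same way.\<close>

lemma odd_prod_sort:
  "\<exists>\<sigma>. (\<sigma> = 1 \<or> \<sigma> = (- 1 :: 'a::field)) \<and> (\<forall>v. (\<forall>j. v j \<in> grassmann_odd)
    \<longrightarrow> prod_list (map v l) = scale_grassmann \<sigma> (prod_list (map v (sort l))))"
proof (induction l)
  case Nil
  show ?case by (intro exI[of _ 1]) (simp add: scale_grassmann_simps)
next
  case (Cons i l)
  then obtain \<sigma> :: 'a where \<sigma>: "\<sigma> = 1 \<or> \<sigma> = - 1" "\<And>v. (\<forall>j. v j \<in> grassmann_odd) \<Longrightarrow>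
    prod_list (map v l) = scale_grassmann \<sigma> (prod_list (map v (sort l)))" by blast
  obtain \<tau> :: 'a where \<tau>: "\<tau> = 1 \<or> \<tau> = - 1" "\<And>v. (\<forall>j. v j \<in> grassmann_odd) \<Longrightarrow>
    v i * prod_list (map v (sort l)) = scale_grassmann \<tau> (prod_list (map v (insort i (sort l))))"
    using odd_prod_insort[of i "sort l", where 'a='a] by blast
  have "prod_list (map v (i # l)) = scale_grassmann (\<sigma> * \<tau>) (prod_list (map v (sort (i # l))))"
    if v: "\<forall>j. v j \<in> grassmann_odd" for v
    by (simp add: \<sigma>(2)[OF v] \<tau>(2)[OF v] scale_grassmann_mult scale_grassmann_scale)
  moreover have "\<sigma> * \<tau> = 1 \<or> \<sigma> * \<tau> = - 1" using \<sigma>(1) \<tau>(1) by auto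
  ultimately show ?case by blast
qed

lemma odd_prod_not_distinct:
  assumes "\<not> distinct l" "\<forall>j. v j \<in> grassmann_odd" and two: "(2 :: 'a::field) \<noteq> 0"
  shows "prod_list (map v l) = (0 :: 'a grassmann)"
proof -
  obtain xs ys zs y where l: "l = xs @ [y] @ ys @ [y] @ zs"
    using not_distinct_decomp[OF assms(1)] by blast
  have "prod_list (map v ys) * v y = scale_grassmann ((- 1) ^ length ys) (v y * prod_list (map v ys))"
    using odd_list_commute[of "map v ys" "v y"] assms(2) by auto
  then have "v y * (prod_list (map v ys) * v y) = 0"
    using odd_square[OF _ two, of "v y"] assms(2)
    by (simp add: scale_grassmann_mult scale_grassmann_simps flip: mult.assoc)
  then have "v y * prod_list (map v ys) * v y = 0" by (simp add: mult.assoc)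
  moreover have "prod_list (map v l)
    = prod_list (map v xs) * (v y * prod_list (map v ys) * v y) * prod_list (map v zs)"
    by (simp add: l mult.assoc)
  ultimately show ?thesis by simp
qed

definition sorted_rep :: "nat set \<Rightarrow> nat list"
  where "sorted_rep = sorted_list_of_set"

lemma sorted_rep_set: "distinct l \<Longrightarrow> sorted_rep (set l) = sort l"
  by (simp add: sorted_rep_def sorted_list_of_set_sort_remdups distinct_remdups_id)

lemma sym_prod_sort:
  assumes two: "(2 :: 'a::field) \<noteq> 0"
  shows "\<exists>\<sigma>. \<forall>w :: nat \<Rightarrow> 'a grassmann^2^2. admissible w \<longrightarrow> sym_prod w s t
    = (if distinct s \<and> distinct t then scale_grassmann \<sigma> (sym_prod w (sorted_rep (set s)) (sorted_rep (set t))) else 0)"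
proof -
  obtain \<sigma> :: 'a where \<sigma>: "\<And>v. (\<forall>j. v j \<in> grassmann_odd) \<Longrightarrow>
    prod_list (map v s) = scale_grassmann \<sigma> (prod_list (map v (sort s)))"
    using odd_prod_sort[of s, where 'a='a] by blast
  obtain \<tau> :: 'a where \<tau>: "\<And>v. (\<forall>j. v j \<in> grassmann_odd) \<Longrightarrow>
    prod_list (map v t) = scale_grassmann \<tau> (prod_list (map v (sort t)))"
    using odd_prod_sort[of t, where 'a='a] by blast
  show ?thesis
  proof (intro exI[of _ "\<sigma> * \<tau>"] allI impI)
    fix w :: "nat \<Rightarrow> 'a grassmann^2^2" assume w: "admissible w"
    have o: "\<forall>j. w j $ 1 $ 2 \<in> grassmann_odd" "\<forall>j. w j $ 2 $ 1 \<in> grassmann_odd"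
      using admissibleD[OF w] by auto
    show "sym_prod w s t = (if distinct s \<and> distinct t
      then scale_grassmann (\<sigma> * \<tau>) (sym_prod w (sorted_rep (set s)) (sorted_rep (set t))) else 0)"
    proof (cases "distinct s \<and> distinct t")
      case True
      have st: "top_prod w s = scale_grassmann \<sigma> (top_prod w (sort s))" "bot_prod w s = scale_grassmann \<sigma> (bot_prod w (sort s))"
        "top_prod w t = scale_grassmann \<tau> (top_prod w (sort t))" "bot_prod w t = scale_grassmann \<tau> (bot_prod w (sort t))"
        unfolding top_prod_def bot_prod_def
        using \<sigma>[OF o(1)] \<sigma>[OF o(2)] \<tau>[OF o(1)] \<tau>[OF o(2)] by simp_all
      show ?thesis
        using True unfolding sym_prod_def[of w s t] st
        by (simp add: sorted_rep_set sym_prod_def scale_grassmann_simps)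
    next
      case False
      then have "(top_prod w s = 0 \<and> bot_prod w s = 0) \<or> (top_prod w t = 0 \<and> bot_prod w t = 0)"
        unfolding top_prod_def bot_prod_def
        using odd_prod_not_distinct[OF _ o(1) two] odd_prod_not_distinct[OF _ o(2) two] by blast
      with False show ?thesis by (auto simp: sym_prod_def)
    qed
  qed
qed

lemma sym_prod_swap:
  assumes w: "admissible w" and "length s = length t"
  shows "sym_prod w s t = scale_grassmann ((- 1) ^ length s) (sym_prod w t s)"
proof -
  have sq: "(- 1 :: 'a) ^ (length s * length t) = (- 1) ^ length s"
    using assms(2) by (simp add: minus_one_power_iff)
  have "top_prod w s * bot_prod w t = scale_grassmann ((- 1) ^ length s) (bot_prod w t * top_prod w s)"
    "bot_prod w s * top_prod w t = scale_grassmann ((- 1) ^ length s) (top_prod w t * bot_prod w s)"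
    unfolding sq[symmetric] top_prod_def bot_prod_def
    using odd_lists_commute[OF top_prod_odd[OF w] bot_prod_odd[OF w], of s t]
      odd_lists_commute[OF bot_prod_odd[OF w] top_prod_odd[OF w], of s t] by simp_all
  then show ?thesis by (simp add: sym_prod_def scale_grassmann_simps add.commute)
qed

definition expo :: "nat set \<Rightarrow> nat \<Rightarrow>\<^sub>0 nat"
  where "expo S = (\<Sum>i\<in>S. Poly_Mapping.single i 1)"

lemma expo_set: "distinct l \<Longrightarrow> expo (set l) = deg l"
  by (simp add: expo_def deg_def sum_list_distinct_conv_sum_set)

lemma expo_eq_deg: "finite S \<Longrightarrow> expo S = deg (sorted_rep S)"
  using expo_set[of "sorted_rep S"] by (simp add: sorted_rep_def)

definition pairs :: "nat \<Rightarrow> (nat \<Rightarrow>\<^sub>0 nat) \<Rightarrow> (nat set \<times> nat set) set"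
  where "pairs k n = {(S, T). S \<subseteq> {..<k} \<and> T \<subseteq> {..<k} \<and> card S = card T \<and> expo S + expo T = n}"

text \<open>One pair from each orbit of the swap \<open>(S, T) \<mapsto> (T, S)\<close>; the fixed pairs with \<open>card S\<close>
  odd are discarded, since their symmetrized product vanishes.\<close>

definition reps :: "nat \<Rightarrow> (nat \<Rightarrow>\<^sub>0 nat) \<Rightarrow> (nat set \<times> nat set) set"
  where "reps k n = {(S, T) \<in> pairs k n. set_encode S < set_encode T \<or> S = T \<and> even (card S)}"

lemma pairs_finite: "finite (pairs k n)"
  by (rule finite_subset[of _ "Pow {..<k} \<times> Pow {..<k}"]) (auto simp: pairs_def)

lemma reps_finite: "finite (reps k n)"
  by (rule finite_subset[OF _ pairs_finite[of k n]]) (auto simp: reps_def)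

lemma pairs_D:
  assumes "(S, T) \<in> pairs k n"
  shows "finite S" "finite T" "S \<subseteq> {..<k}" "T \<subseteq> {..<k}" "card S = card T" "expo S + expo T = n"
  using assms by (auto simp: pairs_def intro: finite_subset)

text \<open>The choice among the polynomials that represent the symmetrized product is immaterial, as they
  agree modulo the weak identities.\<close>

definition basis_poly :: "nat \<Rightarrow> nat set \<times> nat set \<Rightarrow> 'a::field free_alg"
  where "basis_poly k = (\<lambda>(S, T). SOME f. f \<in> component k (expo S + expo T)
    \<and> represents f (\<lambda>w. sym_prod w (sorted_rep S) (sorted_rep T)))"

lemma basis_poly:
  assumes two: "(2 :: 'a::field) \<noteq> 0" and ST: "(S, T) \<in> pairs k n"
  shows "(basis_poly k (S, T) :: 'a free_alg) \<in> component k n"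
    and "represents (basis_poly k (S, T) :: 'a free_alg) (\<lambda>w. sym_prod w (sorted_rep S) (sorted_rep T))"
proof -
  note d = pairs_D[OF ST]
  have "\<exists>f \<in> component k (deg (sorted_rep S @ sorted_rep T)). represents (f :: 'a free_alg) (\<lambda>w. sym_prod w (sorted_rep S) (sorted_rep T))"
    using d by (intro sym_prod_realized two) (auto simp: sorted_rep_def)
  then have "\<exists>f :: 'a free_alg. f \<in> component k (expo S + expo T) \<and> represents f (\<lambda>w. sym_prod w (sorted_rep S) (sorted_rep T))"
    using d by (auto simp: expo_eq_deg)
  from someI_ex[OF this] show "(basis_poly k (S, T) :: 'a free_alg) \<in> component k n"
    "represents (basis_poly k (S, T) :: 'a free_alg) (\<lambda>w. sym_prod w (sorted_rep S) (sorted_rep T))"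
    unfolding basis_poly_def by (simp_all add: d(6))
qed

lemma to_rel_arith:
  "to_rel (f + g) = to_rel f + to_rel g" "to_rel (scale_free c f) = scale_rel c (to_rel f)"
  "to_rel f = 0 \<longleftrightarrow> f \<in> I_w" "to_rel f = to_rel g \<longleftrightarrow> f - g \<in> I_w" "to_rel 0 = 0"
  by (simp_all add: plus_rel_free.abs_eq scale_rel.abs_eq rel_free.abs_eq_iff zero_rel_free.abs_eq zero_in_I_w)

lemma to_rel_sum: "to_rel (sum f A) = (\<Sum>a\<in>A. to_rel (f a))"
  by (induction A rule: infinite_finite_induct) (simp_all add: to_rel_arith)

lemma sym_prod_in_basis_span:
  assumes two: "(2 :: 'a::field) \<noteq> 0" and n: "Poly_Mapping.keys n \<subseteq> {..<k}"
    and st: "length s = length t" "deg (s @ t) = n"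
    and f: "represents (f :: 'a free_alg) (\<lambda>w. sym_prod w s t)"
  shows "to_rel f \<in> rel.span (to_rel ` basis_poly k ` reps k n)"
proof -
  obtain \<sigma> :: 'a where \<sigma>: "\<And>w. admissible w \<Longrightarrow> sym_prod w s t
    = (if distinct s \<and> distinct t then scale_grassmann \<sigma> (sym_prod w (sorted_rep (set s)) (sorted_rep (set t))) else 0)"
    using sym_prod_sort[OF two, of s t] by blast
  show ?thesis
  proof (cases "distinct s \<and> distinct t")
    case False
    with f \<sigma> have "represents f (\<lambda>_. 0)" by (auto elim!: represents_cong)
    then show ?thesis using represents_zero_in_I_w to_rel_arith(3) rel.span_zero by metis
  next
    case True
    define S T where "S = set s" and "T = set t"
    have "set (s @ t) = Poly_Mapping.keys n" unfolding st(2)[symmetric] by (rule keys_deg[symmetric])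
    with n have sub: "S \<subseteq> {..<k}" "T \<subseteq> {..<k}" by (auto simp: S_def T_def)
    have card: "card S = card T" using True st(1) by (simp add: S_def T_def distinct_card)
    have expo: "expo S + expo T = n" using True st(2) by (simp add: S_def T_def expo_set)
    have P: "(S, T) \<in> pairs k n" "(T, S) \<in> pairs k n"
      using sub card expo by (auto simp: pairs_def add.commute)
    have len: "length (sorted_rep S) = card S" "length (sorted_rep T) = card S"
      using card by (simp_all add: sorted_rep_def)
    have f': "represents f (\<lambda>w. scale_grassmann \<sigma> (sym_prod w (sorted_rep S) (sorted_rep T)))"
      using f by (rule represents_cong) (simp add: \<sigma> True S_def T_def)
    consider "(S, T) \<in> reps k n" | "(T, S) \<in> reps k n" | "S = T" "odd (card S)"
      using P inj_on_set_encode[THEN inj_onD, of S T] pairs_D(1,2)[OF P(1)]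
      by (auto simp: reps_def) (metis linorder_neqE_nat)
    then show ?thesis
    proof cases
      case 1
      have "represents (scale_free \<sigma> (basis_poly k (S, T))) (\<lambda>w. scale_grassmann \<sigma> (sym_prod w (sorted_rep S) (sorted_rep T)))"
        by (intro represents_closed basis_poly[OF two P(1)])
      with f' have "to_rel f = scale_rel \<sigma> (to_rel (basis_poly k (S, T)))"
        unfolding to_rel_arith(2)[symmetric] to_rel_arith(4) by (rule represents_unique)
      then show ?thesis using 1 by (simp add: rel.span_scale rel.span_base)
    next
      case 2
      let ?c = "\<sigma> * (- 1) ^ card S"
      have "represents (scale_free ?c (basis_poly k (T, S))) (\<lambda>w. scale_grassmann ?c (sym_prod w (sorted_rep T) (sorted_rep S)))"
        by (intro represents_closed basis_poly[OF two P(2)])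
      then have "represents (scale_free ?c (basis_poly k (T, S))) (\<lambda>w. scale_grassmann \<sigma> (sym_prod w (sorted_rep S) (sorted_rep T)))"
        by (rule represents_cong) (subst sym_prod_swap[of _ "sorted_rep S"], simp_all add: len scale_grassmann_scale)
      with f' have "to_rel f = scale_rel ?c (to_rel (basis_poly k (T, S)))"
        unfolding to_rel_arith(2)[symmetric] to_rel_arith(4) by (rule represents_unique)
      then show ?thesis using 2 by (simp add: rel.span_scale rel.span_base)
    next
      case 3
      have "sym_prod w (sorted_rep S) (sorted_rep S) = 0" if "admissible w" for w :: "nat \<Rightarrow> 'a grassmann^2^2"
      proof (rule grassmann_eqI)
        fix A
        let ?x = "coeff_grassmann (sym_prod w (sorted_rep S) (sorted_rep S)) A"
        have "sym_prod w (sorted_rep S) (sorted_rep S) = scale_grassmann (- 1) (sym_prod w (sorted_rep S) (sorted_rep S))"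
          using sym_prod_swap[OF that, of "sorted_rep S" "sorted_rep S"] 3 len by simp
        then have "?x = - 1 * ?x" by (metis scale_grassmann.rep_eq)
        then have "2 * ?x = 0" by (metis add.right_inverse mult_2 mult_minus1)
        with two have "?x = 0" by (metis mult_eq_0_iff)
        then show "?x = coeff_grassmann 0 A" by (simp only: zero_grassmann.rep_eq)
      qed
      then have "represents f (\<lambda>_. 0)"
        using f' 3(1) by (auto elim!: represents_cong simp: scale_grassmann_simps)
      then show ?thesis using represents_zero_in_I_w to_rel_arith(3) rel.span_zero by metis
    qed
  qed
qed

lemma component_in_basis_span:
  assumes two: "(2 :: 'a::field) \<noteq> 0" and n: "Poly_Mapping.keys n \<subseteq> {..<k}"
    and f: "f \<in> component k n"
  shows "to_rel (f :: 'a free_alg) \<in> rel.span (to_rel ` basis_poly k ` reps k n)"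
  using component_sym_span[OF two f] unfolding sym_span_def
proof (induction rule: free.span_induct_alt)
  case base
  show ?case by (simp add: to_rel_arith rel.span_zero)
next
  case (step c a y)
  have "to_rel a \<in> rel.span (to_rel ` basis_poly k ` reps k n)"
  proof (cases "a \<in> I_w")
    case True
    then have "to_rel a = 0" by (simp add: to_rel_arith)
    then show ?thesis by (simp add: rel.span_zero)
  next
    case False
    with step(1) show ?thesis using sym_prod_in_basis_span[OF two n] by blast
  qed
  with step show ?case by (simp add: to_rel_arith rel.span_add rel.span_scale)
qed

text \<open>Here all generators for the \<open>b\<^sub>i\<close> precede those for the \<open>c\<^sub>i\<close>, so that \<open>b\<^sub>S c\<^sub>T\<close> for sorted \<open>S\<close> and \<open>T\<close> is a
  basis element without a sign.\<close>

definition separated :: "nat \<Rightarrow> nat \<Rightarrow> 'a::field grassmann^2^2"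
  where "separated k i = offdiag (gen i) (gen (k + i))"

lemma admissible_separated: "admissible (separated k)"
  by (simp add: admissible_def M11_str0_def M11_def str_def separated_def grassmann_even_closed gen_odd)

text \<open>The indices of the generators in \<open>b\<^sub>S c\<^sub>T\<close> for the matrices above.\<close>

definition marked :: "nat \<Rightarrow> nat set \<times> nat set \<Rightarrow> nat set"
  where "marked k = (\<lambda>(S, T). S \<union> (\<lambda>i. k + i) ` T)"

lemma marked_inj:
  assumes "S \<subseteq> {..<k}" "T \<subseteq> {..<k}" "S' \<subseteq> {..<k}" "T' \<subseteq> {..<k}"
    and "marked k (S, T) = marked k (S', T')"
  shows "S = S' \<and> T = T'"
proof -
  have S: "marked k (S, T) \<inter> {..<k} = S" if "S \<subseteq> {..<k}" for S T
    using that by (auto simp: marked_def)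
  have T: "{i. k + i \<in> marked k (S, T)} = T" if "S \<subseteq> {..<k}" for S T
    using that by (auto simp: marked_def)
  show ?thesis using S[of S T] S[of S' T'] T[of S T] T[of S' T'] assms by metis
qed

lemma coeff_sym_prod_separated:
  assumes ST: "(S, T) \<in> pairs k n"
  shows "sym_prod (separated k) (sorted_rep S) (sorted_rep T)
    = (emon (marked k (S, T)) + scale_grassmann ((- 1) ^ card S) (emon (marked k (T, S))) :: 'a::field grassmann)"
proof -
  note d = pairs_D[OF ST]
  have prod: "top_prod (separated k) (sorted_rep S) * bot_prod (separated k) (sorted_rep T) = (emon (marked k (S, T)) :: 'a grassmann)"
    if "finite S" "finite T" "S \<subseteq> {..<k}" for S T
  proof -
    have "top_prod (separated k) (sorted_rep S) * bot_prod (separated k) (sorted_rep T)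
      = (gens (sorted_rep S @ map (\<lambda>i. k + i) (sorted_rep T)) :: 'a grassmann)"
      by (simp add: top_prod_def bot_prod_def separated_def gens_append gens_def comp_def)
    also have "\<dots> = emon (set (sorted_rep S @ map (\<lambda>i. k + i) (sorted_rep T)))"
    proof (rule gens_sorted)
      show "sorted (sorted_rep S @ map (\<lambda>i. k + i) (sorted_rep T))"
        using that by (auto simp: sorted_rep_def sorted_append intro!: sorted_map_mono mono_onI)
      show "distinct (sorted_rep S @ map (\<lambda>i. k + i) (sorted_rep T))"
        using that by (auto simp: sorted_rep_def distinct_map)
    qed
    finally show ?thesis using that by (simp add: sorted_rep_def marked_def)
  qed
  have len: "length (sorted_rep S) = card S" "length (sorted_rep T) = card S"
    using d(5) by (simp_all add: sorted_rep_def)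
  have "(- 1 :: 'a) ^ (card S * card S) = (- 1) ^ card S" by (simp add: minus_one_power_iff)
  then have "bot_prod (separated k) (sorted_rep S) * top_prod (separated k) (sorted_rep T)
    = scale_grassmann ((- 1) ^ card S) (top_prod (separated k) (sorted_rep T) * bot_prod (separated k) (sorted_rep S) :: 'a grassmann)"
    unfolding top_prod_def bot_prod_def
    using odd_lists_commute[OF bot_prod_odd[OF admissible_separated[of k, where 'a='a]]
        top_prod_odd[OF admissible_separated[of k]], of "sorted_rep S" "sorted_rep T"] len
    by simp
  then show ?thesis using d by (simp add: sym_prod_def prod)
qed

lemma basis_coefficient:
  assumes ST: "(S, T) \<in> reps k n" and ST': "(S', T') \<in> reps k n"
  shows "coeff_grassmann (sym_prod (separated k) (sorted_rep S) (sorted_rep T) :: 'a::field grassmann) (marked k (S', T'))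
    = (if (S, T) = (S', T') then if S = T then 2 else 1 else 0)"
proof -
  have P: "(S, T) \<in> pairs k n" "(S', T') \<in> pairs k n" using assms by (auto simp: reps_def)
  note d = pairs_D[OF P(1)] and d' = pairs_D[OF P(2)]
  have fin: "finite (marked k (S', T'))" using d' by (simp add: marked_def)
  have eq: "marked k (S', T') = marked k (S, T) \<longleftrightarrow> S' = S \<and> T' = T"
    "marked k (S', T') = marked k (T, S) \<longleftrightarrow> S' = T \<and> T' = S"
    using marked_inj[of S' k T' S T] marked_inj[of S' k T' T S] d d' by auto
  have "S = T" if "S' = T" "T' = S"
    using assms that by (auto simp: reps_def)
  moreover have "even (card S)" if "S = T" using ST that by (simp add: reps_def)
  ultimately show ?thesis
    unfolding coeff_sym_prod_separated[OF P(1)]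
    using fin by (auto simp: coeff_simps coeff_emon eq)
qed

text \<open>The coefficient at the monomial \<open>b\<^sub>S c\<^sub>T\<close> is a linear functional for each representative \<open>(S, T)\<close>. On
  the basis polynomials these functionals form a diagonal matrix with entries \<open>1\<close>, or \<open>2\<close> if \<open>S = T\<close>.\<close>

lemma dim_B_component:
  assumes two: "(2 :: 'a::field) \<noteq> 0" and n: "Poly_Mapping.keys n \<subseteq> {..<k}"
  shows "rel_dim (B_component k n :: 'a rel_free set) = card (reps k n)"
proof -
  let ?b = "\<lambda>r. to_rel (basis_poly k r) :: 'a rel_free"
  define \<phi> :: "nat set \<times> nat set \<Rightarrow> 'a free_alg \<Rightarrow> 'a" where "\<phi> r f = coeff_grassmann (eval_poly (separated k) f $ 1 $ 1) (marked k r)" for r f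
  have \<phi>0: "\<phi> r f = 0" if "f \<in> I_w" for r f
  proof -
    have "eval_poly (separated k) f = 0" using that admissible_separated unfolding I_w_iff by blast
    then show ?thesis by (simp add: \<phi>_def coeff_simps)
  qed
  have \<phi>b: "\<phi> r' (basis_poly k r) = (if r = r' then if fst r = snd r then 2 else 1 else 0)"
    if r: "r \<in> reps k n" "r' \<in> reps k n" for r r'
  proof -
    obtain S T S' T' where rr: "r = (S, T)" "r' = (S', T')" by force
    have "(S, T) \<in> pairs k n" using r rr by (simp add: reps_def)
    then have "represents (basis_poly k r :: 'a free_alg) (\<lambda>w. sym_prod w (sorted_rep S) (sorted_rep T))"
      using basis_poly(2)[OF two] rr by blast
    then have "eval_poly (separated k) (basis_poly k r :: 'a free_alg) = mat (sym_prod (separated k) (sorted_rep S) (sorted_rep T))"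
      using admissible_separated unfolding represents_def by blast
    then show ?thesis
      using basis_coefficient[of S T k n S' T', where 'a='a] r by (simp add: \<phi>_def rr)
  qed
  have indep: "\<forall>r\<in>reps k n. u r = 0" if "(\<Sum>r\<in>reps k n. scale_rel (u r) (?b r)) = 0" for u
  proof
    fix r' assume r': "r' \<in> reps k n"
    have "to_rel (\<Sum>r\<in>reps k n. scale_free (u r) (basis_poly k r)) = (0 :: 'a rel_free)"
      using that by (simp add: to_rel_sum to_rel_arith)
    then have "0 = \<phi> r' (\<Sum>r\<in>reps k n. scale_free (u r) (basis_poly k r))"
      using \<phi>0 by (simp add: to_rel_arith)
    also have "\<dots> = (\<Sum>r\<in>reps k n. u r * \<phi> r' (basis_poly k r))"
      by (simp add: \<phi>_def eval_sum eval_scale coeff_grassmann_sum coeff_simps)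
    also have "\<dots> = (\<Sum>r\<in>reps k n. if r = r' then u r * (if fst r = snd r then 2 else 1) else 0)"
      using \<phi>b r' by (intro sum.cong) auto
    also have "\<dots> = u r' * (if fst r' = snd r' then 2 else 1)"
      using r' reps_finite by simp
    finally show "u r' = 0" using two by (auto split: if_splits)
  qed
  have inj: "inj_on ?b (reps k n)"
  proof (rule inj_onI)
    fix r r' assume r: "r \<in> reps k n" "r' \<in> reps k n" "?b r = ?b r'"
    show "r = r'"
    proof (rule ccontr)
      assume ne: "r \<noteq> r'"
      have "basis_poly k r - basis_poly k r' \<in> (I_w :: 'a free_alg set)" using r(3) to_rel_arith(4) by blast
      then have "\<phi> r (basis_poly k r - basis_poly k r') = 0" by (rule \<phi>0)
      moreover have "\<phi> r (basis_poly k r - basis_poly k r') = \<phi> r (basis_poly k r) - \<phi> r (basis_poly k r')"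
        by (simp add: \<phi>_def eval_diff coeff_simps)
      ultimately show False using \<phi>b[of r r] \<phi>b[of r' r] r ne two by (simp split: if_splits)
    qed
  qed
  show ?thesis
  proof (rule rel.dim_unique)
    show "?b ` reps k n \<subseteq> B_component k n"
      using basis_poly(1)[OF two] by (fastforce simp: B_component_def component_def reps_def)
    show "B_component k n \<subseteq> rel.span (?b ` reps k n)"
      using component_in_basis_span[OF two n] by (auto simp: B_component_def component_def image_image)
    show "rel.independent (?b ` reps k n)"
    proof (rule rel.independent_if_scalars_zero)
      show "finite (?b ` reps k n)" using reps_finite by simp
      fix u x assume u: "(\<Sum>x\<in>?b ` reps k n. scale_rel (u x) x) = 0" and x: "x \<in> ?b ` reps k n"
      have "(\<Sum>r\<in>reps k n. scale_rel (u (?b r)) (?b r)) = 0"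
        using u inj by (simp add: sum.reindex)
      from indep[OF this] x show "u x = 0" by auto
    qed
    show "card (?b ` reps k n) = card (reps k n)" by (rule card_image[OF inj])
  qed
qed

section \<open>Coefficients of the Hilbert series\<close>

lemma prod_tvar:
  assumes "finite S"
  shows "(\<Prod>j\<in>S. tvar j) = Poly_Mapping.single (expo S) 1"
    "(\<Prod>j\<in>S. (tvar j)\<^sup>2) = Poly_Mapping.single (expo S + expo S) 1"
proof -
  show *: "(\<Prod>j\<in>S. tvar j) = Poly_Mapping.single (expo S) 1"
    using assms by (induction S) (simp_all add: expo_def tvar_def mult_single)
  show "(\<Prod>j\<in>S. (tvar j)\<^sup>2) = Poly_Mapping.single (expo S + expo S) 1"
    unfolding prod_power_distrib[symmetric] * by (simp add: power2_eq_square mult_single)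
qed

definition subsets :: "nat \<Rightarrow> nat \<Rightarrow> nat set set"
  where "subsets k i = {S. S \<subseteq> {..<k} \<and> card S = i}"

lemma elem_sym_tvar:
  "elem_sym k i tvar = (\<Sum>S\<in>subsets k i. Poly_Mapping.single (expo S) 1)"
  "elem_sym k i (\<lambda>j. (tvar j)\<^sup>2) = (\<Sum>S\<in>subsets k i. Poly_Mapping.single (expo S + expo S) 1)"
  unfolding elem_sym_def subsets_def
  by (rule sum.cong; auto intro!: prod_tvar intro: finite_subset)+

lemma lookup_elem_sym_square:
  "Poly_Mapping.lookup ((elem_sym k i tvar)\<^sup>2) n
    = (\<Sum>(S, T)\<in>subsets k i \<times> subsets k i. if expo S + expo T = n then 1 else 0)"
  unfolding power2_eq_square elem_sym_tvar sum_product mult_single sum.cartesian_product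
  by (simp add: lookup_sum lookup_single when_def case_prod_unfold)

lemma lookup_elem_sym_sign:
  "Poly_Mapping.lookup ((- 1) ^ i * elem_sym k i (\<lambda>j. (tvar j)\<^sup>2)) n
    = (\<Sum>S\<in>subsets k i. if expo S + expo S = n then (- 1) ^ i else 0)"
  by (cases "even i") (simp_all add: elem_sym_tvar lookup_sum lookup_single when_def sum_negf[symmetric] if_distrib cong: if_cong)

lemma lookup_mpoly_const_mult:
  "Poly_Mapping.lookup (mpoly_const c * f) n = c * Poly_Mapping.lookup f n"
proof -
  have f: "f = (\<Sum>m\<in>Poly_Mapping.keys f. Poly_Mapping.single m (Poly_Mapping.lookup f m))"
    by (rule poly_mapping_eqI) (auto simp: lookup_sum lookup_single when_def sum.delta' in_keys_iff)
  have "mpoly_const c * f = (\<Sum>m\<in>Poly_Mapping.keys f. Poly_Mapping.single m (c * Poly_Mapping.lookup f m))"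
    by (subst f) (simp add: mpoly_const_def sum_distrib_left mult_single)
  then show ?thesis
    by (auto simp: lookup_sum lookup_single when_def in_keys_iff)
qed

text \<open>This is the orbit count for the swap of \<open>S\<close> and \<open>T\<close>, with a fixed pair weighted by the sign with which
  the swap acts on \<open>b\<^sub>S c\<^sub>S\<close>.\<close>

lemma card_reps:
  "of_nat (2 * card (reps k n)) = (of_nat (card (pairs k n))
    + (\<Sum>S | (S, S) \<in> pairs k n. (- 1) ^ card S) :: rat)"
proof -
  let ?D = "{S. (S, S) \<in> pairs k n}"
  let ?L = "{(S, T) \<in> pairs k n. set_encode S < set_encode T}"
  let ?G = "{(S, T) \<in> pairs k n. set_encode T < set_encode S}"
  have finD: "finite ?D" by (rule finite_subset[of _ "Pow {..<k}"]) (auto simp: pairs_def)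
  have finL: "finite ?L" "finite ?G" by (rule finite_subset[OF _ pairs_finite[of k n]]; auto)+
  have "?G = prod.swap ` ?L" by (auto simp: pairs_def image_iff add.commute)
  then have G: "card ?G = card ?L" by (simp add: card_image)
  have "pairs k n = (?L \<union> ?G) \<union> (\<lambda>S. (S, S)) ` ?D"
  proof (rule set_eqI)
    fix x :: "nat set \<times> nat set"
    obtain S T where x: "x = (S, T)" by force
    have "S = T \<or> set_encode S < set_encode T \<or> set_encode T < set_encode S" if "(S, T) \<in> pairs k n"
      using inj_on_set_encode[THEN inj_onD, of S T] pairs_D(1,2)[OF that] by (auto simp: neq_iff)
    then show "x \<in> pairs k n \<longleftrightarrow> x \<in> (?L \<union> ?G) \<union> (\<lambda>S. (S, S)) ` ?D" by (auto simp: x)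
  qed
  also have "card \<dots> = card (?L \<union> ?G) + card ((\<lambda>S. (S, S)) ` ?D)"
    using finL finD by (intro card_Un_disjoint) auto
  also have "card (?L \<union> ?G) = card ?L + card ?G"
    using finL by (intro card_Un_disjoint) auto
  also have "card ((\<lambda>S. (S, S)) ` ?D) = card ?D" by (intro card_image) (auto simp: inj_on_def)
  finally have pairs: "card (pairs k n) = 2 * card ?L + card ?D" using G by simp
  have "reps k n = ?L \<union> (\<lambda>S. (S, S)) ` {S \<in> ?D. even (card S)}" by (auto simp: reps_def)
  also have "card \<dots> = card ?L + card ((\<lambda>S. (S, S)) ` {S \<in> ?D. even (card S)})"
    using finL finD by (intro card_Un_disjoint) auto
  also have "card ((\<lambda>S. (S, S)) ` {S \<in> ?D. even (card S)}) = card {S \<in> ?D. even (card S)}"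
    by (intro card_image) (auto simp: inj_on_def)
  finally have reps: "card (reps k n) = card ?L + card {S \<in> ?D. even (card S)}" .
  have "of_nat (card ?D) + (\<Sum>S\<in>?D. (- 1) ^ card S) = (\<Sum>S\<in>?D. 1 + (- 1) ^ card S :: rat)"
    by (simp add: sum.distrib)
  also have "\<dots> = (\<Sum>S\<in>?D. if even (card S) then 2 else 0)" by (rule sum.cong) auto
  also have "\<dots> = (\<Sum>S\<in>{S \<in> ?D. even (card S)}. 2)"
    using finD by (simp add: sum.If_cases Int_def)
  also have "\<dots> = 2 * of_nat (card {S \<in> ?D. even (card S)})" by simp
  finally show ?thesis by (simp add: pairs reps)
qed

lemma keys_expo: "finite S \<Longrightarrow> Poly_Mapping.keys (expo S) = S"
  by (simp add: expo_eq_deg keys_deg sorted_rep_def)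

lemma hilbert_series_B_component:
  assumes two: "(2 :: 'a::field) \<noteq> 0"
  shows "hilbert_series k (B_component k :: _ \<Rightarrow> 'a rel_free set) =
    Poly_Mapping.lookup (mpoly_const (1 / 2) *
      (\<Sum>i\<le>k. (elem_sym k i tvar)\<^sup>2 + (- 1) ^ i * elem_sym k i (\<lambda>j. (tvar j)\<^sup>2)))"
proof
  fix n
  let ?X = "{(S, T). S \<subseteq> {..<k} \<and> T \<subseteq> {..<k} \<and> card S = card T}"
  have finX: "finite ?X" by (rule finite_subset[of _ "Pow {..<k} \<times> Pow {..<k}"]) auto
  have le: "card S \<le> k" if "S \<subseteq> {..<k}" for S using card_mono[OF _ that] by simp
  \<comment> \<open>The sum over \<open>i\<close> groups the pairs by their common cardinality.\<close>
  have fib: "{x \<in> ?X. card (fst x) = i} = subsets k i \<times> subsets k i" for i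
    by (auto simp: subsets_def)
  have "(\<Sum>i\<le>k. \<Sum>(S, T)\<in>subsets k i \<times> subsets k i. if expo S + expo T = n then 1 else 0)
    = (\<Sum>(S, T)\<in>?X. if expo S + expo T = n then 1 else (0::rat))"
    unfolding fib[symmetric] by (rule sum.group[OF finX]) (auto intro: le)
  also have "\<dots> = (\<Sum>x\<in>pairs k n. 1)"
    using finX by (intro sum.mono_neutral_cong_right) (auto simp: pairs_def split: if_splits)
  finally have sum1: "(\<Sum>i\<le>k. \<Sum>(S, T)\<in>subsets k i \<times> subsets k i. if expo S + expo T = n then 1 else 0)
    = (of_nat (card (pairs k n)) :: rat)" by simp
  have fib': "{S \<in> Pow {..<k}. card S = i} = subsets k i" for i by (auto simp: subsets_def)
  have "(\<Sum>i\<le>k. \<Sum>S\<in>subsets k i. if expo S + expo S = n then (- 1) ^ i else 0)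
    = (\<Sum>i\<le>k. \<Sum>S\<in>subsets k i. if expo S + expo S = n then (- 1) ^ card S else (0::rat))"
    by (intro sum.cong) (auto simp: subsets_def)
  also have "\<dots> = (\<Sum>S\<in>Pow {..<k}. if expo S + expo S = n then (- 1) ^ card S else 0)"
    unfolding fib'[symmetric] by (rule sum.group) (auto intro: le)
  also have "\<dots> = (\<Sum>S | (S, S) \<in> pairs k n. (- 1) ^ card S)"
    by (intro sum.mono_neutral_cong_right) (auto simp: pairs_def split: if_splits)
  finally have sum2: "(\<Sum>i\<le>k. \<Sum>S\<in>subsets k i. if expo S + expo S = n then (- 1) ^ i else 0)
    = (\<Sum>S | (S, S) \<in> pairs k n. (- 1) ^ card S :: rat)" .
  have "Poly_Mapping.lookup (mpoly_const (1 / 2) *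
      (\<Sum>i\<le>k. (elem_sym k i tvar)\<^sup>2 + (- 1) ^ i * elem_sym k i (\<lambda>j. (tvar j)\<^sup>2))) n
    = 1 / 2 * (of_nat (card (pairs k n)) + (\<Sum>S | (S, S) \<in> pairs k n. (- 1) ^ card S))"
    unfolding lookup_mpoly_const_mult lookup_sum lookup_add lookup_elem_sym_square lookup_elem_sym_sign
      sum.distrib sum1 sum2 ..
  also have "\<dots> = of_nat (card (reps k n))"
    unfolding card_reps[symmetric] by simp
  also have "\<dots> = hilbert_series k (B_component k :: _ \<Rightarrow> 'a rel_free set) n"
  proof (cases "Poly_Mapping.keys n \<subseteq> {..<k}")
    case True
    then show ?thesis by (simp add: hilbert_series_def dim_B_component[OF two])
  next
    case False
    have "pairs k n = {}"
    proof (rule equals0I)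
      fix x assume "x \<in> pairs k n"
      then obtain S T where ST: "(S, T) \<in> pairs k n" by (cases x) auto
      note d = pairs_D[OF ST]
      have "Poly_Mapping.keys n \<subseteq> {..<k}"
        using keys_add[of "expo S" "expo T"] d by (auto simp: keys_expo)
      with False show False by blast
    qed
    then have "reps k n = {}" by (auto simp: reps_def)
    with False show ?thesis by (simp add: hilbert_series_def)
  qed
  finally show "hilbert_series k (B_component k :: _ \<Rightarrow> 'a rel_free set) n
    = Poly_Mapping.lookup (mpoly_const (1 / 2) *
      (\<Sum>i\<le>k. (elem_sym k i tvar)\<^sup>2 + (- 1) ^ i * elem_sym k i (\<lambda>j. (tvar j)\<^sup>2))) n" ..
qed

theorem theorem7p2:
  assumes "infinite (UNIV :: 'a::field set)" and "CHAR('a) \<noteq> 2"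
  shows "(I_w :: 'a free_alg set) =
      Omega_generated {commutator (commutator (var 0) (var 1)) (var 2),
        commutator (var 1) (var 0) * commutator (var 2) (var 0) * commutator (var 3) (var 0)}
    \<and> (\<forall>k>0. hilbert_series k (B_component k :: _ \<Rightarrow> 'a rel_free set) =
        Poly_Mapping.lookup (mpoly_const (1 / 2) *
          (\<Sum>i\<le>k. (elem_sym k i tvar)\<^sup>2 + (- 1) ^ i * elem_sym k i (\<lambda>j. (tvar j)\<^sup>2))))"
proof (intro conjI allI impI)
  note two = two_neq_zero[OF assms(2)]
  show "(I_w :: 'a free_alg set) =
      Omega_generated {commutator (commutator (var 0) (var 1)) (var 2),
        commutator (var 1) (var 0) * commutator (var 2) (var 0) * commutator (var 3) (var 0)}"
    by (rule I_w_eq_Omega_generated[OF assms(1) two])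
  fix k :: nat
  show "hilbert_series k (B_component k :: _ \<Rightarrow> 'a rel_free set) =
        Poly_Mapping.lookup (mpoly_const (1 / 2) *
          (\<Sum>i\<le>k. (elem_sym k i tvar)\<^sup>2 + (- 1) ^ i * elem_sym k i (\<lambda>j. (tvar j)\<^sup>2)))"
    by (rule hilbert_series_B_component[OF two])
qed

end
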